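(* Let $K$ be a polytope in $\mathbb{R}^d$ (not necessarily convex) and let $\sigma$ be the surface measure supported on $\partial K$. Then $\sigma$ is frame-spectral; that is, there exist a countable set $\Lambda\subset\mathbb{R}^d$ and constants $0<A\le B<\infty$ such that $$A\int|f|^2\,d\sigma\le\sum_{\lambda\in\Lambda}\left|\int f(x)e^{-2\pi i\lambda\cdot x}\,d\sigma(x)\right|^2\le B\int|f|^2\,d\sigma\qquad\text{for all } f\in L^2(\sigma).$$
   Context: Polytopes need not be convex: a polytope is a bounded body in $\mathbb{R}^d$ whose boundary $\partial K$ is a finite union of $(d-1)$-dimensional facets, each a bounded Borel subset of positive $(d-1)$-dimensional Hausdorff measure of a $(d-1)$-dimensional affine hyperplane, distinct facets overlapping only in sets of $(d-1)$-dimensional Hausdorff measure zero. The surface measure is $\sigma=\mathcal{H}^{d-1}|_{\partial K}=\sum_{F}\mathcal{H}^{d-1}|_F$, the sum being over all facets $F$, where $\mathcal{H}^{d-1}$ is $(d-1)$-dimensional Hausdorff measure. *)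

theory Defs
  imports "HOL-Analysis.Analysis"
begin

text \<open>
  Hausdorff measure of integer dimension \<open>k\<close>, in the usual normalization (it agrees with Lebesgue
  measure on \<open>k\<close>-dimensional affine subspaces). The empty set gets weight \<open>0\<close> separately because for
  \<open>k = 0\<close> the general formula would give it \<open>0 ^ 0 = 1\<close>; nonempty sets do get weight \<open>1\<close> then.
  Covering sets are required to be bounded because \<^const>\<open>diameter\<close> is only meaningful on these.
\<close>

definition hausdorff_weight :: "nat \<Rightarrow> 'a::metric_space set \<Rightarrow> ennreal" where
  "hausdorff_weight k U =
     (if U = {} then 0 else ennreal (unit_ball_vol (real k) * (diameter U / 2) ^ k))"

definition hausdorff_premeasure :: "nat \<Rightarrow> real \<Rightarrow> 'a::metric_space set \<Rightarrow> ennreal" where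
  "hausdorff_premeasure k \<delta> A =
     (INF U \<in> {U :: nat \<Rightarrow> 'a set. A \<subseteq> (\<Union>i. U i) \<and> (\<forall>i. bounded (U i) \<and> diameter (U i) \<le> \<delta>)}.
        \<Sum>i. hausdorff_weight k (U i))"

definition hausdorff_outer :: "nat \<Rightarrow> 'a::metric_space set \<Rightarrow> ennreal" where
  "hausdorff_outer k A = (SUP \<delta> \<in> {0<..}. hausdorff_premeasure k \<delta> A)"

text \<open>
  \<^const>\<open>hausdorff_outer\<close> is a metric outer measure, hence countably additive on the Borel sets;
  so the default of \<^const>\<open>measure_of\<close> for non-measures (the null measure) does not occur here.
\<close>

definition hausdorff_measure :: "nat \<Rightarrow> 'a::metric_space measure" where
  "hausdorff_measure k = measure_of UNIV (sets borel) (hausdorff_outer k)"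

definition polytope_facet :: "'a::euclidean_space set \<Rightarrow> bool" where
  "polytope_facet F \<longleftrightarrow>
     bounded F \<and> F \<in> sets borel \<and>
     (\<exists>a b. a \<noteq> 0 \<and> F \<subseteq> {x. a \<bullet> x = b}) \<and>
     emeasure (hausdorff_measure (DIM('a) - 1)) F > 0"

text \<open>
  Not necessarily convex polytopes; the library's \<^const>\<open>polytope\<close> is the convex notion. A body is
  a set with nonempty interior.
\<close>

definition general_polytope :: "'a::euclidean_space set \<Rightarrow> bool" where
  "general_polytope K \<longleftrightarrow>
     bounded K \<and> interior K \<noteq> {} \<and>
     (\<exists>\<F>. finite \<F> \<and> (\<forall>F\<in>\<F>. polytope_facet F) \<and> frontier K = \<Union>\<F> \<and>
          (\<forall>F\<in>\<F>. \<forall>G\<in>\<F>. F \<noteq> G \<longrightarrow> emeasure (hausdorff_measure (DIM('a) - 1)) (F \<inter> G) = 0))"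

text \<open>The restriction of Hausdorff measure to the boundary, as a Borel measure on the whole space.\<close>

definition surface_measure :: "'a::euclidean_space set \<Rightarrow> 'a measure" where
  "surface_measure K = density (hausdorff_measure (DIM('a) - 1)) (indicator (frontier K))"

definition square_integrable :: "'a measure \<Rightarrow> ('a \<Rightarrow> complex) \<Rightarrow> bool" where
  "square_integrable M f \<longleftrightarrow> f \<in> borel_measurable M \<and> integrable M (\<lambda>x. (cmod (f x))\<^sup>2)"

definition fourier_coeff :: "'a::euclidean_space measure \<Rightarrow> ('a \<Rightarrow> complex) \<Rightarrow> 'a \<Rightarrow> complex" where
  "fourier_coeff M f \<xi> =
     (\<integral>x. f x * exp (- 2 * complex_of_real pi * \<i> * complex_of_real (\<xi> \<bullet> x)) \<partial>M)"

text \<open>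
  The conjunct \<open>summable_on\<close> makes the upper bound assert convergence; otherwise \<^const>\<open>infsum\<close>
  would be \<open>0\<close> by convention.
\<close>

definition frame_spectral :: "'a::euclidean_space measure \<Rightarrow> bool" where
  "frame_spectral M \<longleftrightarrow>
     (\<exists>\<Lambda> A B. countable \<Lambda> \<and> 0 < A \<and> A \<le> B \<and>
        (\<forall>f. square_integrable M f \<longrightarrow>
           (\<lambda>\<xi>. (cmod (fourier_coeff M f \<xi>))\<^sup>2) summable_on \<Lambda> \<and>
           A * (\<integral>x. (cmod (f x))\<^sup>2 \<partial>M) \<le> (\<Sum>\<^sub>\<infinity>\<xi>\<in>\<Lambda>. (cmod (fourier_coeff M f \<xi>))\<^sup>2) \<and>
           (\<Sum>\<^sub>\<infinity>\<xi>\<in>\<Lambda>. (cmod (fourier_coeff M f \<xi>))\<^sup>2) \<le> B * (\<integral>x. (cmod (f x))\<^sup>2 \<partial>M)))"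

end

(*
  Let F_1, ..., F_p be the parts of the boundary lying in distinct hyperplanes H_j = {a_j . x = c_j}.
  For f_j on F_j, the modulus of the Fourier transform of f_j sigma is constant along the direction a_j,
  and on a sufficiently fine lattice of frequencies it satisfies Parseval's identity. For fixed i, attach
  to each lattice point lambda the frequencies lambda + (t(lambda) + m s) a_i with 0 <= m < N. Then
  (1) f_i contributes N times its Parseval sum;
  (2) if H_j is parallel to H_i, the N frequencies of a block separate f_i from f_j up to an error
      bounded independently of N (a geometric sum);
  (3) if H_j is not parallel to H_i, the exponentials are almost orthogonal on H_j: across blocks because
      t grows fast enough for the Riemann-Lebesgue lemma to make all cross terms summable, within a
      block because the row sums of the Gram matrix are o(N), again by Riemann-Lebesgue. So f_j
      contributes only o(N).
  For large N the union of these frequency sets over i is therefore a frame.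
*)
theory Submission
  imports Defs
begin

section \<open>Hausdorff measure on hyperplanes\<close>

text \<open>Hausdorff measure is never identified with Lebesgue measure. On a hyperplane only three
  facts about it are used: it lives there, it is finite on bounded sets, and it is invariant under
  translations along the hyperplane. No product structure is at hand, so orthogonality of the
  lattice exponentials and the Riemann-Lebesgue lemma both come from translating by half a period,
  which reverses the sign of the exponential.

  The order of the choices matters. The geometry fixes the step \<open>s\<close>, the separation
  error \<open>D\<close> and a lower constant \<open>V\<close> for each hyperplane; then \<epsilon>
  is taken small against all the \<open>V\<close>, then \<open>N\<close> large in terms of
  \<open>D\<close> and \<epsilon>, and only then the offsets \<open>t\<close> in terms of
  \<open>N\<close>. The set built for one hyperplane recovers that one component, up to \<epsilon>
  times the norm of all of \<open>f\<close>, so the lower bound emerges only from adding these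
  estimates.

  Facets in a common hyperplane are merged first: frequencies along the normal separate parallel
  hyperplanes, but not two functions on the same one.\<close>

lemma space_hausdorff_measure [simp]: "space (hausdorff_measure k) = UNIV"
  by (simp add: hausdorff_measure_def space_measure_of_conv)

lemma sets_hausdorff_measure [simp, measurable_cong]:
  "sets (hausdorff_measure k :: 'a::metric_space measure) = sets borel"
  unfolding hausdorff_measure_def
  by (metis sets_measure_of_conv sigma_algebra.sigma_sets_eq sets.sigma_algebra_axioms space_borel
      subset_UNIV Pow_UNIV)

text \<open>
  Inequality suffices below and, unlike equality, needs no countable additivity of the outer measure:
  if that failed, \<^const>\<open>measure_of\<close> would yield the null measure.
\<close>

lemma emeasure_hausdorff_measure_le:
  "emeasure (hausdorff_measure k) A \<le> hausdorff_outer k A"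
  by (simp add: hausdorff_measure_def emeasure_measure_of_conv)

section \<open>Translation invariance of Hausdorff measure\<close>

lemma diameter_translation:
  fixes v :: "'a::real_normed_vector"
  shows "diameter ((+) v ` U) = diameter U"
  by (simp add: diameter_def dist_norm image_image case_prod_unfold flip: image_paired_Times)

lemma hausdorff_weight_translation:
  fixes v :: "'a::real_normed_vector"
  shows "hausdorff_weight k ((+) v ` U) = hausdorff_weight k U"
  by (simp add: hausdorff_weight_def diameter_translation)

lemma hausdorff_outer_translation_le:
  fixes v :: "'a::real_normed_vector"
  shows "hausdorff_outer k ((+) v ` A) \<le> hausdorff_outer k A"
proof -
  have "hausdorff_premeasure k \<delta> ((+) v ` A) \<le> hausdorff_premeasure k \<delta> A" for \<delta>
    unfolding hausdorff_premeasure_def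
  proof (rule INF_mono)
    fix U :: "nat \<Rightarrow> 'a set"
    assume U: "U \<in> {U. A \<subseteq> (\<Union>i. U i) \<and> (\<forall>i. bounded (U i) \<and> diameter (U i) \<le> \<delta>)}"
    let ?V = "\<lambda>i. (+) v ` U i"
    have "?V \<in> {U. (+) v ` A \<subseteq> (\<Union>i. U i) \<and> (\<forall>i. bounded (U i) \<and> diameter (U i) \<le> \<delta>)}"
    proof -
      have "(+) v ` A \<subseteq> (+) v ` (\<Union>i. U i)" using U by blast
      then show ?thesis using U by (simp add: diameter_translation bounded_translation image_UN)
    qed
    moreover have "(\<Sum>i. hausdorff_weight k (?V i)) \<le> (\<Sum>i. hausdorff_weight k (U i))"
      by (simp add: hausdorff_weight_translation)
    ultimately show "\<exists>V\<in>{U. (+) v ` A \<subseteq> (\<Union>i. U i) \<and> (\<forall>i. bounded (U i) \<and> diameter (U i) \<le> \<delta>)}.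
       (\<Sum>i. hausdorff_weight k (V i)) \<le> (\<Sum>i. hausdorff_weight k (U i))"
      by (intro bexI[where x="?V"])
  qed
  then show ?thesis
    unfolding hausdorff_outer_def by (intro SUP_mono) auto
qed

lemma hausdorff_outer_translation:
  fixes v :: "'a::real_normed_vector"
  shows "hausdorff_outer k ((+) v ` A) = hausdorff_outer k A"
  using hausdorff_outer_translation_le[of k v A] hausdorff_outer_translation_le[of k "-v" "(+) v ` A"]
  by (simp add: image_image)

text \<open>Equality holds whether or not \<open>measure_of\<close> falls back to the null measure:
  both sets are Borel, so \<open>emeasure_measure_of_conv\<close> takes the same branch for them,
  and the outer measure is translation invariant.\<close>

lemma emeasure_hausdorff_measure_translation:
  fixes v :: "'a::euclidean_space"
  assumes A: "A \<in> sets borel"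
  shows "emeasure (hausdorff_measure k) ((+) v ` A) = emeasure (hausdorff_measure k) A"
proof -
  have "(+) v ` A = (\<lambda>x. x - v) -` A \<inter> space borel"
    by (auto simp: image_iff algebra_simps intro!: bexI[where x="_ - v"])
  also have "\<dots> \<in> sets borel"
    using A by measurable
  finally have "(+) v ` A \<in> sets borel" .
  moreover have "sigma_sets UNIV (sets borel) = sets (borel :: 'a measure)"
    by (metis sets.sigma_sets_eq space_borel)
  ultimately show ?thesis
    using A by (simp add: hausdorff_measure_def emeasure_measure_of_conv hausdorff_outer_translation)
qed

text \<open>Since \<open>a \<bullet> b \<noteq> 0\<close>, the hyperplane is a graph over the
  coordinates other than \<open>b\<close>, and the \<open>b\<close> coordinate is a Lipschitz
  function of them. Boxes in these coordinates thus control diameters; this serves the coverings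
  here and the period cell later.\<close>

lemma norm_diff_le_on_hyperplane:
  fixes a b :: "'a::euclidean_space"
  assumes b: "b \<in> Basis" "a \<bullet> b \<noteq> 0" and xy: "a \<bullet> x = a \<bullet> y"
    and d: "\<And>e. e \<in> Basis - {b} \<Longrightarrow> \<bar>x \<bullet> e - y \<bullet> e\<bar> \<le> d"
  shows "norm (x - y) \<le> (\<Sum>e\<in>Basis - {b}. 1 + \<bar>a \<bullet> e\<bar> / \<bar>a \<bullet> b\<bar>) * d"
proof -
  have "0 = a \<bullet> (x - y)" using xy by (simp add: inner_diff_right)
  also have "\<dots> = (\<Sum>e\<in>Basis. (a \<bullet> e) * ((x - y) \<bullet> e))"
    by (rule euclidean_inner)
  also have "\<dots> = (a \<bullet> b) * ((x - y) \<bullet> b) + (\<Sum>e\<in>Basis - {b}. (a \<bullet> e) * ((x - y) \<bullet> e))"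
    using b by (simp add: sum.remove)
  finally have "(x - y) \<bullet> b = - (\<Sum>e\<in>Basis - {b}. (a \<bullet> e) * ((x - y) \<bullet> e)) / (a \<bullet> b)"
    using b by (simp add: field_simps)
  then have "\<bar>(x - y) \<bullet> b\<bar> = \<bar>\<Sum>e\<in>Basis - {b}. (a \<bullet> e) * ((x - y) \<bullet> e)\<bar> / \<bar>a \<bullet> b\<bar>"
    by (simp add: abs_divide)
  also have "\<dots> \<le> (\<Sum>e\<in>Basis - {b}. \<bar>(a \<bullet> e) * ((x - y) \<bullet> e)\<bar>) / \<bar>a \<bullet> b\<bar>"
    by (intro divide_right_mono sum_abs) auto
  also have "\<dots> \<le> (\<Sum>e\<in>Basis - {b}. \<bar>a \<bullet> e\<bar> * d) / \<bar>a \<bullet> b\<bar>"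
    using d by (intro divide_right_mono sum_mono) (auto simp: abs_mult inner_diff_left intro!: mult_left_mono)
  also have "\<dots> = (\<Sum>e\<in>Basis - {b}. \<bar>a \<bullet> e\<bar> / \<bar>a \<bullet> b\<bar> * d)"
    by (simp add: sum_divide_distrib)
  finally have *: "\<bar>(x - y) \<bullet> b\<bar> \<le> (\<Sum>e\<in>Basis - {b}. \<bar>a \<bullet> e\<bar> / \<bar>a \<bullet> b\<bar> * d)" .
  have "norm (x - y) \<le> (\<Sum>e\<in>Basis. \<bar>(x - y) \<bullet> e\<bar>)"
    by (rule norm_le_l1)
  also have "\<dots> = \<bar>(x - y) \<bullet> b\<bar> + (\<Sum>e\<in>Basis - {b}. \<bar>(x - y) \<bullet> e\<bar>)"
    using b by (simp add: sum.remove)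
  also have "\<dots> \<le> (\<Sum>e\<in>Basis - {b}. \<bar>a \<bullet> e\<bar> / \<bar>a \<bullet> b\<bar> * d) + (\<Sum>e\<in>Basis - {b}. d)"
    using * d by (intro add_mono sum_mono) (auto simp: inner_diff_left)
  also have "\<dots> = (\<Sum>e\<in>Basis - {b}. (1 + \<bar>a \<bullet> e\<bar> / \<bar>a \<bullet> b\<bar>) * d)"
    by (simp add: sum.distrib ring_distribs)
  finally show ?thesis by (simp add: sum_distrib_right)
qed

lemma hausdorff_premeasure_le_card:
  assumes fin: "finite P" and cov: "A \<subseteq> \<Union>(U ` P)"
    and U: "\<And>p. p \<in> P \<Longrightarrow> bounded (U p) \<and> diameter (U p) \<le> d" and d: "0 \<le> d" "d \<le> \<delta>"
  shows "hausdorff_premeasure k \<delta> A \<le> ennreal (real (card P) * (unit_ball_vol (real k) * (d / 2) ^ k))"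
proof -
  obtain h where h: "bij_betw h {..<card P} P"
    using fin ex_bij_betw_nat_finite[OF fin] by (auto simp: atLeast0LessThan)
  \<comment> \<open>A cover indexed by a finite set is padded with empty sets. These have weight 0
    even for \<open>k = 0\<close>, which is where the special case in
    \<open>hausdorff_weight\<close> enters.\<close>
  define V where "V i = (if i < card P then U (h i) else {})" for i
  have hP: "h i \<in> P" if "i < card P" for i using h that by (auto simp: bij_betw_def)
  have "A \<subseteq> (\<Union>i. V i)"
  proof
    fix x assume "x \<in> A"
    then obtain p where "p \<in> P" "x \<in> U p" using cov by auto
    moreover from this obtain i where "i < card P" "h i = p"
      using bij_betw_imp_surj_on[OF h] by (metis imageE lessThan_iff)
    ultimately show "x \<in> (\<Union>i. V i)" by (auto simp: V_def)
  qed
  moreover have "bounded (V i) \<and> diameter (V i) \<le> \<delta>" for i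
    using U[OF hP] d by (fastforce simp: V_def)
  ultimately have "hausdorff_premeasure k \<delta> A \<le> (\<Sum>i. hausdorff_weight k (V i))"
    unfolding hausdorff_premeasure_def by (intro INF_lower) auto
  also have "\<dots> = (\<Sum>i<card P. hausdorff_weight k (V i))"
    by (intro suminf_finite) (auto simp: V_def hausdorff_weight_def)
  also have "\<dots> \<le> (\<Sum>i<card P. ennreal (unit_ball_vol (real k) * (d / 2) ^ k))"
  proof (intro sum_mono)
    fix i assume "i \<in> {..<card P}"
    then have "bounded (V i)" "diameter (V i) \<le> d" using U[OF hP] by (auto simp: V_def)
    then show "hausdorff_weight k (V i) \<le> ennreal (unit_ball_vol (real k) * (d / 2) ^ k)"
      by (auto simp: hausdorff_weight_def intro!: ennreal_leI mult_left_mono power_mono diameter_ge_0)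
  qed
  also have "\<dots> = ennreal (real (card P) * (unit_ball_vol (real k) * (d / 2) ^ k))"
    using d by (simp add: ennreal_mult ennreal_of_nat_eq_real_of_nat)
  finally show ?thesis .
qed

text \<open>Cutting a coordinate cube into \<open>n ^ k\<close> boxes, with \<open>k\<close> one
  less than the dimension, gives pieces of the hyperplane of diameter at most a constant over
  \<open>n\<close>. The powers of \<open>n\<close> cancel, so the bound does not depend on the scale
  \<delta>.\<close>

lemma hausdorff_outer_hyperplane_finite:
  fixes a :: "'a::euclidean_space"
  assumes a: "a \<noteq> 0" and S: "bounded S" "S \<subseteq> {x. a \<bullet> x = c}"
  shows "hausdorff_outer (DIM('a) - 1) S < \<infinity>"
proof -
  obtain b where b: "b \<in> Basis" "a \<bullet> b \<noteq> 0"
    using a by (metis euclidean_all_zero_iff)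
  obtain R where R: "R > 0" "\<And>x. x \<in> S \<Longrightarrow> norm x < R"
    using S(1) by (metis bounded_pos_less)
  define C where "C = (\<Sum>e\<in>Basis - {b}. 1 + \<bar>a \<bullet> e\<bar> / \<bar>a \<bullet> b\<bar>)"
  have C: "C \<ge> 0" unfolding C_def by (intro sum_nonneg) auto
  let ?k = "DIM('a) - 1"
  define W where "W = unit_ball_vol (real ?k) * (C * (2 * R) / 2) ^ ?k"
  have "hausdorff_premeasure ?k \<delta> S \<le> ennreal W" if \<delta>: "\<delta> > 0" for \<delta>
  proof -
    obtain n :: nat where n: "C * (2 * R) / \<delta> < real n" "n > 0"
    proof -
      obtain m :: nat where "C * (2 * R) / \<delta> < real m" using reals_Archimedean2 by blast
      then show ?thesis using that[of "Suc m"] by simp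
    qed
    define d where "d = C * (2 * R / n)"
    define P where "P = (Basis - {b} \<rightarrow>\<^sub>E {..<n})"
    define U where "U p = {x. a \<bullet> x = c \<and> (\<forall>e\<in>Basis - {b}. 
      - R + 2 * R / n * real (p e) \<le> x \<bullet> e \<and> x \<bullet> e \<le> - R + 2 * R / n * (real (p e) + 1))}" for p :: "'a \<Rightarrow> nat"
    have no: "norm (x - y) \<le> d" if "x \<in> U p" "y \<in> U p" for x y p
      unfolding d_def C_def
    proof (rule norm_diff_le_on_hyperplane[OF b])
      show "a \<bullet> x = a \<bullet> y" using that by (simp add: U_def)
      fix e assume "e \<in> Basis - {b}"
      then have "- R + 2 * R / n * real (p e) \<le> x \<bullet> e" "x \<bullet> e \<le> - R + 2 * R / n * (real (p e) + 1)"
        "- R + 2 * R / n * real (p e) \<le> y \<bullet> e" "y \<bullet> e \<le> - R + 2 * R / n * (real (p e) + 1)"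
        using that by (auto simp: U_def)
      then show "\<bar>x \<bullet> e - y \<bullet> e\<bar> \<le> 2 * R / real n"
        by (simp add: ring_distribs abs_le_iff)
    qed
    have d0: "0 \<le> d" using C R by (simp add: d_def)
    have "hausdorff_premeasure ?k \<delta> S \<le> ennreal (real (card P) * (unit_ball_vol (real ?k) * (d / 2) ^ ?k))"
    proof (rule hausdorff_premeasure_le_card)
      show "finite P" by (auto simp: P_def intro: finite_PiE)
      show "0 \<le> d" by fact
      show "d \<le> \<delta>" using n \<delta> by (simp add: d_def field_simps)
      show "S \<subseteq> \<Union>(U ` P)"
      proof
        fix x assume x: "x \<in> S"
        define p where "p = restrict (\<lambda>e. nat \<lfloor>(x \<bullet> e + R) * n / (2 * R)\<rfloor>) (Basis - {b})"
        have "p e < n \<and> - R + 2 * R / n * real (p e) \<le> x \<bullet> e \<and> x \<bullet> e \<le> - R + 2 * R / n * (real (p e) + 1)"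
          if e: "e \<in> Basis - {b}" for e
        proof -
          have "\<bar>x \<bullet> e\<bar> < R" using R(2)[OF x] Basis_le_norm[of e x] e by auto
          then have xe: "0 < x \<bullet> e + R" "x \<bullet> e + R < 2 * R" by auto
          \<comment> \<open>The position of \<open>x\<close> along \<open>e\<close> in units of the
            box side. The strict bound by \<open>R\<close> keeps it below \<open>n\<close>, so its
            floor is a legal index.\<close>
          define q where "q = (x \<bullet> e + R) * n / (2 * R)"
          have q: "0 \<le> q" "q < n" using xe n R by (auto simp: q_def divide_less_eq mult.commute)
          have pe: "p e = nat \<lfloor>q\<rfloor>" using e by (simp add: p_def q_def)
          have rp: "real (p e) = of_int \<lfloor>q\<rfloor>" using q by (simp add: pe)
          have "p e < n" using q by (simp add: pe nat_less_iff floor_less_iff)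
          moreover have qs: "real (p e) \<le> q" "q \<le> real (p e) + 1" unfolding rp by linarith+
          moreover have "x \<bullet> e = - R + 2 * R / n * q" using n R by (simp add: q_def)
          moreover have "2 * R / n * real (p e) \<le> 2 * R / n * q"
            "2 * R / n * q \<le> 2 * R / n * (real (p e) + 1)"
            using n R qs by (intro mult_left_mono; simp)+
          ultimately show ?thesis by linarith
        qed
        then have "p \<in> P" "x \<in> U p" using S(2) x by (auto simp: P_def U_def p_def)
        then show "x \<in> \<Union>(U ` P)" by blast
      qed
      fix p assume "p \<in> P"
      show "bounded (U p) \<and> diameter (U p) \<le> d"
      proof
        show "bounded (U p)"
        proof (cases "U p = {}")
          case False
          then obtain y where "y \<in> U p" by blast
          then show ?thesis unfolding bounded_def dist_norm using no by (metis norm_minus_commute)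
        qed simp
        show "diameter (U p) \<le> d" using no d0 by (intro diameter_le) auto
      qed
    qed
    also have "real (card P) * (unit_ball_vol (real ?k) * (d / 2) ^ ?k) = W"
      using b n by (simp add: P_def W_def d_def card_PiE card_Diff_singleton power_divide power_mult_distrib)
    finally show ?thesis .
  qed
  then have "hausdorff_outer ?k S \<le> ennreal W"
    unfolding hausdorff_outer_def by (intro SUP_least) auto
  then show ?thesis by (simp add: order_le_less_trans)
qed

section \<open>Characters and almost orthogonal systems\<close>

definition character :: "'a::real_inner \<Rightarrow> 'a \<Rightarrow> complex" where
  "character \<xi> x = exp (- 2 * complex_of_real pi * \<i> * complex_of_real (\<xi> \<bullet> x))"

lemma fourier_coeff_character: "fourier_coeff M f \<xi> = (\<integral>x. f x * character \<xi> x \<partial>M)"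
  by (simp add: fourier_coeff_def character_def)

lemma character_cis: "character \<xi> x = cis (- 2 * pi * (\<xi> \<bullet> x))"
  by (simp add: character_def cis_conv_exp algebra_simps)

lemma norm_character [simp]: "cmod (character \<xi> x) = 1"
  by (simp add: character_cis)

lemma character_zero_left [simp]: "character 0 x = 1"
  by (simp add: character_def)

lemma character_add_left: "character (\<xi> + \<eta>) x = character \<xi> x * character \<eta> x"
  by (simp add: character_cis cis_mult inner_add_left algebra_simps)

lemma character_add_right: "character \<xi> (x + y) = character \<xi> x * character \<xi> y"
  by (simp add: character_cis cis_mult inner_add_right algebra_simps)

lemma cnj_character: "cnj (character \<xi> x) = character (- \<xi>) x"
  by (simp add: character_cis cis_cnj)

lemma character_mult_cnj: "character \<xi> x * cnj (character \<eta> x) = character (\<xi> - \<eta>) x"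
  using character_add_left[of \<xi> "-\<eta>" x] by (simp add: cnj_character)

lemma borel_measurable_character [measurable]:
  "character \<xi> \<in> borel_measurable (borel :: 'a::euclidean_space measure)"
  unfolding character_def by measurable

section \<open>Integrals against characters and Bessel-type inequalities\<close>

lemma square_integrable_integrable:
  assumes "finite_measure M" "square_integrable M f"
  shows "integrable M f"
proof -
  have m [measurable]: "f \<in> borel_measurable M" and i: "integrable M (\<lambda>x. norm ((f x)\<^sup>2))"
    using assms(2) by (auto simp: square_integrable_def norm_power)
  have "(\<lambda>x. (f x)\<^sup>2) \<in> borel_measurable M" by measurable
  from integrable_norm_cancel[OF i this] show ?thesis
    by (rule finite_measure.square_integrable_imp_integrable[OF assms(1) m])
qed

lemma integrable_character:
  fixes M :: "'a::euclidean_space measure"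
  assumes "finite_measure M" "sets M = sets borel"
  shows "integrable M (character \<xi>)"
proof -
  interpret finite_measure M by fact
  show ?thesis
    using assms(2) by (intro integrable_const_bound[where B=1]) (auto cong: measurable_cong_sets)
qed

lemma integrable_mult_character:
  fixes M :: "'a::euclidean_space measure"
  assumes "integrable M f" "sets M = sets borel"
  shows "integrable M (\<lambda>x. f x * character \<xi> x)"
proof (rule Bochner_Integration.integrable_bound[OF assms(1)])
  have [measurable]: "f \<in> borel_measurable M" using assms(1) by auto
  have [measurable]: "character \<xi> \<in> borel_measurable M"
    using assms(2) by (simp cong: measurable_cong_sets)
  show "(\<lambda>x. f x * character \<xi> x) \<in> borel_measurable M" by measurable
qed (simp add: norm_mult)

lemma integral_norm_sq_diff_trig:
  fixes M :: "'a::euclidean_space measure" and \<xi> :: "'i \<Rightarrow> 'a"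
  assumes M: "finite_measure M" "sets M = sets borel" and f: "square_integrable M f"
    and S: "finite S"
  shows "(\<integral>x. (cmod (f x - (\<Sum>n\<in>S. p n * cnj (character (\<xi> n) x))))\<^sup>2 \<partial>M)
    = (\<integral>x. (cmod (f x))\<^sup>2 \<partial>M) - 2 * Re (\<Sum>n\<in>S. cnj (p n) * fourier_coeff M f (\<xi> n))
      + Re (\<Sum>n\<in>S. \<Sum>m\<in>S. p n * cnj (p m) * (\<integral>x. character (\<xi> m - \<xi> n) x \<partial>M))"
proof -
  have f_int: "integrable M f" by (rule square_integrable_integrable) fact+
  have i1: "integrable M (\<lambda>x. (cmod (f x))\<^sup>2)" using f by (simp add: square_integrable_def)
  define g where "g x = (\<Sum>n\<in>S. cnj (p n) * (f x * character (\<xi> n) x))" for x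
  define h where "h x = (\<Sum>n\<in>S. \<Sum>m\<in>S. p n * cnj (p m) * character (\<xi> m - \<xi> n) x)" for x
  have i2: "integrable M g"
    unfolding g_def by (intro Bochner_Integration.integrable_sum integrable_mult_right integrable_mult_character f_int M)
  have i3: "integrable M h"
    unfolding h_def by (intro Bochner_Integration.integrable_sum integrable_mult_right integrable_character M)
  have "(cmod (f x - (\<Sum>n\<in>S. p n * cnj (character (\<xi> n) x))))\<^sup>2
      = (cmod (f x))\<^sup>2 - 2 * Re (g x) + Re (h x)" for x
  proof -
    define P where "P = (\<Sum>n\<in>S. p n * cnj (character (\<xi> n) x))"
    have "f x * cnj P = g x"
      unfolding P_def g_def by (simp add: sum_distrib_left mult_ac)
    moreover have "P * cnj P = h x"
      unfolding P_def h_def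
      by (simp add: sum_product character_mult_cnj[symmetric] mult_ac)
    moreover have "(cmod (f x - P))\<^sup>2 = (cmod (f x))\<^sup>2 - 2 * Re (f x * cnj P) + Re (P * cnj P)"
      unfolding cmod_power2 by (simp add: power2_eq_square algebra_simps)
    ultimately show ?thesis by (simp add: P_def)
  qed
  then have "(\<integral>x. (cmod (f x - (\<Sum>n\<in>S. p n * cnj (character (\<xi> n) x))))\<^sup>2 \<partial>M)
     = (\<integral>x. (cmod (f x))\<^sup>2 - 2 * Re (g x) + Re (h x) \<partial>M)"
    by simp
  also have "\<dots> = (\<integral>x. (cmod (f x))\<^sup>2 \<partial>M) - 2 * Re (\<integral>x. g x \<partial>M) + Re (\<integral>x. h x \<partial>M)"
    using i1 i2 i3 by simp
  also have "(\<integral>x. g x \<partial>M) = (\<Sum>n\<in>S. cnj (p n) * fourier_coeff M f (\<xi> n))"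
    unfolding g_def fourier_coeff_character
    by (subst Bochner_Integration.integral_sum)
       (auto intro!: integrable_mult_right integrable_mult_character f_int M)
  also have "(\<integral>x. h x \<partial>M) = (\<Sum>n\<in>S. \<Sum>m\<in>S. p n * cnj (p m) * (\<integral>x. character (\<xi> m - \<xi> n) x \<partial>M))"
    unfolding h_def
    by (subst Bochner_Integration.integral_sum Bochner_Integration.integral_mult_right_zero;
        (intro Bochner_Integration.integrable_sum integrable_mult_right integrable_character M)?)+
       (auto intro!: sum.cong Bochner_Integration.integral_sum integrable_mult_right integrable_character M
             simp: Bochner_Integration.integral_sum integrable_character M)
  finally show ?thesis .
qed

text \<open>The Schur test without operators: row sums bound the quadratic form of the Gram matrix,
  and nonnegativity of the distance from \<open>f\<close> to one well chosen polynomial turns this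
  into a bound for the coefficients.\<close>

lemma bessel_almost_orthogonal:
  fixes M :: "'a::euclidean_space measure" and \<xi> :: "'i \<Rightarrow> 'a"
  assumes M: "finite_measure M" "sets M = sets borel" and f: "square_integrable M f"
    and S: "finite S" and C: "C > 0"
    and row: "\<And>n. n \<in> S \<Longrightarrow> (\<Sum>m\<in>S. cmod (\<integral>x. character (\<xi> m - \<xi> n) x \<partial>M)) \<le> C"
  shows "(\<Sum>n\<in>S. (cmod (fourier_coeff M f (\<xi> n)))\<^sup>2) \<le> C * (\<integral>x. (cmod (f x))\<^sup>2 \<partial>M)"
proof -
  define c where "c n = fourier_coeff M f (\<xi> n)" for n
  define g where "g n m = cmod (\<integral>x. character (\<xi> m - \<xi> n) x \<partial>M)" for n m
  define A where "A = (\<Sum>n\<in>S. (cmod (c n))\<^sup>2)"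
  have g_sym: "g n m = g m n" for n m
  proof -
    have "character (\<xi> n - \<xi> m) x = cnj (character (\<xi> m - \<xi> n) x)" for x
      by (simp add: cnj_character)
    then have "(\<integral>x. character (\<xi> n - \<xi> m) x \<partial>M) = cnj (\<integral>x. character (\<xi> m - \<xi> n) x \<partial>M)"
      by simp
    then show ?thesis by (simp add: g_def)
  qed
  \<comment> \<open>The polynomial has coefficients \<open>c n / C\<close>. Its quadratic term is
    then at most \<open>A / C\<close> and its linear term exactly \<open>2 * A / C\<close>, which
    leaves \<open>A / C\<close> below the squared norm of \<open>f\<close>.\<close>
  have "Re (\<Sum>n\<in>S. \<Sum>m\<in>S. (c n / C) * cnj (c m / C) * (\<integral>x. character (\<xi> m - \<xi> n) x \<partial>M))
     \<le> (\<Sum>n\<in>S. \<Sum>m\<in>S. cmod (c n) * cmod (c m) * g n m / C\<^sup>2)"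
    unfolding Re_sum
  proof (intro sum_mono)
    fix n m
    show "Re ((c n / C) * cnj (c m / C) * (\<integral>x. character (\<xi> m - \<xi> n) x \<partial>M)) \<le> cmod (c n) * cmod (c m) * g n m / C\<^sup>2"
      using C by (intro order_trans[OF complex_Re_le_cmod]) (simp add: norm_mult norm_divide g_def power2_eq_square)
  qed
  \<comment> \<open>The arithmetic-geometric mean splits the products; as the moduli
    \<open>g\<close> are symmetric, the row sums suffice for both halves.\<close>
  also have "\<dots> \<le> (\<Sum>n\<in>S. \<Sum>m\<in>S. ((cmod (c n))\<^sup>2 * g n m + (cmod (c m))\<^sup>2 * g n m) / 2 / C\<^sup>2)"
  proof (intro sum_mono divide_right_mono)
    fix n m
    have "cmod (c n) * cmod (c m) \<le> ((cmod (c n))\<^sup>2 + (cmod (c m))\<^sup>2) / 2"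
      using sum_squares_bound[of "cmod (c n)" "cmod (c m)"] by simp
    then have "cmod (c n) * cmod (c m) * g n m \<le> ((cmod (c n))\<^sup>2 + (cmod (c m))\<^sup>2) / 2 * g n m"
      by (rule mult_right_mono) (simp add: g_def)
    then show "cmod (c n) * cmod (c m) * g n m \<le> ((cmod (c n))\<^sup>2 * g n m + (cmod (c m))\<^sup>2 * g n m) / 2"
      by (simp add: algebra_simps)
  qed simp
  also have "\<dots> = ((\<Sum>n\<in>S. \<Sum>m\<in>S. (cmod (c n))\<^sup>2 * g n m) + (\<Sum>n\<in>S. \<Sum>m\<in>S. (cmod (c m))\<^sup>2 * g n m)) / 2 / C\<^sup>2"
    by (simp add: sum.distrib sum_divide_distrib add_divide_distrib)
  also have "(\<Sum>n\<in>S. \<Sum>m\<in>S. (cmod (c m))\<^sup>2 * g n m) = (\<Sum>n\<in>S. \<Sum>m\<in>S. (cmod (c n))\<^sup>2 * g n m)"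
    by (subst sum.swap) (simp add: g_sym)
  also have "(\<Sum>n\<in>S. \<Sum>m\<in>S. (cmod (c n))\<^sup>2 * g n m) = (\<Sum>n\<in>S. (cmod (c n))\<^sup>2 * (\<Sum>m\<in>S. g n m))"
    by (simp add: sum_distrib_left)
  also have "((\<Sum>n\<in>S. (cmod (c n))\<^sup>2 * (\<Sum>m\<in>S. g n m)) + (\<Sum>n\<in>S. (cmod (c n))\<^sup>2 * (\<Sum>m\<in>S. g n m))) / 2 / C\<^sup>2
    \<le> ((\<Sum>n\<in>S. (cmod (c n))\<^sup>2 * C) + (\<Sum>n\<in>S. (cmod (c n))\<^sup>2 * C)) / 2 / C\<^sup>2"
    using row by (intro divide_right_mono add_mono sum_mono mult_left_mono) (auto simp: g_def)
  also have "\<dots> = A / C"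
    using C by (simp add: A_def power2_eq_square flip: sum_distrib_right)
  finally have 1: "Re (\<Sum>n\<in>S. \<Sum>m\<in>S. (c n / C) * cnj (c m / C) * (\<integral>x. character (\<xi> m - \<xi> n) x \<partial>M)) \<le> A / C" .
  have "Re (\<Sum>n\<in>S. cnj (c n / C) * c n) = (\<Sum>n\<in>S. (cmod (c n))\<^sup>2 / C)"
    unfolding Re_sum by (intro sum.cong refl) (simp add: cmod_power2, simp add: power2_eq_square add_divide_distrib)
  also have "\<dots> = A / C" by (simp add: A_def sum_divide_distrib)
  finally have 2: "Re (\<Sum>n\<in>S. cnj (c n / C) * c n) = A / C" .
  have "0 \<le> (\<integral>x. (cmod (f x - (\<Sum>n\<in>S. (c n / C) * cnj (character (\<xi> n) x))))\<^sup>2 \<partial>M)" by simp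
  also have "\<dots> \<le> (\<integral>x. (cmod (f x))\<^sup>2 \<partial>M) - 2 * (A / C) + A / C"
    unfolding integral_norm_sq_diff_trig[OF M f S] using 1 2 by (simp add: c_def)
  finally show ?thesis using C by (simp add: A_def c_def field_simps)
qed

text \<open>The coefficients \<open>p\<close> are arbitrary: the orthogonal projection is at least
  as good as any other polynomial, so every approximation, however found, bounds what the
  coefficients of \<open>f\<close> on \<open>S\<close> miss.\<close>

lemma best_approximation_orthogonal:
  fixes M :: "'a::euclidean_space measure" and \<xi> :: "'i \<Rightarrow> 'a"
  assumes M: "finite_measure M" "sets M = sets borel" and f: "square_integrable M f"
    and S: "finite S" and V: "V > 0"
    and orth: "\<And>n m. n \<in> S \<Longrightarrow> m \<in> S \<Longrightarrow>
      (\<integral>x. character (\<xi> m - \<xi> n) x \<partial>M) = (if n = m then complex_of_real V else 0)"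
  shows "V * (\<integral>x. (cmod (f x))\<^sup>2 \<partial>M) \<le> (\<Sum>n\<in>S. (cmod (fourier_coeff M f (\<xi> n)))\<^sup>2)
     + V * (\<integral>x. (cmod (f x - (\<Sum>n\<in>S. p n * cnj (character (\<xi> n) x))))\<^sup>2 \<partial>M)"
proof -
  define c where "c n = fourier_coeff M f (\<xi> n)" for n
  have "Re (\<Sum>n\<in>S. \<Sum>m\<in>S. p n * cnj (p m) * (\<integral>x. character (\<xi> m - \<xi> n) x \<partial>M))
     = Re (\<Sum>n\<in>S. \<Sum>m\<in>S. if n = m then p n * cnj (p m) * complex_of_real V else 0)"
    using orth by (intro arg_cong[where f=Re] sum.cong refl) auto
  also have "\<dots> = (\<Sum>n\<in>S. V * (cmod (p n))\<^sup>2)"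
    using S by (simp add: cmod_power2) (simp add: power2_eq_square algebra_simps)
  finally have 1: "Re (\<Sum>n\<in>S. \<Sum>m\<in>S. p n * cnj (p m) * (\<integral>x. character (\<xi> m - \<xi> n) x \<partial>M))
     = (\<Sum>n\<in>S. V * (cmod (p n))\<^sup>2)" .
  have "2 * V * Re (cnj (p n) * c n) \<le> (cmod (c n))\<^sup>2 + V * (V * (cmod (p n))\<^sup>2)" for n
  proof -
    have "2 * V * Re (cnj (p n) * c n) \<le> 2 * V * (cmod (p n) * cmod (c n))"
      using V complex_Re_le_cmod[of "cnj (p n) * c n"] by (simp add: norm_mult)
    also have "\<dots> \<le> (cmod (c n))\<^sup>2 + (V * cmod (p n))\<^sup>2"
      using sum_squares_bound[of "cmod (c n)" "V * cmod (p n)"] by (simp add: mult_ac)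
    finally show ?thesis by (simp add: power2_eq_square mult_ac)
  qed
  then have "(\<Sum>n\<in>S. 2 * V * Re (cnj (p n) * c n)) \<le> (\<Sum>n\<in>S. (cmod (c n))\<^sup>2 + V * (V * (cmod (p n))\<^sup>2))"
    by (intro sum_mono)
  then have "V * (2 * Re (\<Sum>n\<in>S. cnj (p n) * c n)) \<le> (\<Sum>n\<in>S. (cmod (c n))\<^sup>2) + V * (\<Sum>n\<in>S. V * (cmod (p n))\<^sup>2)"
    by (simp only: sum.distrib sum_distrib_left Re_sum mult_ac)
  then show ?thesis
    unfolding integral_norm_sq_diff_trig[OF M f S] 1 c_def by (simp add: algebra_simps)
qed

section \<open>Geometric sums and Cesaro means\<close>

lemma norm_geometric_sum_le:
  fixes w :: complex
  assumes "cmod w = 1" "w \<noteq> 1"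
  shows "cmod (\<Sum>m<N. w ^ m) \<le> 2 / cmod (1 - w)"
proof -
  have "cmod (\<Sum>m<N. w ^ m) = cmod (1 - w ^ N) / cmod (1 - w)"
    using assms by (simp add: sum_gp_strict norm_divide norm_minus_commute)
  also have "\<dots> \<le> 2 / cmod (1 - w)"
    using norm_triangle_ineq4[of 1 "w ^ N"] assms by (intro divide_right_mono) (auto simp: norm_power)
  finally show ?thesis .
qed

text \<open>After expanding the squares, the sum over \<open>m\<close> is \<open>N\<close> on the
  diagonal, and off it a geometric sum whose ratio \<open>w j * cnj (w k)\<close> differs from 1.
  \<open>D\<close> collects the bounds of the latter; being independent of \<open>N\<close> and
  \<open>z\<close>, it can be fixed before \<open>N\<close> is chosen.\<close>

lemma vandermonde_lower_bound:
  fixes w :: "'j \<Rightarrow> complex"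
  assumes J: "finite J" and w: "\<And>j. j \<in> J \<Longrightarrow> cmod (w j) = 1" and inj: "inj_on w J"
  obtains D :: real where "D \<ge> 0" "\<And>N z. (real N - D) * (\<Sum>j\<in>J. (cmod (z j))\<^sup>2)
    \<le> (\<Sum>m<N. (cmod (\<Sum>j\<in>J. w j ^ m * z j))\<^sup>2)"
proof
  define d where "d j k = (if j = k then 0 else 2 / cmod (1 - w j * cnj (w k)))" for j k
  define D where "D = (\<Sum>j\<in>J. \<Sum>k\<in>J. d j k)"
  have d0: "d j k \<ge> 0" for j k by (simp add: d_def)
  show "D \<ge> 0" unfolding D_def by (intro sum_nonneg d0)
  fix N :: nat and z :: "'j \<Rightarrow> complex"
  define Z where "Z = (\<Sum>j\<in>J. (cmod (z j))\<^sup>2)"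
  have "(\<Sum>m<N. (cmod (\<Sum>j\<in>J. w j ^ m * z j))\<^sup>2) = Re (\<Sum>m<N. \<Sum>j\<in>J. \<Sum>k\<in>J. w j ^ m * z j * cnj (w k ^ m * z k))"
    unfolding Re_sum[of _ "{..<N}"]
  proof (intro sum.cong refl)
    fix m
    have "(cmod (\<Sum>j\<in>J. w j ^ m * z j))\<^sup>2 = Re ((\<Sum>j\<in>J. w j ^ m * z j) * cnj (\<Sum>j\<in>J. w j ^ m * z j))"
      by (metis Re_complex_of_real complex_norm_square)
    also have "\<dots> = Re (\<Sum>j\<in>J. \<Sum>k\<in>J. w j ^ m * z j * cnj (w k ^ m * z k))"
      by (simp only: cnj_sum sum_product)
    finally show "(cmod (\<Sum>j\<in>J. w j ^ m * z j))\<^sup>2 = Re (\<Sum>j\<in>J. \<Sum>k\<in>J. w j ^ m * z j * cnj (w k ^ m * z k))" .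
  qed
  also have "(\<Sum>m<N. \<Sum>j\<in>J. \<Sum>k\<in>J. w j ^ m * z j * cnj (w k ^ m * z k))
     = (\<Sum>j\<in>J. \<Sum>k\<in>J. z j * cnj (z k) * (\<Sum>m<N. (w j * cnj (w k)) ^ m))"
  proof -
    have "(\<Sum>m<N. \<Sum>j\<in>J. \<Sum>k\<in>J. w j ^ m * z j * cnj (w k ^ m * z k))
      = (\<Sum>j\<in>J. \<Sum>k\<in>J. \<Sum>m<N. w j ^ m * z j * cnj (w k ^ m * z k))"
      by (subst sum.swap, intro sum.cong refl, subst sum.swap, rule refl)
    then show ?thesis
      by (simp add: sum_distrib_left power_mult_distrib mult_ac)
  qed
  also have "Re \<dots> = (\<Sum>j\<in>J. \<Sum>k\<in>J. Re (z j * cnj (z k) * (\<Sum>m<N. (w j * cnj (w k)) ^ m)))"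
    by simp
  also have "\<dots> \<ge> (\<Sum>j\<in>J. \<Sum>k\<in>J. (if j = k then real N * (cmod (z j))\<^sup>2 else 0) - d j k * Z)"
  proof (intro sum_mono)
    fix j k assume jk: "j \<in> J" "k \<in> J"
    have ww: "w j * cnj (w j) = 1" using w[OF jk(1)] by (simp add: complex_norm_square[symmetric])
    show "(if j = k then real N * (cmod (z j))\<^sup>2 else 0) - d j k * Z
       \<le> Re (z j * cnj (z k) * (\<Sum>m<N. (w j * cnj (w k)) ^ m))"
    proof (cases "j = k")
      case True
      have "Re (z j * cnj (z k) * (\<Sum>m<N. (w j * cnj (w k)) ^ m)) = real N * Re (z j * cnj (z j))"
        using True ww by simp
      also have "Re (z j * cnj (z j)) = (cmod (z j))\<^sup>2"
        by (metis Re_complex_of_real complex_norm_square)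
      finally show ?thesis using True by (simp add: d_def)
    next
      case False
      have "w j * cnj (w k) \<noteq> 1"
      proof
        assume eq: "w j * cnj (w k) = 1"
        have "w k * cnj (w k) = 1" using w[OF jk(2)] by (simp add: complex_norm_square[symmetric])
        with eq have "w j = w k" by (metis mult_cancel_right mult_zero_right zero_neq_one)
        then show False using False inj jk by (auto dest: inj_onD)
      qed
      then have g: "cmod (\<Sum>m<N. (w j * cnj (w k)) ^ m) \<le> d j k"
        using False jk w by (simp add: d_def) (intro norm_geometric_sum_le; simp add: norm_mult)
      have zZ: "(cmod (z j))\<^sup>2 + (cmod (z k))\<^sup>2 \<le> Z"
      proof -
        have "(\<Sum>i\<in>{j,k}. (cmod (z i))\<^sup>2) \<le> Z"
          unfolding Z_def using J jk by (intro sum_mono2) auto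
        then show ?thesis using False by simp
      qed
      have "cmod (z j) * cmod (z k) \<le> Z"
      proof -
        have "2 * (cmod (z j) * cmod (z k)) \<le> Z"
          using sum_squares_bound[of "cmod (z j)" "cmod (z k)"] zZ by (simp add: mult.assoc)
        moreover have "0 \<le> cmod (z j) * cmod (z k)" by simp
        ultimately show ?thesis by linarith
      qed
      then have "cmod (z j * cnj (z k) * (\<Sum>m<N. (w j * cnj (w k)) ^ m)) \<le> Z * d j k"
        unfolding norm_mult complex_mod_cnj using g by (intro mult_mono) (auto simp: Z_def sum_nonneg)
      then show ?thesis
        using False abs_Re_le_cmod[of "z j * cnj (z k) * (\<Sum>m<N. (w j * cnj (w k)) ^ m)"]
        by (simp add: mult.commute)
    qed
  qed
  also have "(\<Sum>j\<in>J. \<Sum>k\<in>J. (if j = k then real N * (cmod (z j))\<^sup>2 else 0) - d j k * Z) = (real N - D) * Z"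
  proof -
    have "(\<Sum>j\<in>J. \<Sum>k\<in>J. d j k * Z) = D * Z" by (simp add: D_def sum_distrib_right)
    moreover have "(\<Sum>j\<in>J. \<Sum>k\<in>J. if j = k then real N * (cmod (z j))\<^sup>2 else 0) = real N * Z"
      using J by (simp add: Z_def sum_distrib_left)
    ultimately show ?thesis by (simp add: sum_subtractf left_diff_distrib)
  qed
  finally show "(real N - D) * (\<Sum>j\<in>J. (cmod (z j))\<^sup>2) \<le> (\<Sum>m<N. (cmod (\<Sum>j\<in>J. w j ^ m * z j))\<^sup>2)"
    by (simp add: Z_def)
qed

lemma cesaro_mean_tendsto_zero:
  fixes g :: "nat \<Rightarrow> real"
  assumes g: "g \<longlonglongrightarrow> 0" and e: "\<epsilon> > 0"
  shows "\<forall>\<^sub>F N in sequentially. (\<Sum>m<N. g m) \<le> \<epsilon> * real N"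
proof -
  obtain M where M: "\<And>m. m \<ge> M \<Longrightarrow> \<bar>g m\<bar> < \<epsilon> / 2"
    using LIMSEQ_D[OF g, of "\<epsilon> / 2"] e by auto
  define B where "B = (\<Sum>m<M. \<bar>g m\<bar>)"
  have "(\<Sum>m<N. g m) \<le> B + \<epsilon> / 2 * real N" for N
  proof -
    have "(\<Sum>m<N. g m) \<le> (\<Sum>m<N. (if m < M then \<bar>g m\<bar> else 0) + \<epsilon> / 2)"
      using M e by (intro sum_mono) (smt (verit) divide_pos_pos not_less)
    also have "\<dots> = (\<Sum>m\<in>{..<N} \<inter> {..<M}. \<bar>g m\<bar>) + \<epsilon> / 2 * real N"
      by (simp add: sum.distrib sum.inter_restrict mult.commute)
    also have "(\<Sum>m\<in>{..<N} \<inter> {..<M}. \<bar>g m\<bar>) \<le> B"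
      unfolding B_def by (intro sum_mono2) auto
    finally show ?thesis by simp
  qed
  moreover have "\<forall>\<^sub>F N in sequentially. B \<le> \<epsilon> / 2 * real N"
  proof -
    obtain N0 :: nat where "2 * B / \<epsilon> < N0" using reals_Archimedean2 by blast
    then have "B \<le> \<epsilon> / 2 * real N" if "N \<ge> N0" for N
      using that e by (simp add: field_simps) (smt (verit) mult_left_mono of_nat_mono)
    then show ?thesis by (auto simp: eventually_sequentially)
  qed
  ultimately show ?thesis
    by (elim eventually_mono) (smt (verit) field_sum_of_halves distrib_right)
qed

section \<open>Translation-invariant measures on a hyperplane\<close>

lemma integral_density_indicator:
  fixes g :: "'a \<Rightarrow> 'b::{banach, second_countable_topology}"
  assumes "g \<in> borel_measurable M" "U \<in> sets M"
  shows "(\<integral>x. g x \<partial>density M (indicator U)) = (\<integral>x. indicator U x *\<^sub>R g x \<partial>M)"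
  using integral_density[of g M "indicator U :: 'a \<Rightarrow> real"] assms
  by (simp add: ennreal_indicator)

lemma character_half:
  assumes "\<xi> \<bullet> x = 1 / 2"
  shows "character \<xi> x = -1"
  unfolding character_cis assms by (simp add: complex_eq_iff)

text \<open>What the Fourier analysis uses of Hausdorff measure. The null measure also qualifies, so
  positivity has to enter later, through the ball of radius \<open>R\<close>.\<close>

locale hyperplane_measure =
  fixes \<nu> :: "'a::euclidean_space measure" and a :: 'a and c :: real
  assumes sets_nu [simp, measurable_cong]: "sets \<nu> = sets borel"
    and normal_nonzero: "a \<noteq> 0"
    and AE_hyperplane: "AE x in \<nu>. a \<bullet> x = c"
    and emeasure_bounded: "bounded B \<Longrightarrow> B \<in> sets borel \<Longrightarrow> emeasure \<nu> B < \<infinity>"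
    and emeasure_translation: "a \<bullet> v = 0 \<Longrightarrow> A \<in> sets borel \<Longrightarrow> emeasure \<nu> ((\<lambda>x. x + v) -` A) = emeasure \<nu> A"
begin

lemma space_nu [simp]: "space \<nu> = UNIV"
  using sets_eq_imp_space_eq[OF sets_nu] by simp

lemma measurable_nu [simp]: "borel_measurable \<nu> = borel_measurable borel"
  by (simp cong: measurable_cong_sets)

lemma distr_translation:
  assumes "a \<bullet> v = 0"
  shows "distr \<nu> borel (\<lambda>x. x + v) = \<nu>"
proof (rule measure_eqI)
  fix A assume "A \<in> sets (distr \<nu> borel (\<lambda>x. x + v))"
  then have "A \<in> sets borel" by simp
  then show "emeasure (distr \<nu> borel (\<lambda>x. x + v)) A = emeasure \<nu> A"
    using emeasure_translation[OF assms] by (subst emeasure_distr) auto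
qed simp

lemma integral_translation:
  fixes g :: "'a \<Rightarrow> 'b::{banach, second_countable_topology}"
  assumes "a \<bullet> v = 0" "g \<in> borel_measurable borel"
  shows "(\<integral>x. g (x + v) \<partial>\<nu>) = (\<integral>x. g x \<partial>\<nu>)"
  by (subst (2) distr_translation[OF assms(1), symmetric], subst integral_distr)
     (use assms in auto)

lemma finite_measure_density:
  assumes "emeasure \<nu> U < \<infinity>" "U \<in> sets borel"
  shows "finite_measure (density \<nu> (indicator U))"
  using assms by (intro finite_measureI) (simp add: emeasure_density)

lemma integrable_indicator_mult:
  fixes g :: "'a \<Rightarrow> complex"
  assumes "emeasure \<nu> U < \<infinity>" "U \<in> sets borel" "g \<in> borel_measurable borel" "\<And>x. cmod (g x) \<le> B"
  shows "integrable \<nu> (\<lambda>x. indicator U x *\<^sub>R g x)"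
proof (rule Bochner_Integration.integrable_bound)
  show "integrable \<nu> (\<lambda>x. B * indicator U x)"
    using assms by (intro integrable_mult_right integrable_real_indicator) auto
  show "(\<lambda>x. indicator U x *\<^sub>R g x) \<in> borel_measurable \<nu>"
    using assms by measurable
  show "AE x in \<nu>. norm (indicator U x *\<^sub>R g x) \<le> norm (B * indicator U x)"
    using assms(4) by (intro AE_I2) (auto simp: indicator_def intro: order_trans[OF _ abs_ge_self])
qed

text \<open>Translation by half a period along the tangent vector \<open>u\<close> changes the sign
  of the character, so twice the integral is at most the measure of the symmetric difference of
  \<open>U\<close> and a translate. The translation tends to 0, and openness of \<open>U\<close>
  takes the place of continuity of translations in the mean.\<close>

lemma riemann_lebesgue:
  assumes U: "open U" "bounded U" and u: "a \<bullet> u = 0" "\<eta> \<bullet> u \<noteq> 0"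
  shows "((\<lambda>t. \<integral>x. character (\<xi> + t *\<^sub>R \<eta>) x \<partial>density \<nu> (indicator U)) \<longlongrightarrow> 0) at_top"
proof -
  have Um [measurable]: "U \<in> sets borel" using U(1) by simp
  have Uf: "emeasure \<nu> U < \<infinity>" using emeasure_bounded U by simp
  \<comment> \<open>The mass of those points of \<open>U\<close> that translation by
    \<open>v\<close> moves out of \<open>U\<close>. Openness makes this integrand vanish eventually
    at each point; the other half of the symmetric difference is turned into \<omega> of
    \<open>- v\<close> by invariance.\<close>
  define \<omega> :: "'a \<Rightarrow> real" where
    "\<omega> v = (\<integral>x. indicator U x * (1 - indicator U (x + v)) \<partial>\<nu>)" for v
  \<comment> \<open>Scaled so that \<open>(\<xi> + t *\<^sub>R \<eta>) \<bullet> v t = 1 / 2\<close>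
    as soon as the denominator is nonzero.\<close>
  define v where "v t = (1 / (2 * (\<xi> \<bullet> u + t * (\<eta> \<bullet> u)))) *\<^sub>R u" for t
  have av: "a \<bullet> v t = 0" "a \<bullet> - v t = 0" for t using u by (simp_all add: v_def)
  have lim0: "((\<lambda>t. 1 / (2 * (\<xi> \<bullet> u + t * (\<eta> \<bullet> u)))) \<longlongrightarrow> 0) at_top"
  proof (rule tendsto_divide_0[OF tendsto_const])
    have "filterlim (\<lambda>t. \<xi> \<bullet> u + t * (\<eta> \<bullet> u)) at_infinity at_top"
      using tendsto_mult_filterlim_at_infinity[OF tendsto_const u(2) filterlim_at_top_imp_at_infinity[OF filterlim_ident]]
      by (intro tendsto_add_filterlim_at_infinity[OF tendsto_const]) (simp add: mult.commute)
    then show "filterlim (\<lambda>t. 2 * (\<xi> \<bullet> u + t * (\<eta> \<bullet> u))) at_infinity at_top"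
      by (intro tendsto_mult_filterlim_at_infinity[OF tendsto_const]) auto
  qed
  then have lim_v: "(v \<longlongrightarrow> 0) at_top"
    unfolding v_def using tendsto_scaleR[OF lim0 tendsto_const[of u]] by simp
  have lim_\<omega>: "((\<lambda>t. \<omega> (s *\<^sub>R v t)) \<longlongrightarrow> 0) at_top" for s :: real
  proof -
    have "((\<lambda>t. \<omega> (s *\<^sub>R v t)) \<longlongrightarrow> (\<integral>x. 0 \<partial>\<nu>)) at_top"
      unfolding \<omega>_def
    proof (rule integral_dominated_convergence_at_top)
      show "integrable \<nu> (indicator U :: 'a \<Rightarrow> real)"
        using Uf by (intro integrable_real_indicator) auto
      show "\<forall>\<^sub>F t in at_top. AE x in \<nu>. norm (indicator U x * (1 - indicator U (x + s *\<^sub>R v t)) :: real) \<le> indicator U x"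
        by (intro always_eventually allI AE_I2) (auto simp: indicator_def)
      show "AE x in \<nu>. ((\<lambda>t. indicator U x * (1 - indicator U (x + s *\<^sub>R v t))) \<longlongrightarrow> (0::real)) at_top"
      proof (rule AE_I2)
        fix x
        show "((\<lambda>t. indicator U x * (1 - indicator U (x + s *\<^sub>R v t))) \<longlongrightarrow> (0::real)) at_top"
        proof (cases "x \<in> U")
          case True
          have "((\<lambda>t. x + s *\<^sub>R v t) \<longlongrightarrow> x + s *\<^sub>R 0) at_top"
            by (intro tendsto_intros lim_v)
          then have "\<forall>\<^sub>F t in at_top. x + s *\<^sub>R v t \<in> U"
            using U(1) True by (auto dest: topological_tendstoD)
          then show ?thesis
            by (intro tendsto_eventually) (elim eventually_mono, simp)
        qed simp
      qed
    qed auto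
    then show ?thesis by simp
  qed
  define G where "G t = (\<integral>x. indicator U x *\<^sub>R character (\<xi> + t *\<^sub>R \<eta>) x \<partial>\<nu>)" for t
  have bound: "cmod (G t) \<le> (\<omega> (v t) + \<omega> (- v t)) / 2" if t: "\<xi> \<bullet> u + t * (\<eta> \<bullet> u) \<noteq> 0" for t
  proof -
    let ?\<chi> = "character (\<xi> + t *\<^sub>R \<eta>)"
    have "(\<xi> + t *\<^sub>R \<eta>) \<bullet> v t = 1 / 2"
      using t by (simp add: v_def inner_add_left field_simps)
    then have "?\<chi> (v t) = -1"
      by (rule character_half)
    then have shift: "?\<chi> (x + v t) = - ?\<chi> x" for x
      by (simp add: character_add_right)
    have i1: "integrable \<nu> (\<lambda>x. indicator U x *\<^sub>R ?\<chi> x)"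
      by (rule integrable_indicator_mult[OF Uf, where B=1]) auto
    have i2: "integrable \<nu> (\<lambda>x. indicator ((\<lambda>x. x + w) -` U) x *\<^sub>R g x)"
      if "a \<bullet> w = 0" "g \<in> borel_measurable borel" "\<And>x. cmod (g x) \<le> 1" for w g
    proof (rule integrable_indicator_mult[where B=1])
      show "emeasure \<nu> ((\<lambda>x. x + w) -` U) < \<infinity>" using emeasure_translation[OF that(1)] Uf by simp
      show "(\<lambda>x. x + w) -` U \<in> sets borel"
        using measurable_sets[of "\<lambda>x. x + w" borel borel U] by simp
    qed (use that in auto)
    have j: "integrable \<nu> (\<lambda>x. indicator U (x + w) * (1 - indicator U (x + w')) :: real)" if "a \<bullet> w = 0" for w w'
    proof (rule Bochner_Integration.integrable_bound)
      show "integrable \<nu> (indicator ((\<lambda>x. x + w) -` U) :: 'a \<Rightarrow> real)"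
        using measurable_sets[of "\<lambda>x. x + w" borel borel U] emeasure_translation[OF that, of U] Uf
        by (intro integrable_real_indicator) auto
    qed (auto simp: indicator_def)
    note j1 = j[of 0 "v t", simplified] and j2 = j[OF av(1), of t 0, simplified]
    have "G t = (\<integral>x. indicator U (x + v t) *\<^sub>R ?\<chi> (x + v t) \<partial>\<nu>)"
      unfolding G_def by (rule integral_translation[symmetric]) (auto simp: av)
    also have "\<dots> = - (\<integral>x. indicator U (x + v t) *\<^sub>R ?\<chi> x \<partial>\<nu>)"
      by (simp add: shift)
    finally have "2 * G t = (\<integral>x. indicator U x *\<^sub>R ?\<chi> x \<partial>\<nu>) - (\<integral>x. indicator U (x + v t) *\<^sub>R ?\<chi> x \<partial>\<nu>)"
      by (simp add: G_def)
    also have "\<dots> = (\<integral>x. indicator U x *\<^sub>R ?\<chi> x - indicator U (x + v t) *\<^sub>R ?\<chi> x \<partial>\<nu>)"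
      using i1 i2[OF av(1)[of t], of ?\<chi>] by (simp add: indicator_vimage)
    also have "cmod \<dots> \<le> (\<integral>x. indicator U x * (1 - indicator U (x + v t)) + indicator U (x + v t) * (1 - indicator U x) \<partial>\<nu>)"
    proof (rule Bochner_Integration.integral_norm_bound_integral)
      fix x
      show "cmod (indicator U x *\<^sub>R ?\<chi> x - indicator U (x + v t) *\<^sub>R ?\<chi> x)
         \<le> indicator U x * (1 - indicator U (x + v t)) + indicator U (x + v t) * (1 - indicator U x)"
        by (auto simp: indicator_def)
    qed (use i1 i2[OF av(1)[of t], of ?\<chi>] in \<open>auto simp: indicator_vimage 
        intro!: Bochner_Integration.integrable_add j1 j2\<close>)
    also have "\<dots> = \<omega> (v t) + (\<integral>x. indicator U (x + v t) * (1 - indicator U x) \<partial>\<nu>)"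
      unfolding \<omega>_def by (rule Bochner_Integration.integral_add) (rule j1 j2)+
    also have "(\<integral>x. indicator U (x + v t) * (1 - indicator U x) \<partial>\<nu>) = \<omega> (- v t)"
      unfolding \<omega>_def
      by (subst integral_translation[OF av(2), of _ t, symmetric]) auto
    finally show ?thesis by (simp add: norm_mult)
  qed
  have "(G \<longlongrightarrow> 0) at_top"
  proof (rule Lim_null_comparison)
    have "\<forall>\<^sub>F t in at_top. t > - (\<xi> \<bullet> u) / (\<eta> \<bullet> u)" by (rule eventually_gt_at_top)
    then have "\<forall>\<^sub>F t in at_top. \<xi> \<bullet> u + t * (\<eta> \<bullet> u) \<noteq> 0"
    proof (elim eventually_mono, intro notI)
      fix t assume "t > - (\<xi> \<bullet> u) / (\<eta> \<bullet> u)" "\<xi> \<bullet> u + t * (\<eta> \<bullet> u) = 0"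
      moreover from this(2) have "t = - (\<xi> \<bullet> u) / (\<eta> \<bullet> u)"
        using u(2) by (metis add_eq_0_iff minus_divide_left nonzero_mult_div_cancel_right)
      ultimately show False by simp
    qed
    then show "\<forall>\<^sub>F t in at_top. cmod (G t) \<le> (\<omega> (v t) + \<omega> (- v t)) / 2"
      by (elim eventually_mono) (rule bound)
    show "((\<lambda>t. (\<omega> (v t) + \<omega> (- v t)) / 2) \<longlongrightarrow> 0) at_top"
      using tendsto_divide[OF tendsto_add[OF lim_\<omega>[of 1] lim_\<omega>[of "-1"]] tendsto_const[of 2]] by simp
  qed
  then show ?thesis
    by (simp add: G_def[abs_def] integral_density_indicator)
qed

end

section \<open>Approximation by trigonometric polynomials\<close>

text \<open>The dual lattice of a cube of side \<open>L\<close> in the coordinates other than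
  \<open>b\<close>. The \<open>b\<close> component is fixed at 0 because the hyperplane is a graph
  over the others; this leaves it free to encode offsets along the normal.\<close>

definition coordinate_lattice :: "'a::euclidean_space \<Rightarrow> real \<Rightarrow> 'a set" where
  "coordinate_lattice b L = {\<xi>. \<xi> \<bullet> b = 0 \<and> (\<forall>e\<in>Basis. L * (\<xi> \<bullet> e) \<in> \<int>)}"

lemma coordinate_lattice_0: "0 \<in> coordinate_lattice b L"
  by (simp add: coordinate_lattice_def)

lemma coordinate_lattice_add:
  "\<xi> \<in> coordinate_lattice b L \<Longrightarrow> \<eta> \<in> coordinate_lattice b L \<Longrightarrow> \<xi> + \<eta> \<in> coordinate_lattice b L"
  by (auto simp: coordinate_lattice_def inner_add_left distrib_left)

lemma coordinate_lattice_uminus: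
  "\<xi> \<in> coordinate_lattice b L \<Longrightarrow> - \<xi> \<in> coordinate_lattice b L"
  by (auto simp: coordinate_lattice_def)

lemma coordinate_lattice_diff:
  "\<xi> \<in> coordinate_lattice b L \<Longrightarrow> \<eta> \<in> coordinate_lattice b L \<Longrightarrow> \<xi> - \<eta> \<in> coordinate_lattice b L"
  using coordinate_lattice_add[OF _ coordinate_lattice_uminus, of \<xi> b L \<eta>] by simp

lemma coordinate_lattice_Basis:
  assumes "e \<in> Basis" "b \<in> Basis" "e \<noteq> b" "L > 0"
  shows "(1 / L) *\<^sub>R e \<in> coordinate_lattice b L"
  using assms by (auto simp: coordinate_lattice_def inner_Basis)

lemma countable_coordinate_lattice:
  fixes b :: "'a::euclidean_space"
  assumes "L > 0"
  shows "countable (coordinate_lattice b L)"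
proof (rule countable_subset)
  let ?h = "\<lambda>k :: 'a \<Rightarrow> int. \<Sum>e\<in>Basis. (of_int (k e) / L) *\<^sub>R e"
  show "coordinate_lattice b L \<subseteq> ?h ` (Basis \<rightarrow>\<^sub>E UNIV)"
  proof
    fix \<xi> assume "\<xi> \<in> coordinate_lattice b L"
    then have "\<forall>e\<in>Basis. \<exists>k::int. L * (\<xi> \<bullet> e) = of_int k"
      by (auto simp: coordinate_lattice_def elim!: Ints_cases)
    then obtain k :: "'a \<Rightarrow> int" where k: "\<And>e. e \<in> Basis \<Longrightarrow> L * (\<xi> \<bullet> e) = of_int (k e)"
      by metis
    have "?h (restrict k Basis) = (\<Sum>e\<in>Basis. (\<xi> \<bullet> e) *\<^sub>R e)"
      using assms k by (intro sum.cong) (auto simp: field_simps)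
    then have "?h (restrict k Basis) = \<xi>" by (simp add: euclidean_representation)
    then show "\<xi> \<in> ?h ` (Basis \<rightarrow>\<^sub>E UNIV)"
      by (intro image_eqI[where x="restrict k Basis"]) auto
  qed
  show "countable (?h ` (Basis \<rightarrow>\<^sub>E UNIV))"
    by (intro countable_image countable_PiE) auto
qed

section \<open>Trigonometric polynomials\<close>

inductive trig_poly :: "'a::real_inner set \<Rightarrow> ('a \<Rightarrow> complex) \<Rightarrow> bool" for \<Lambda> where
  mono: "\<xi> \<in> \<Lambda> \<Longrightarrow> trig_poly \<Lambda> (\<lambda>x. z * cnj (character \<xi> x))"
| add: "trig_poly \<Lambda> P \<Longrightarrow> trig_poly \<Lambda> Q \<Longrightarrow> trig_poly \<Lambda> (\<lambda>x. P x + Q x)"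

lemma trig_poly_mult:
  assumes \<Lambda>: "\<And>\<xi> \<eta>. \<xi> \<in> \<Lambda> \<Longrightarrow> \<eta> \<in> \<Lambda> \<Longrightarrow> \<xi> + \<eta> \<in> \<Lambda>"
    and P: "trig_poly \<Lambda> P" and Q: "trig_poly \<Lambda> Q"
  shows "trig_poly \<Lambda> (\<lambda>x. P x * Q x)"
  using P
proof induction
  case (mono \<xi> z)
  show ?case using Q
  proof induction
    case (mono \<eta> w)
    have "(\<lambda>x. z * cnj (character \<xi> x) * (w * cnj (character \<eta> x)))
      = (\<lambda>x. (z * w) * cnj (character (\<xi> + \<eta>) x))"
      by (simp add: character_add_left mult_ac)
    then show ?case using trig_poly.mono[OF \<Lambda>[OF \<open>\<xi> \<in> \<Lambda>\<close> mono(1)], of "z * w"] by simp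
  next
    case (add P Q)
    then show ?case using trig_poly.add by (fastforce simp: distrib_left)
  qed
next
  case (add P1 P2)
  then show ?case using trig_poly.add by (fastforce simp: distrib_right)
qed

text \<open>Sums formed inductively may repeat a frequency. Orthogonality needs distinct ones, so
  coefficients are added over the union of the frequency sets.\<close>

lemma trig_poly_sum_form:
  assumes "trig_poly \<Lambda> P"
  shows "\<exists>S p. finite S \<and> S \<subseteq> \<Lambda> \<and> (\<forall>x. P x = (\<Sum>\<xi>\<in>S. p \<xi> * cnj (character \<xi> x)))"
  using assms
proof induction
  case (mono \<xi> z)
  then show ?case by (intro exI[of _ "{\<xi>}"] exI[of _ "\<lambda>_. z"]) simp
next
  case (add P Q)
  then obtain S p T q where S: "finite S" "S \<subseteq> \<Lambda>" "\<And>x. P x = (\<Sum>\<xi>\<in>S. p \<xi> * cnj (character \<xi> x))"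
    and T: "finite T" "T \<subseteq> \<Lambda>" "\<And>x. Q x = (\<Sum>\<xi>\<in>T. q \<xi> * cnj (character \<xi> x))"
    by blast
  let ?r = "\<lambda>\<xi>. (if \<xi> \<in> S then p \<xi> else 0) + (if \<xi> \<in> T then q \<xi> else 0)"
  have "P x + Q x = (\<Sum>\<xi>\<in>S \<union> T. ?r \<xi> * cnj (character \<xi> x))" for x
  proof -
    have "(\<Sum>\<xi>\<in>S \<union> T. (if \<xi> \<in> S then p \<xi> else 0) * cnj (character \<xi> x)) = P x"
      unfolding S(3) using S T by (intro sum.mono_neutral_cong_right) auto
    moreover have "(\<Sum>\<xi>\<in>S \<union> T. (if \<xi> \<in> T then q \<xi> else 0) * cnj (character \<xi> x)) = Q x"
      unfolding T(3) using S T by (intro sum.mono_neutral_cong_right) auto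
    ultimately show ?thesis by (simp add: distrib_right sum.distrib)
  qed
  then show ?case using S T by (intro exI[of _ "S \<union> T"] exI[of _ ?r]) auto
qed

lemma trig_poly_measurable:
  fixes P :: "'a::euclidean_space \<Rightarrow> complex"
  assumes "trig_poly \<Lambda> P"
  shows "P \<in> borel_measurable borel"
  using assms
proof induction
  case (mono \<xi> z)
  have "(\<lambda>x. z * character (- \<xi>) x) \<in> borel_measurable borel" by measurable
  then show ?case by (simp add: cnj_character)
qed (rule borel_measurable_add)

lemma trig_poly_bounded:
  assumes "trig_poly \<Lambda> P"
  shows "\<exists>B. \<forall>x. cmod (P x) \<le> B"
  using assms
proof induction
  case (mono \<xi> z)
  then show ?case by (auto simp: norm_mult)
next
  case (add P Q)
  then obtain B C where "\<And>x. cmod (P x) \<le> B" "\<And>x. cmod (Q x) \<le> C" by blast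
  then have "cmod (P x + Q x) \<le> B + C" for x by (meson norm_triangle_mono)
  then show ?case by blast
qed

section \<open>Bounded functions approximable in mean square\<close>

lemma norm_add_square_le: "(norm (x + y))\<^sup>2 \<le> 2 * (norm x)\<^sup>2 + 2 * (norm y)\<^sup>2"
  for x y :: "'a::real_normed_vector"
proof -
  have "(norm (x + y))\<^sup>2 \<le> (norm x + norm y)\<^sup>2"
    by (intro power_mono norm_triangle_ineq) auto
  also have "\<dots> \<le> 2 * (norm x)\<^sup>2 + 2 * (norm y)\<^sup>2"
    using sum_squares_bound[of "norm x" "norm y"] by (simp add: power2_sum)
  finally show ?thesis .
qed

text \<open>Zero and sums in \<Lambda> make the polynomials an algebra with constants. Separation of
  points is not part of this; how far the polynomials are dense is left to the hypothesis
  \<open>K\<close> of \<open>square_integrable_approximation\<close>.\<close>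

locale trig_approximation = finite_measure M for M :: "'a::euclidean_space measure" +
  fixes \<Lambda> :: "'a set"
  assumes sets_M [simp, measurable_cong]: "sets M = sets borel"
    and zero: "0 \<in> \<Lambda>"
    and add: "\<And>\<xi> \<eta>. \<xi> \<in> \<Lambda> \<Longrightarrow> \<eta> \<in> \<Lambda> \<Longrightarrow> \<xi> + \<eta> \<in> \<Lambda>"
begin

lemma space_M [simp]: "space M = UNIV"
  using sets_eq_imp_space_eq[OF sets_M] by simp

lemma measurable_M [simp]: "borel_measurable M = borel_measurable borel"
  by (simp cong: measurable_cong_sets)

text \<open>Boundedness is included because mean-square approximation alone is not stable under
  products.\<close>

definition approximable :: "('a \<Rightarrow> complex) \<Rightarrow> bool" where
  "approximable g \<longleftrightarrow> g \<in> borel_measurable borel \<and> (\<exists>B. \<forall>x. cmod (g x) \<le> B) \<and>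
     (\<forall>\<epsilon>>0. \<exists>P. trig_poly \<Lambda> P \<and> (\<integral>x. (cmod (g x - P x))\<^sup>2 \<partial>M) < \<epsilon>)"

lemma approximable_measurable: "approximable g \<Longrightarrow> g \<in> borel_measurable borel"
  by (simp add: approximable_def)

lemma approximable_bounded:
  assumes "approximable g" obtains B where "B > 0" "\<And>x. cmod (g x) \<le> B"
proof -
  obtain B where "\<forall>x. cmod (g x) \<le> B" using assms by (auto simp: approximable_def)
  then have "cmod (g x) \<le> max B 1" for x by (simp add: le_max_iff_disj)
  then show ?thesis using that[of "max B 1"] by simp
qed

lemma integrable_square_bounded:
  fixes g :: "'a \<Rightarrow> complex"
  assumes "g \<in> borel_measurable borel" "\<And>x. cmod (g x) \<le> B"
  shows "integrable M (\<lambda>x. (cmod (g x))\<^sup>2)"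
proof (rule integrable_const_bound[where B="B\<^sup>2"])
  show "AE x in M. norm ((cmod (g x))\<^sup>2) \<le> B\<^sup>2"
    using assms(2) by (intro AE_I2) (simp add: power_mono)
  have [measurable]: "g \<in> borel_measurable M" using assms by simp
  show "(\<lambda>x. (cmod (g x))\<^sup>2) \<in> borel_measurable M" by measurable
qed

lemma integrable_square_diff:
  fixes g h :: "'a \<Rightarrow> complex"
  assumes "g \<in> borel_measurable borel" "\<And>x. cmod (g x) \<le> B"
    and "h \<in> borel_measurable borel" "\<And>x. cmod (h x) \<le> C"
  shows "integrable M (\<lambda>x. (cmod (g x - h x))\<^sup>2)"
proof (rule integrable_square_bounded)
  show "(\<lambda>x. g x - h x) \<in> borel_measurable borel" using assms by measurable
  show "cmod (g x - h x) \<le> B + C" for x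
    using assms(2,4) by (meson add_mono norm_triangle_ineq4 order_trans)
qed

lemma approximable_trig:
  assumes "trig_poly \<Lambda> P" shows "approximable P"
  unfolding approximable_def
  using trig_poly_measurable[OF assms] trig_poly_bounded[OF assms] assms by (auto intro!: exI[of _ P])

lemma integral_square_triangle:
  fixes f g h :: "'a \<Rightarrow> complex"
  assumes "integrable M (\<lambda>x. (cmod (f x - g x))\<^sup>2)" "integrable M (\<lambda>x. (cmod (g x - h x))\<^sup>2)"
  shows "(\<integral>x. (cmod (f x - h x))\<^sup>2 \<partial>M)
    \<le> 2 * (\<integral>x. (cmod (f x - g x))\<^sup>2 \<partial>M) + 2 * (\<integral>x. (cmod (g x - h x))\<^sup>2 \<partial>M)"
proof -
  have "(\<integral>x. (cmod (f x - h x))\<^sup>2 \<partial>M) \<le> (\<integral>x. 2 * (cmod (f x - g x))\<^sup>2 + 2 * (cmod (g x - h x))\<^sup>2 \<partial>M)"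
  proof (rule integral_mono')
    show "integrable M (\<lambda>x. 2 * (cmod (f x - g x))\<^sup>2 + 2 * (cmod (g x - h x))\<^sup>2)"
      using assms by (intro Bochner_Integration.integrable_add integrable_mult_right)
    show "(cmod (f x - h x))\<^sup>2 \<le> 2 * (cmod (f x - g x))\<^sup>2 + 2 * (cmod (g x - h x))\<^sup>2" for x
      using norm_add_square_le[of "f x - g x" "g x - h x"] by simp
  qed simp
  also have "\<dots> = 2 * (\<integral>x. (cmod (f x - g x))\<^sup>2 \<partial>M) + 2 * (\<integral>x. (cmod (g x - h x))\<^sup>2 \<partial>M)"
    using assms by simp
  finally show ?thesis .
qed

lemma approximable_limit:
  assumes "g \<in> borel_measurable borel" "\<And>x. cmod (g x) \<le> B"
    and ap: "\<And>\<epsilon>. \<epsilon> > 0 \<Longrightarrow> \<exists>h. approximable h \<and> (\<integral>x. (cmod (g x - h x))\<^sup>2 \<partial>M) < \<epsilon>"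
  shows "approximable g"
  unfolding approximable_def
proof (intro conjI allI impI)
  show "\<exists>B. \<forall>x. cmod (g x) \<le> B" using assms by blast
  fix \<epsilon> :: real assume "\<epsilon> > 0"
  then obtain h where h: "approximable h" "(\<integral>x. (cmod (g x - h x))\<^sup>2 \<partial>M) < \<epsilon> / 4"
    using ap[of "\<epsilon> / 4"] by auto
  obtain C where C: "\<And>x. cmod (h x) \<le> C" using approximable_bounded[OF h(1)] by metis
  obtain P where P: "trig_poly \<Lambda> P" "(\<integral>x. (cmod (h x - P x))\<^sup>2 \<partial>M) < \<epsilon> / 4"
    using h(1) \<open>\<epsilon> > 0\<close> unfolding approximable_def by (meson divide_pos_pos zero_less_numeral)
  obtain D where D: "\<And>x. cmod (P x) \<le> D" using trig_poly_bounded[OF P(1)] by metis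
  have hm: "h \<in> borel_measurable borel" by (rule approximable_measurable) fact
  have "(\<integral>x. (cmod (g x - P x))\<^sup>2 \<partial>M)
     \<le> 2 * (\<integral>x. (cmod (g x - h x))\<^sup>2 \<partial>M) + 2 * (\<integral>x. (cmod (h x - P x))\<^sup>2 \<partial>M)"
    by (rule integral_square_triangle[OF integrable_square_diff[OF assms(1,2) hm C]
          integrable_square_diff[OF hm C trig_poly_measurable[OF P(1)] D]])
  also have "\<dots> < \<epsilon>" using h(2) P(2) by linarith
  finally show "\<exists>P. trig_poly \<Lambda> P \<and> (\<integral>x. (cmod (g x - P x))\<^sup>2 \<partial>M) < \<epsilon>" using P(1) by blast
qed fact

lemma integral_square_mult_le:
  fixes g h k :: "'a \<Rightarrow> complex"
  assumes "integrable M (\<lambda>x. (cmod (g x - h x))\<^sup>2)" "\<And>x. cmod (k x) \<le> B"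
  shows "(\<integral>x. (cmod (g x * k x - h x * k x))\<^sup>2 \<partial>M) \<le> B\<^sup>2 * (\<integral>x. (cmod (g x - h x))\<^sup>2 \<partial>M)"
proof -
  have "(\<integral>x. (cmod (g x * k x - h x * k x))\<^sup>2 \<partial>M) \<le> (\<integral>x. B\<^sup>2 * (cmod (g x - h x))\<^sup>2 \<partial>M)"
  proof (rule integral_mono')
    show "(cmod (g x * k x - h x * k x))\<^sup>2 \<le> B\<^sup>2 * (cmod (g x - h x))\<^sup>2" for x
      using assms(2)[of x] 
      by (simp add: norm_mult power_mult_distrib mult.commute mult_right_mono power_mono
          flip: left_diff_distrib)
  qed (use assms in auto)
  then show ?thesis by simp
qed

text \<open>One factor at a time: the sup norm of an approximating polynomial is not controlled by
  that of the function, so the error is always multiplied by a factor already fixed, first a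
  polynomial \<open>Q\<close>, then \<open>g\<close> itself.\<close>

lemma approximable_mult:
  assumes g: "approximable g" and h: "approximable h"
  shows "approximable (\<lambda>x. g x * h x)"
proof -
  note [measurable] = approximable_measurable[OF g] approximable_measurable[OF h]
  obtain B where B: "B > 0" "\<And>x. cmod (g x) \<le> B" using approximable_bounded[OF g] by blast
  obtain C where C: "C > 0" "\<And>x. cmod (h x) \<le> C" using approximable_bounded[OF h] by blast
  have ex: "\<exists>P. trig_poly \<Lambda> P \<and> (\<integral>x. (cmod (f x * k x - P x * k x))\<^sup>2 \<partial>M) < \<epsilon>"
    if f: "approximable f" and k: "\<And>x. cmod (k x) \<le> D" "D > 0" and e: "\<epsilon> > 0" for f k D \<epsilon>
  proof -
    obtain F where F: "\<And>x. cmod (f x) \<le> F" using approximable_bounded[OF f] by metis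
    obtain P where P: "trig_poly \<Lambda> P" "(\<integral>x. (cmod (f x - P x))\<^sup>2 \<partial>M) < \<epsilon> / D\<^sup>2"
      using f k e unfolding approximable_def by (meson divide_pos_pos zero_less_power)
    obtain G where G: "\<And>x. cmod (P x) \<le> G" using trig_poly_bounded[OF P(1)] by metis
    have "(\<integral>x. (cmod (f x * k x - P x * k x))\<^sup>2 \<partial>M) \<le> D\<^sup>2 * (\<integral>x. (cmod (f x - P x))\<^sup>2 \<partial>M)"
      by (intro integral_square_mult_le integrable_square_diff[OF approximable_measurable[OF f] F trig_poly_measurable[OF P(1)] G] k)
    also have "\<dots> < \<epsilon>" using P(2) k by (simp add: field_simps)
    finally show ?thesis using P(1) by blast
  qed
  have bounded_mult: "cmod (f x * k x) \<le> F * K" if "\<And>x. cmod (f x) \<le> F" "\<And>x. cmod (k x) \<le> K"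
    for f k :: "'a \<Rightarrow> complex" and F K x
    unfolding norm_mult by (intro mult_mono that norm_ge_zero order_trans[OF norm_ge_zero that(1)])
  have trig: "approximable (\<lambda>x. g x * Q x)" if Q: "trig_poly \<Lambda> Q" for Q
  proof -
    have [measurable]: "Q \<in> borel_measurable borel" by (rule trig_poly_measurable) fact
    obtain D where D: "D > 0" "\<And>x. cmod (Q x) \<le> D" using approximable_bounded[OF approximable_trig[OF Q]] by blast
    show ?thesis
      unfolding approximable_def
    proof (intro conjI allI impI)
      show "\<exists>B. \<forall>x. cmod (g x * Q x) \<le> B" using bounded_mult[of g B Q D, OF B(2) D(2)] by blast
      show "(\<lambda>x. g x * Q x) \<in> borel_measurable borel" by measurable
      fix \<epsilon> :: real assume "\<epsilon> > 0"
      then obtain P where "trig_poly \<Lambda> P" "(\<integral>x. (cmod (g x * Q x - P x * Q x))\<^sup>2 \<partial>M) < \<epsilon>"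
        using ex[of g Q D \<epsilon>, OF g D(2,1)] by blast
      then show "\<exists>P. trig_poly \<Lambda> P \<and> (\<integral>x. (cmod (g x * Q x - P x))\<^sup>2 \<partial>M) < \<epsilon>"
        using trig_poly_mult[OF add _ Q] by blast
    qed
  qed
  show ?thesis
  proof (rule approximable_limit)
    show "(\<lambda>x. g x * h x) \<in> borel_measurable borel" by measurable
    show "cmod (g x * h x) \<le> B * C" for x by (rule bounded_mult[of g B h C, OF B(2) C(2)])
    fix \<epsilon> :: real assume "\<epsilon> > 0"
    then obtain P where "trig_poly \<Lambda> P" "(\<integral>x. (cmod (h x * g x - P x * g x))\<^sup>2 \<partial>M) < \<epsilon>"
      using ex[of h g B \<epsilon>, OF h B(2,1)] by blast
    then show "\<exists>k. approximable k \<and> (\<integral>x. (cmod (g x * h x - k x))\<^sup>2 \<partial>M) < \<epsilon>"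
      using trig by (intro exI[of _ "\<lambda>x. g x * P x"]) (simp add: mult.commute)
  qed
qed

lemma approximable_add:
  assumes g: "approximable g" and h: "approximable h"
  shows "approximable (\<lambda>x. g x + h x)"
proof -
  note [measurable] = approximable_measurable[OF g] approximable_measurable[OF h]
  obtain B where B: "\<And>x. cmod (g x) \<le> B" using approximable_bounded[OF g] by metis
  obtain C where C: "\<And>x. cmod (h x) \<le> C" using approximable_bounded[OF h] by metis
  show ?thesis
    unfolding approximable_def
  proof (intro conjI allI impI)
    have "cmod (g x + h x) \<le> B + C" for x using B C by (meson norm_triangle_mono)
    then show "\<exists>B. \<forall>x. cmod (g x + h x) \<le> B" by blast
    show "(\<lambda>x. g x + h x) \<in> borel_measurable borel" by measurable
    fix \<epsilon> :: real assume e: "\<epsilon> > 0"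
    obtain P where P: "trig_poly \<Lambda> P" "(\<integral>x. (cmod (g x - P x))\<^sup>2 \<partial>M) < \<epsilon> / 4"
      using g e unfolding approximable_def by (meson divide_pos_pos zero_less_numeral)
    obtain Q where Q: "trig_poly \<Lambda> Q" "(\<integral>x. (cmod (h x - Q x))\<^sup>2 \<partial>M) < \<epsilon> / 4"
      using h e unfolding approximable_def by (meson divide_pos_pos zero_less_numeral)
    note [measurable] = trig_poly_measurable[OF P(1)] trig_poly_measurable[OF Q(1)]
    obtain D where D: "\<And>x. cmod (P x) \<le> D" using trig_poly_bounded[OF P(1)] by metis
    obtain E where E: "\<And>x. cmod (Q x) \<le> E" using trig_poly_bounded[OF Q(1)] by metis
    have i: "integrable M (\<lambda>x. (cmod (g x - P x))\<^sup>2)" "integrable M (\<lambda>x. (cmod (h x - Q x))\<^sup>2)"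
      by (rule integrable_square_diff[OF _ B _ D] integrable_square_diff[OF _ C _ E]; measurable)+
    have "(\<integral>x. (cmod ((g x + h x) - (P x + h x)))\<^sup>2 \<partial>M) < \<epsilon> / 4"
         "(\<integral>x. (cmod ((P x + h x) - (P x + Q x)))\<^sup>2 \<partial>M) < \<epsilon> / 4"
      using P(2) Q(2) by simp_all
    moreover have "(\<integral>x. (cmod ((g x + h x) - (P x + Q x)))\<^sup>2 \<partial>M)
      \<le> 2 * (\<integral>x. (cmod ((g x + h x) - (P x + h x)))\<^sup>2 \<partial>M) + 2 * (\<integral>x. (cmod ((P x + h x) - (P x + Q x)))\<^sup>2 \<partial>M)"
      by (rule integral_square_triangle) (use i in simp_all)
    ultimately have "(\<integral>x. (cmod ((g x + h x) - (P x + Q x)))\<^sup>2 \<partial>M) < \<epsilon>" by linarith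
    then show "\<exists>P. trig_poly \<Lambda> P \<and> (\<integral>x. (cmod (g x + h x - P x))\<^sup>2 \<partial>M) < \<epsilon>"
      using trig_poly.add[OF P(1) Q(1)] by blast
  qed
qed

lemma approximable_const: "approximable (\<lambda>x. z)"
  using approximable_trig[OF trig_poly.mono[OF zero, of z]] by simp

lemma approximable_cmult: "approximable g \<Longrightarrow> approximable (\<lambda>x. z * g x)"
  by (rule approximable_mult[OF approximable_const])

lemma approximable_diff: "approximable g \<Longrightarrow> approximable h \<Longrightarrow> approximable (\<lambda>x. g x - h x)"
  using approximable_add[OF _ approximable_cmult[of h "-1"], of g] by simp

lemma approximable_sum:
  assumes "finite I" "\<And>i. i \<in> I \<Longrightarrow> approximable (g i)"
  shows "approximable (\<lambda>x. \<Sum>i\<in>I. g i x)"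
  using assms by (induction I) (auto intro: approximable_const approximable_add)

lemma approximable_pointwise_limit:
  assumes ap: "\<And>n. approximable (g n)" and B: "\<And>n x. cmod (g n x) \<le> B"
    and lim: "\<And>x. (\<lambda>n. g n x) \<longlonglongrightarrow> h x"
  shows "approximable h"
proof (rule approximable_limit)
  have gm [measurable]: "g n \<in> borel_measurable borel" for n using approximable_measurable[OF ap] .
  show hm [measurable]: "h \<in> borel_measurable borel"
    by (rule borel_measurable_LIMSEQ_metric[OF gm lim])
  show hB: "cmod (h x) \<le> B" for x
    by (rule tendsto_upperbound[OF tendsto_norm[OF lim]]) (auto simp: B)
  have "(\<lambda>n. \<integral>x. (cmod (h x - g n x))\<^sup>2 \<partial>M) \<longlonglongrightarrow> (\<integral>x. 0 \<partial>M)"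
  proof (rule integral_dominated_convergence[where w="\<lambda>_. (2 * B)\<^sup>2"])
    show "AE x in M. (\<lambda>n. (cmod (h x - g n x))\<^sup>2) \<longlonglongrightarrow> 0"
    proof (rule AE_I2)
      fix x
      have "(\<lambda>n. (cmod (h x - g n x))\<^sup>2) \<longlonglongrightarrow> (cmod (h x - h x))\<^sup>2"
        by (intro tendsto_intros lim)
      then show "(\<lambda>n. (cmod (h x - g n x))\<^sup>2) \<longlonglongrightarrow> 0" by simp
    qed
    fix n
    show "(\<lambda>x. (cmod (h x - g n x))\<^sup>2) \<in> borel_measurable M" by measurable
    show "AE x in M. norm ((cmod (h x - g n x))\<^sup>2) \<le> (2 * B)\<^sup>2"
    proof (rule AE_I2)
      fix x
      have "cmod (h x - g n x) \<le> 2 * B"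
        using norm_triangle_ineq4[of "h x" "g n x"] hB[of x] B[of n x] by linarith
      then have "(cmod (h x - g n x))\<^sup>2 \<le> (2 * B)\<^sup>2" by (intro power_mono) auto
      then show "norm ((cmod (h x - g n x))\<^sup>2) \<le> (2 * B)\<^sup>2" by simp
    qed
  qed auto
  then have "(\<lambda>n. \<integral>x. (cmod (h x - g n x))\<^sup>2 \<partial>M) \<longlonglongrightarrow> 0" by simp
  then show "\<exists>k. approximable k \<and> (\<integral>x. (cmod (h x - k x))\<^sup>2 \<partial>M) < \<epsilon>" if "\<epsilon> > 0" for \<epsilon>
    using order_tendstoD(2)[OF _ that] ap by (fastforce simp: eventually_sequentially)
qed

lemma approximable_real_polynomial:
  assumes "approximable (\<lambda>x. complex_of_real (g x))" "real_polynomial_function p"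
  shows "approximable (\<lambda>x. complex_of_real (p (g x)))"
  using assms(2)
proof induction
  case (linear f)
  have "f y = f 1 * y" for y
    using bounded_linear.linear[OF linear] linear_scale[of f y 1] by (simp add: mult.commute)
  then have "(\<lambda>x. complex_of_real (f (g x))) = (\<lambda>x. complex_of_real (f 1) * complex_of_real (g x))"
    by (metis of_real_mult)
  then show ?case using approximable_cmult[OF assms(1)] by simp
qed (simp_all add: approximable_const approximable_add approximable_mult)

text \<open>Weierstrass on an interval containing the range of \<open>g\<close> reduces this to
  polynomials in \<open>g\<close>, which are approximable by closure under sums and
  products.\<close>

lemma approximable_continuous:
  fixes \<phi> :: "real \<Rightarrow> real"
  assumes g: "approximable (\<lambda>x. complex_of_real (g x))" and \<phi>: "continuous_on UNIV \<phi>"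
  shows "approximable (\<lambda>x. complex_of_real (\<phi> (g x)))"
proof -
  obtain B where B: "\<And>x. \<bar>g x\<bar> \<le> B" using approximable_bounded[OF g] by (metis norm_of_real)
  have "(\<lambda>x. Re (complex_of_real (g x))) \<in> borel_measurable borel"
    using approximable_measurable[OF g] by measurable
  then have gm [measurable]: "g \<in> borel_measurable borel" by simp
  have [measurable]: "\<phi> \<in> borel_measurable borel" using \<phi> by (rule borel_measurable_continuous_onI)
  have \<phi>B: "continuous_on {-B..B} \<phi>" using \<phi> by (rule continuous_on_subset) simp
  then have "bounded (\<phi> ` {-B..B})" by (intro compact_imp_bounded compact_continuous_image) auto
  then obtain C where "\<forall>z\<in>\<phi> ` {-B..B}. norm z \<le> C" unfolding bounded_iff by blast
  then have C: "\<bar>\<phi> y\<bar> \<le> C" if "y \<in> {-B..B}" for y using that by auto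
  show ?thesis
  proof (rule approximable_limit)
    show "(\<lambda>x. complex_of_real (\<phi> (g x))) \<in> borel_measurable borel" by measurable
    show "cmod (complex_of_real (\<phi> (g x))) \<le> C" for x using C[of "g x"] B[of x] by (simp add: abs_le_iff)
    fix \<epsilon> :: real assume e: "\<epsilon> > 0"
    define m where "m = measure M UNIV"
    \<comment> \<open>Chosen so that \<open>m * d\<^sup>2 < \<epsilon>\<close>; the summand 1 covers
      total mass 0.\<close>
    define d where "d = sqrt (\<epsilon> / (m + 1))"
    have m: "m \<ge> 0" by (simp add: m_def)
    have d: "d > 0" "d\<^sup>2 = \<epsilon> / (m + 1)" using e m by (simp_all add: d_def)
    obtain p where p: "real_polynomial_function p" "\<And>y. y \<in> {-B..B} \<Longrightarrow> \<bar>\<phi> y - p y\<bar> < d"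
      using Stone_Weierstrass_real_polynomial_function[OF compact_Icc \<phi>B d(1)] by metis
    have "(\<integral>x. (cmod (complex_of_real (\<phi> (g x)) - complex_of_real (p (g x))))\<^sup>2 \<partial>M) \<le> (\<integral>x. d\<^sup>2 \<partial>M)"
    proof (rule integral_mono')
      fix x
      have "\<bar>\<phi> (g x) - p (g x)\<bar> < d" using p(2)[of "g x"] B[of x] by (simp add: abs_le_iff)
      then show "(cmod (complex_of_real (\<phi> (g x)) - complex_of_real (p (g x))))\<^sup>2 \<le> d\<^sup>2"
        by (metis abs_ge_zero less_imp_le norm_of_real of_real_diff power_mono)
    qed auto
    also have "\<dots> = m * (\<epsilon> / (m + 1))" by (simp add: m_def d(2))
    also have "\<dots> < \<epsilon>" using e m by (simp add: field_simps)
    finally show "\<exists>k. approximable k \<and> (\<integral>x. (cmod (complex_of_real (\<phi> (g x)) - k x))\<^sup>2 \<partial>M) < \<epsilon>"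
      using approximable_real_polynomial[OF g p(1)] by blast
  qed
qed

section \<open>The sigma-algebra of sets with approximable indicator\<close>

definition approximable_sets :: "'a set set" where
  "approximable_sets = {A. approximable (indicator A)}"

text \<open>Inclusion-exclusion expresses a union of two sets by sums and products of indicators;
  countable unions are bounded pointwise limits of finite ones.\<close>

lemma sigma_algebra_approximable_sets: "sigma_algebra UNIV approximable_sets"
  unfolding sigma_algebra_iff2
proof (intro conjI ballI allI impI)
  show "{} \<in> approximable_sets"
    using approximable_const[of 0] by (simp add: approximable_sets_def indicator_def[abs_def])
  have Un: "A \<union> B \<in> approximable_sets" if "A \<in> approximable_sets" "B \<in> approximable_sets" for A B
  proof -
    have "approximable (\<lambda>x. indicator A x + indicator B x - indicator A x * indicator B x)"
      using that by (auto simp: approximable_sets_def intro!: approximable_diff approximable_add approximable_mult)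
    moreover have "(\<lambda>x. indicator A x + indicator B x - indicator A x * indicator B x :: complex) = indicator (A \<union> B)"
      by (auto simp: indicator_def)
    ultimately show ?thesis by (simp add: approximable_sets_def)
  qed
  fix A :: "nat \<Rightarrow> 'a set" assume A: "range A \<subseteq> approximable_sets"
  have fin: "(\<Union>i<n. A i) \<in> approximable_sets" for n
  proof (induction n)
    case (Suc n)
    then show ?case using Un[of "\<Union>i<n. A i" "A n"] A by (simp add: lessThan_Suc Un_commute image_subset_iff)
  qed (use \<open>{} \<in> approximable_sets\<close> in simp)
  have "approximable (indicator (\<Union>i. A i))"
  proof (rule approximable_pointwise_limit)
    show "approximable (indicator (\<Union>i<n. A i))" for n using fin by (simp add: approximable_sets_def)
    show "cmod (indicator (\<Union>i<n. A i) x) \<le> 1" for n x by (simp add: indicator_def)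
  qed (rule LIMSEQ_indicator_UN)
  then show "(\<Union>i. A i) \<in> approximable_sets" by (simp add: approximable_sets_def)
next
  fix s assume "s \<in> approximable_sets"
  then have "approximable (\<lambda>x. 1 - indicator s x)"
    by (auto simp: approximable_sets_def intro!: approximable_diff approximable_const)
  moreover have "(\<lambda>x. 1 - indicator s x :: complex) = indicator (UNIV - s)" by (auto simp: indicator_def)
  ultimately show "UNIV - s \<in> approximable_sets" by (simp add: approximable_sets_def)
qed auto

text \<open>Packaged as a measure so that membership in \<open>approximable_sets\<close> can be
  derived by the measurability calculus.\<close>

definition approximable_algebra :: "'a measure" where
  "approximable_algebra = sigma UNIV approximable_sets"

lemma space_approximable_algebra [simp]: "space approximable_algebra = UNIV"
  by (simp add: approximable_algebra_def space_measure_of_conv)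

lemma sets_approximable_algebra [simp]: "sets approximable_algebra = approximable_sets"
  using sigma_algebra.sigma_sets_eq[OF sigma_algebra_approximable_sets]
  by (simp add: approximable_algebra_def sets_measure_of_conv)

text \<open>The indicator of a sublevel set is a bounded pointwise limit of continuous functions of
  \<open>g\<close>: equal to 1 up to \<open>t\<close>, then decreasing to 0 ever more
  steeply.\<close>

lemma approximable_measurable_algebra:
  assumes g: "approximable (\<lambda>x. complex_of_real (g x))"
  shows "g \<in> borel_measurable approximable_algebra"
proof (rule borel_measurableI_le)
  fix t :: real
  define \<phi> where "\<phi> n y = max 0 (1 - real n * max 0 (y - t))" for n y
  have "approximable (indicator {x. g x \<le> t})"
  proof (rule approximable_pointwise_limit)
    show "approximable (\<lambda>x. complex_of_real (\<phi> n (g x)))" for n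
      by (intro approximable_continuous[OF g]) (auto simp: \<phi>_def intro!: continuous_intros)
    show "cmod (complex_of_real (\<phi> n (g x))) \<le> 1" for n x by (simp add: \<phi>_def)
    fix x
    have "(\<lambda>n. \<phi> n (g x)) \<longlonglongrightarrow> indicator {x. g x \<le> t} x"
    proof (cases "g x \<le> t")
      case True
      then show ?thesis by (simp add: \<phi>_def)
    next
      case False
      then obtain n0 :: nat where "1 / (g x - t) < n0" using reals_Archimedean2 by blast
      then have "\<phi> n (g x) = 0" if "n \<ge> n0" for n
      proof -
        have "1 < real n0 * (g x - t)" using False \<open>1 / (g x - t) < n0\<close> by (simp add: field_simps)
        also have "\<dots> \<le> real n * (g x - t)" using that False by (intro mult_right_mono) auto
        finally show ?thesis using False by (simp add: \<phi>_def)
      qed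
      then have "\<forall>\<^sub>F n in sequentially. \<phi> n (g x) = 0" by (auto simp: eventually_sequentially)
      then show ?thesis using False by (simp add: tendsto_eventually)
    qed
    then have "(\<lambda>n. complex_of_real (\<phi> n (g x))) \<longlonglongrightarrow> complex_of_real (indicator {x. g x \<le> t} x)"
      by (rule tendsto_of_real)
    then show "(\<lambda>n. complex_of_real (\<phi> n (g x))) \<longlonglongrightarrow> indicator {x. g x \<le> t} x"
      by (cases "g x \<le> t") simp_all
  qed
  then show "{x \<in> space approximable_algebra. g x \<le> t} \<in> sets approximable_algebra"
    by (simp add: approximable_sets_def)
qed

text \<open>Only \<open>M\<close>-almost everywhere values matter, so the indicator of \<open>K\<close> may be used to discard
  the part of the period cell on which the trigonometric functions fail to separate points.\<close>

lemma square_integrable_approximation: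
  fixes f :: "'a \<Rightarrow> complex"
  assumes K: "\<And>A. A \<in> sets borel \<Longrightarrow> approximable (indicator (A \<inter> K))"
    and f: "square_integrable M f" and supp: "AE x in M. x \<notin> K \<longrightarrow> f x = 0" and e: "\<epsilon> > 0"
  shows "\<exists>P. trig_poly \<Lambda> P \<and> (\<integral>x. (cmod (f x - P x))\<^sup>2 \<partial>M) < \<epsilon>"
proof -
  have fm [measurable]: "f \<in> borel_measurable M" and fi: "integrable M (\<lambda>x. (cmod (f x))\<^sup>2)"
    using f unfolding square_integrable_def by blast+
  obtain s where s: "\<And>i. simple_function M (s i)" "\<And>x. x \<in> space M \<Longrightarrow> (\<lambda>i. s i x) \<longlonglongrightarrow> f x"
      "\<And>i x. x \<in> space M \<Longrightarrow> dist (s i x) 0 \<le> 2 * dist (f x) 0"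
    using borel_measurable_implies_sequence_metric[OF fm, of 0] by blast
  have [measurable]: "s i \<in> borel_measurable M" for i using s(1) by (rule borel_measurable_simple_function)
  have bnd: "(cmod (f x - s i x))\<^sup>2 \<le> 9 * (cmod (f x))\<^sup>2" for x i
  proof -
    have "cmod (f x - s i x) \<le> 3 * cmod (f x)"
      using norm_triangle_ineq4[of "f x" "s i x"] s(3)[of x i] by simp
    then have "(cmod (f x - s i x))\<^sup>2 \<le> (3 * cmod (f x))\<^sup>2" by (intro power_mono) auto
    then show ?thesis by (simp add: power_mult_distrib)
  qed
  have "(\<lambda>i. \<integral>x. (cmod (f x - s i x))\<^sup>2 \<partial>M) \<longlonglongrightarrow> (\<integral>x. 0 \<partial>M)"
  proof (rule integral_dominated_convergence[where w="\<lambda>x. 9 * (cmod (f x))\<^sup>2"])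
    show "integrable M (\<lambda>x. 9 * (cmod (f x))\<^sup>2)" using fi by simp
    show "AE x in M. (\<lambda>i. (cmod (f x - s i x))\<^sup>2) \<longlonglongrightarrow> 0"
    proof (rule AE_I2)
      fix x assume "x \<in> space M"
      then have "(\<lambda>i. (cmod (f x - s i x))\<^sup>2) \<longlonglongrightarrow> (cmod (f x - f x))\<^sup>2"
        by (intro tendsto_intros s(2))
      then show "(\<lambda>i. (cmod (f x - s i x))\<^sup>2) \<longlonglongrightarrow> 0" by simp
    qed
    fix i
    show "(\<lambda>x. (cmod (f x - s i x))\<^sup>2) \<in> borel_measurable M" by measurable
    show "AE x in M. norm ((cmod (f x - s i x))\<^sup>2) \<le> 9 * (cmod (f x))\<^sup>2"
      using bnd by (intro AE_I2) simp
  qed simp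
  then have lim: "(\<lambda>i. \<integral>x. (cmod (f x - s i x))\<^sup>2 \<partial>M) \<longlonglongrightarrow> 0" by simp
  obtain i where i: "(\<integral>x. (cmod (f x - s i x))\<^sup>2 \<partial>M) < \<epsilon> / 4"
    using order_tendstoD(2)[OF lim, of "\<epsilon> / 4"] e by (auto simp: eventually_sequentially)
  \<comment> \<open>The simple function cut down to \<open>K\<close>, written by values so that the
    hypothesis \<open>K\<close> applies to each level set.\<close>
  define h where "h x = (\<Sum>y\<in>range (s i). y * indicator (s i -` {y} \<inter> K) x)" for x
  have fin: "finite (range (s i))" using s(1)[of i] by (simp add: simple_function_def)
  have hs: "h x = s i x * indicator K x" for x
  proof -
    have "h x = (\<Sum>y\<in>range (s i). if y = s i x then y * indicator K x else 0)"
      unfolding h_def by (intro sum.cong) (auto simp: indicator_def)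
    then show ?thesis using fin by simp
  qed
  have "s i -` {y} \<in> sets borel" for y
    using s(1)[of i] measurable_sets[of "s i" M borel "{y}"] by simp
  then have h: "approximable h"
    unfolding h_def by (intro approximable_sum fin approximable_cmult K)
  obtain P where P: "trig_poly \<Lambda> P" "(\<integral>x. (cmod (h x - P x))\<^sup>2 \<partial>M) < \<epsilon> / 4"
    using h e unfolding approximable_def by (meson divide_pos_pos zero_less_numeral)
  obtain C where C: "\<And>x. cmod (h x) \<le> C" using approximable_bounded[OF h] by metis
  obtain D where D: "\<And>x. cmod (P x) \<le> D" using trig_poly_bounded[OF P(1)] by metis
  have hm [measurable]: "h \<in> borel_measurable M" using approximable_measurable[OF h] by simp
  \<comment> \<open>Outside \<open>K\<close> the function \<open>f\<close> vanishes almost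
    everywhere, so the cut does not increase the error.\<close>
  have le: "AE x in M. (cmod (f x - h x))\<^sup>2 \<le> (cmod (f x - s i x))\<^sup>2"
    using supp by eventually_elim (auto simp: hs indicator_def)
  have int_s: "integrable M (\<lambda>x. (cmod (f x - s i x))\<^sup>2)"
    by (rule Bochner_Integration.integrable_bound[where f="\<lambda>x. 9 * (cmod (f x))\<^sup>2"])
      (use fi bnd in auto)
  have int_h: "integrable M (\<lambda>x. (cmod (f x - h x))\<^sup>2)"
    by (rule Bochner_Integration.integrable_bound[OF int_s]) (use le in auto)
  have "(\<integral>x. (cmod (f x - h x))\<^sup>2 \<partial>M) \<le> (\<integral>x. (cmod (f x - s i x))\<^sup>2 \<partial>M)"
    by (rule integral_mono_AE) (fact int_h int_s le)+
  moreover have "(\<integral>x. (cmod (f x - P x))\<^sup>2 \<partial>M)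
     \<le> 2 * (\<integral>x. (cmod (f x - h x))\<^sup>2 \<partial>M) + 2 * (\<integral>x. (cmod (h x - P x))\<^sup>2 \<partial>M)"
    by (rule integral_square_triangle[OF int_h integrable_square_diff[OF approximable_measurable[OF h] C
          trig_poly_measurable[OF P(1)] D]])
  ultimately have "(\<integral>x. (cmod (f x - P x))\<^sup>2 \<partial>M) < \<epsilon>" using i P(2) by linarith
  then show ?thesis using P(1) by blast
qed

end

section \<open>Parseval's identity on a period cell\<close>

context hyperplane_measure
begin

lemma integrable_translation:
  fixes g :: "'a \<Rightarrow> 'b::{banach, second_countable_topology}"
  assumes "a \<bullet> v = 0" "g \<in> borel_measurable borel" "integrable \<nu> (\<lambda>x. g (x + v))"
  shows "integrable \<nu> g"
  by (subst distr_translation[OF assms(1), symmetric], subst integrable_distr_eq)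
     (use assms in auto)

lemma restrict_support:
  fixes f :: "'a \<Rightarrow> complex"
  assumes U: "U \<in> sets borel" and f: "square_integrable \<nu> f" and supp: "\<And>x. x \<notin> U \<Longrightarrow> f x = 0"
  shows "square_integrable (density \<nu> (indicator U)) f"
    and "fourier_coeff (density \<nu> (indicator U)) f \<xi> = fourier_coeff \<nu> f \<xi>"
    and "(\<integral>x. (cmod (f x))\<^sup>2 \<partial>density \<nu> (indicator U)) = (\<integral>x. (cmod (f x))\<^sup>2 \<partial>\<nu>)"
proof -
  have fm [measurable]: "f \<in> borel_measurable borel" and fi: "integrable \<nu> (\<lambda>x. (cmod (f x))\<^sup>2)"
    using f by (auto simp: square_integrable_def)
  have [measurable]: "U \<in> sets borel" by fact
  have 1: "indicator U x *\<^sub>R (cmod (f x))\<^sup>2 = (cmod (f x))\<^sup>2"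
    "indicator U x *\<^sub>R (f x * character \<xi> x) = f x * character \<xi> x" for x
    using supp[of x] by (auto simp: indicator_def)
  show "(\<integral>x. (cmod (f x))\<^sup>2 \<partial>density \<nu> (indicator U)) = (\<integral>x. (cmod (f x))\<^sup>2 \<partial>\<nu>)"
  proof -
    have "(\<integral>x. (cmod (f x))\<^sup>2 \<partial>density \<nu> (indicator U)) = (\<integral>x. indicator U x *\<^sub>R (cmod (f x))\<^sup>2 \<partial>\<nu>)"
      by (rule integral_density_indicator) (use U in auto)
    then show ?thesis by (simp only: 1)
  qed
  show "fourier_coeff (density \<nu> (indicator U)) f \<xi> = fourier_coeff \<nu> f \<xi>"
    unfolding fourier_coeff_character by (subst integral_density_indicator) (use 1 U in auto)
  have "integrable (density \<nu> (\<lambda>x. ennreal (indicator U x))) (\<lambda>x. (cmod (f x))\<^sup>2)"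
  proof -
    have "integrable (density \<nu> (\<lambda>x. ennreal (indicator U x))) (\<lambda>x. (cmod (f x))\<^sup>2)
       \<longleftrightarrow> integrable \<nu> (\<lambda>x. indicator U x *\<^sub>R (cmod (f x))\<^sup>2)"
      by (rule integrable_density) (use U in auto)
    then show ?thesis by (simp only: 1 fi)
  qed
  then show "square_integrable (density \<nu> (indicator U)) f"
    by (simp add: square_integrable_def ennreal_indicator)
qed

lemma bessel_restricted:
  fixes f :: "'a \<Rightarrow> complex" and \<xi> :: "'i \<Rightarrow> 'a"
  assumes U: "U \<in> sets borel" "emeasure \<nu> U < \<infinity>"
    and f: "square_integrable \<nu> f" and supp: "\<And>x. x \<notin> U \<Longrightarrow> f x = 0"
    and S: "finite S" and C: "C > 0"
    and row: "\<And>n. n \<in> S \<Longrightarrow> (\<Sum>m\<in>S. cmod (\<integral>x. character (\<xi> m - \<xi> n) x \<partial>density \<nu> (indicator U))) \<le> C"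
  shows "(\<Sum>n\<in>S. (cmod (fourier_coeff \<nu> f (\<xi> n)))\<^sup>2) \<le> C * (\<integral>x. (cmod (f x))\<^sup>2 \<partial>\<nu>)"
  using bessel_almost_orthogonal[OF finite_measure_density[OF U(2,1)] _ restrict_support(1)[OF U(1) f supp] S C row]
  by (simp add: restrict_support(2,3)[OF U(1) f supp])

end

section \<open>The period cell and orthogonality of the lattice characters\<close>

locale hyperplane_cell = hyperplane_measure \<nu> a c
  for \<nu> :: "'a::euclidean_space measure" and a c +
  fixes b :: 'a and L :: real
  assumes b: "b \<in> Basis" "a \<bullet> b \<noteq> 0" and L: "L > 0"
begin

abbreviation "lattice \<equiv> coordinate_lattice b L"

text \<open>A cylinder, unbounded along \<open>b\<close>, whose intersection with the hyperplane is
  bounded. The half-open sides let translates by \<open>L\<close> fit together without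
  overlap.\<close>

definition cell :: "'a set" where
  "cell = {x. \<forall>e\<in>Basis - {b}. - (L / 2) \<le> x \<bullet> e \<and> x \<bullet> e < L / 2}"

definition cell_measure :: "'a measure" where
  "cell_measure = density \<nu> (indicator cell)"

definition cell_volume :: real where
  "cell_volume = measure \<nu> cell"

lemma cell_borel [measurable]: "cell \<in> sets borel"
proof -
  have "{x \<in> space borel. \<forall>e\<in>Basis - {b}. - (L / 2) \<le> x \<bullet> e \<and> x \<bullet> e < L / 2} \<in> sets (borel :: 'a measure)"
    by (intro sets.sets_Collect_finite_All) auto
  then show ?thesis by (simp add: cell_def)
qed

lemma bounded_cell_hyperplane: "bounded (cell \<inter> {x. a \<bullet> x = c})"
proof (cases "cell \<inter> {x. a \<bullet> x = c} = {}")
  case False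
  then obtain y where y: "y \<in> cell" "a \<bullet> y = c" by blast
  have "norm (y - x) \<le> (\<Sum>e\<in>Basis - {b}. 1 + \<bar>a \<bullet> e\<bar> / \<bar>a \<bullet> b\<bar>) * L"
    if x: "x \<in> cell" "a \<bullet> x = c" for x
  proof (rule norm_diff_le_on_hyperplane[OF b])
    fix e assume "e \<in> Basis - {b}"
    then have "- (L / 2) \<le> x \<bullet> e \<and> x \<bullet> e < L / 2" "- (L / 2) \<le> y \<bullet> e \<and> y \<bullet> e < L / 2"
      using x y by (auto simp: cell_def)
    then show "\<bar>y \<bullet> e - x \<bullet> e\<bar> \<le> L" by (simp add: abs_le_iff)
  qed (use x y in simp)
  then show ?thesis unfolding bounded_def dist_norm by blast
qed simp

lemma emeasure_cell: "emeasure \<nu> cell < \<infinity>"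
proof -
  have m: "cell \<inter> {x. a \<bullet> x = c} \<in> sets borel" by measurable
  have "emeasure \<nu> cell = emeasure \<nu> (cell \<inter> {x. a \<bullet> x = c})"
    using AE_hyperplane m by (intro emeasure_eq_AE) auto
  also have "\<dots> < \<infinity>" using emeasure_bounded[OF bounded_cell_hyperplane m] .
  finally show ?thesis .
qed

lemma finite_measure_cell: "finite_measure cell_measure"
  unfolding cell_measure_def by (rule finite_measure_density[OF emeasure_cell cell_borel])

lemma sets_cell_measure [simp, measurable_cong]: "sets cell_measure = sets borel"
  by (simp add: cell_measure_def)

lemma integral_character_0: "(\<integral>x. character 0 x \<partial>cell_measure) = complex_of_real cell_volume"
  unfolding cell_measure_def
  by (subst integral_density_indicator) (auto simp: cell_volume_def scaleR_conv_of_real)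

text \<open>Translation by half a period along the hyperplane reverses the sign of the character.
  The part of the cell pushed over the edge is moved back by a full period \<open>L\<close>, under
  which a lattice character is invariant; so the integral equals its own negative.\<close>

lemma integral_character_pos:
  assumes \<xi>: "\<xi> \<in> lattice" and e: "e \<in> Basis" "\<xi> \<bullet> e > 0"
  shows "(\<integral>x. character \<xi> x \<partial>cell_measure) = 0"
proof -
  have eb: "e \<noteq> b" "\<xi> \<bullet> b = 0" using \<xi> e by (auto simp: coordinate_lattice_def)
  define \<tau> where "\<tau> = 1 / (2 * (\<xi> \<bullet> e))"
  have "L * (\<xi> \<bullet> e) \<in> \<int>" "L * (\<xi> \<bullet> e) > 0" using \<xi> e L by (auto simp: coordinate_lattice_def)
  \<comment> \<open>A positive integer is at least 1, so the half period \<tau> is at most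
    \<open>L\<close> and one translation brings the whole overhang back.\<close>
  then have "L * (\<xi> \<bullet> e) \<ge> 1" by (auto elim!: Ints_cases)
  then have \<tau>: "\<tau> > 0" "\<tau> \<le> L" using e L by (auto simp: \<tau>_def field_simps)
  \<comment> \<open>Tangent to the hyperplane, with coordinate 1 at \<open>e\<close> and 0 at all
    others except \<open>b\<close>, so that translating along it affects only the \<open>e\<close>
    condition of the cell.\<close>
  define d where "d = e - ((a \<bullet> e) / (a \<bullet> b)) *\<^sub>R b"
  have ad: "a \<bullet> d = 0" using b by (simp add: d_def inner_diff_right)
  have \<xi>d: "\<xi> \<bullet> d = \<xi> \<bullet> e" using eb by (simp add: d_def inner_diff_right)
  have de: "d \<bullet> e' = (if e' = e then 1 else 0)" if "e' \<in> Basis - {b}" for e'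
    using that e b by (auto simp: d_def inner_diff_left inner_Basis)
  have \<chi>v: "character \<xi> (x + \<tau> *\<^sub>R d) = - character \<xi> x" for x
    using e by (simp add: character_add_right character_half \<xi>d \<tau>_def)
  have \<chi>w: "character \<xi> (x + L *\<^sub>R d) = character \<xi> x" for x
  proof -
    obtain k :: int where k: "L * (\<xi> \<bullet> e) = of_int k" using \<open>L * (\<xi> \<bullet> e) \<in> \<int>\<close> by (auto elim: Ints_cases)
    have "character \<xi> (L *\<^sub>R d) = cis (2 * pi * of_int (- k))"
      by (simp add: character_cis \<xi>d k)
    also have "\<dots> = 1" by (rule cis_multiple_2pi) simp
    finally show ?thesis by (simp add: character_add_right)
  qed
  define R where "R = {x. \<forall>e'\<in>Basis - {b, e}. - (L / 2) \<le> x \<bullet> e' \<and> x \<bullet> e' < L / 2}"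
  have [measurable]: "R \<in> sets borel"
  proof -
    have "{x \<in> space borel. \<forall>e'\<in>Basis - {b, e}. - (L / 2) \<le> x \<bullet> e' \<and> x \<bullet> e' < L / 2} \<in> sets (borel :: 'a measure)"
      by (intro sets.sets_Collect_finite_All) auto
    then show ?thesis by (simp add: R_def)
  qed
  have R: "indicator R (x + t *\<^sub>R d) = (indicator R x :: real)" for x t
    using de by (simp add: R_def indicator_def inner_add_left)
  define F where "F q x = (indicator R x * q (x \<bullet> e)) *\<^sub>R character \<xi> x" for q :: "real \<Rightarrow> real" and x
  have [measurable]: "F q \<in> borel_measurable borel" if [measurable]: "q \<in> borel_measurable borel" for q
    unfolding F_def[abs_def] by measurable
  define Q where "Q = (indicator {-(L/2)..<L/2} :: real \<Rightarrow> real)"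
  \<comment> \<open>Of the translated interval, \<open>A\<close> is what stays inside the cell and
    \<open>P\<close> is the overhang on the right.\<close>
  define A where "A = (indicator {-(L/2) + \<tau>..<L/2} :: real \<Rightarrow> real)"
  define P where "P = (indicator {L/2..<L/2 + \<tau>} :: real \<Rightarrow> real)"
  have [measurable]: "Q \<in> borel_measurable borel" "A \<in> borel_measurable borel" "P \<in> borel_measurable borel"
    by (simp_all add: Q_def A_def P_def)
  have cell_FQ: "indicator cell x *\<^sub>R character \<xi> x = F Q x" for x
  proof -
    have "Basis - {b} = insert e (Basis - {b, e})" using e eb by auto
    then have "x \<in> cell \<longleftrightarrow> x \<in> R \<and> x \<bullet> e \<in> {-(L/2)..<L/2}" by (auto simp: cell_def R_def)
    then have "indicator cell x = (indicator R x * Q (x \<bullet> e) :: real)" by (simp add: Q_def indicator_def)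
    then show ?thesis by (simp add: F_def)
  qed
  have I: "(\<integral>x. character \<xi> x \<partial>cell_measure) = (\<integral>x. F Q x \<partial>\<nu>)"
    unfolding cell_measure_def by (subst integral_density_indicator) (auto simp: cell_FQ)
  have iQ: "integrable \<nu> (F Q)"
    using integrable_indicator_mult[OF emeasure_cell cell_borel, of "character \<xi>" 1] by (simp add: cell_FQ)
  have iq: "integrable \<nu> (F q)" if [measurable]: "q \<in> borel_measurable borel" and q: "\<And>s. \<bar>q s\<bar> \<le> \<bar>Q s\<bar>" for q
  proof (rule Bochner_Integration.integrable_bound[OF iQ])
    show "AE x in \<nu>. norm (F q x) \<le> norm (F Q x)"
      using q by (intro AE_I2) (simp add: F_def abs_mult mult_left_mono)
  qed simp
  have "F Q (x + \<tau> *\<^sub>R d) = - F (\<lambda>s. Q (s + \<tau>)) x" for x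
    using de[of e] e eb by (simp add: F_def R \<chi>v inner_add_left)
  then have "- F Q x = F (\<lambda>s. Q (s - \<tau>)) (x + \<tau> *\<^sub>R d)" for x
    using de[of e] e eb by (simp add: F_def R \<chi>v inner_add_left)
  then have "- (\<integral>x. F Q x \<partial>\<nu>) = (\<integral>x. F (\<lambda>s. Q (s - \<tau>)) (x + \<tau> *\<^sub>R d) \<partial>\<nu>)"
    by (simp flip: Bochner_Integration.integral_minus)
  also have "\<dots> = (\<integral>x. F (\<lambda>s. Q (s - \<tau>)) x \<partial>\<nu>)"
    by (rule integral_translation) (auto simp: ad)
  also have "\<dots> = (\<integral>x. F A x + F P x \<partial>\<nu>)"
  proof (rule Bochner_Integration.integral_cong[OF refl])
    fix x
    have "Q (x \<bullet> e - \<tau>) = A (x \<bullet> e) + P (x \<bullet> e)"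
      using \<tau> by (auto simp: Q_def A_def P_def indicator_def)
    then show "F (\<lambda>s. Q (s - \<tau>)) x = F A x + F P x"
      by (simp add: F_def distrib_left scaleR_left_distrib)
  qed
  finally have 1: "- (\<integral>x. F Q x \<partial>\<nu>) = (\<integral>x. F A x + F P x \<partial>\<nu>)" .
  have FP: "F P (x + L *\<^sub>R d) = F (\<lambda>s. P (s + L)) x" for x
    using de[of e] e eb by (simp add: F_def R \<chi>w inner_add_left)
  have iA: "integrable \<nu> (F A)" using \<tau> by (intro iq) (auto simp: A_def Q_def indicator_def)
  have iP': "integrable \<nu> (F (\<lambda>s. P (s + L)))"
    using \<tau> by (intro iq) (auto simp: P_def Q_def indicator_def)
  have iP: "integrable \<nu> (F P)"
    by (rule integrable_translation[where v="L *\<^sub>R d"]) (use iP' ad in \<open>auto simp: FP\<close>)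
  have "(\<integral>x. F P x \<partial>\<nu>) = (\<integral>x. F P (x + L *\<^sub>R d) \<partial>\<nu>)"
    by (rule integral_translation[symmetric]) (auto simp: ad)
  then have "(\<integral>x. F A x + F P x \<partial>\<nu>) = (\<integral>x. F A x + F (\<lambda>s. P (s + L)) x \<partial>\<nu>)"
    using iA iP iP' by (simp add: FP)
  also have "\<dots> = (\<integral>x. F Q x \<partial>\<nu>)"
  proof (rule Bochner_Integration.integral_cong[OF refl])
    fix x
    have "A (x \<bullet> e) + P (x \<bullet> e + L) = Q (x \<bullet> e)"
      using \<tau> by (auto simp: Q_def A_def P_def indicator_def)
    then show "F A x + F (\<lambda>s. P (s + L)) x = F Q x"
      by (simp add: F_def flip: scaleR_left_distrib distrib_left)
  qed
  finally show ?thesis using 1 by (simp add: I)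
qed

lemma integral_character_lattice:
  assumes "\<xi> \<in> lattice" "\<xi> \<noteq> 0"
  shows "(\<integral>x. character \<xi> x \<partial>cell_measure) = 0"
proof -
  obtain e where e: "e \<in> Basis" "\<xi> \<bullet> e \<noteq> 0" using assms(2) by (metis euclidean_all_zero_iff)
  show ?thesis
  proof (cases "\<xi> \<bullet> e > 0")
    case True
    then show ?thesis using integral_character_pos assms e by blast
  next
    case False
    then have "(\<integral>x. character (- \<xi>) x \<partial>cell_measure) = 0"
      using e assms by (intro integral_character_pos[of _ e] coordinate_lattice_uminus) auto
    then have "(\<integral>x. cnj (character \<xi> x) \<partial>cell_measure) = 0" by (simp add: cnj_character)
    then show ?thesis by simp
  qed
qed

lemma character_lattice_orthogonal:
  assumes "\<xi> \<in> lattice" "\<eta> \<in> lattice"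
  shows "(\<integral>x. character (\<eta> - \<xi>) x \<partial>cell_measure) = (if \<xi> = \<eta> then complex_of_real cell_volume else 0)"
proof (cases "\<xi> = \<eta>")
  case True
  then show ?thesis using integral_character_0 by simp
next
  case False
  then show ?thesis using integral_character_lattice[OF coordinate_lattice_diff[OF assms(2,1)]] by simp
qed

sublocale cell: trig_approximation cell_measure lattice
proof (intro trig_approximation.intro trig_approximation_axioms.intro)
  show "finite_measure cell_measure" by (rule finite_measure_cell)
qed (auto intro: coordinate_lattice_0 coordinate_lattice_add)

section \<open>Density of the polynomials on the half cell, and Parseval bounds\<close>

lemma cell_approximable_cos_sin:
  assumes e: "e \<in> Basis - {b}"
  shows "cell.approximable (\<lambda>x. complex_of_real (cos (2 * pi / L * (x \<bullet> e))))"
    and "cell.approximable (\<lambda>x. complex_of_real (sin (2 * pi / L * (x \<bullet> e))))"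
proof -
  let ?\<xi> = "(1 / L) *\<^sub>R e"
  have \<xi>: "?\<xi> \<in> lattice" "- ?\<xi> \<in> lattice"
    using e b L by (auto intro!: coordinate_lattice_Basis coordinate_lattice_uminus[of ?\<xi>, simplified])
  have 1: "cell.approximable (\<lambda>x. z * cnj (character \<xi> x))" if "\<xi> \<in> lattice" for \<xi> z
    using that by (intro cell.approximable_trig trig_poly.mono)
  have "cell.approximable (\<lambda>x. (1/2) * cnj (character ?\<xi> x) + (1/2) * cnj (character (- ?\<xi>) x))"
    by (intro cell.approximable_add 1 \<xi>)
  moreover have "(1/2) * cnj (character ?\<xi> x) + (1/2) * cnj (character (- ?\<xi>) x)
      = complex_of_real (cos (2 * pi / L * (x \<bullet> e)))" for x
    by (simp add: character_cis cis_cnj complex_eq_iff inner_commute)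
  ultimately show "cell.approximable (\<lambda>x. complex_of_real (cos (2 * pi / L * (x \<bullet> e))))"
    by simp
  have "cell.approximable (\<lambda>x. (- \<i>/2) * cnj (character ?\<xi> x) + (\<i>/2) * cnj (character (- ?\<xi>) x))"
    by (intro cell.approximable_add 1 \<xi>)
  moreover have "(- \<i>/2) * cnj (character ?\<xi> x) + (\<i>/2) * cnj (character (- ?\<xi>) x)
      = complex_of_real (sin (2 * pi / L * (x \<bullet> e)))" for x
    by (simp add: character_cis cis_cnj complex_eq_iff inner_commute)
  ultimately show "cell.approximable (\<lambda>x. complex_of_real (sin (2 * pi / L * (x \<bullet> e))))"
    by simp
qed

text \<open>Described by cosines rather than coordinates, so that it is an approximable set at once.
  Within the cell it means \<open>\<bar>x \<bullet> e\<bar> \<le> L / 4\<close> for each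
  \<open>e\<close> other than \<open>b\<close>, where the sine is injective.\<close>

definition half_cell :: "'a set" where
  "half_cell = {x. \<forall>e\<in>Basis - {b}. 0 \<le> cos (2 * pi / L * (x \<bullet> e))}"

lemma half_cell_approximable_set: "half_cell \<in> sets cell.approximable_algebra"
proof -
  have "{x \<in> space cell.approximable_algebra. \<forall>e\<in>Basis - {b}. 0 \<le> cos (2 * pi / L * (x \<bullet> e))}
     \<in> sets cell.approximable_algebra"
  proof (rule sets.sets_Collect_finite_All)
    fix e :: 'a assume "e \<in> Basis - {b}"
    note [measurable] = cell.approximable_measurable_algebra[OF cell_approximable_cos_sin(1)[OF this]]
    show "{x \<in> space cell.approximable_algebra. 0 \<le> cos (2 * pi / L * (x \<bullet> e))} \<in> sets cell.approximable_algebra"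
      by measurable
  qed simp
  then show ?thesis by (simp add: half_cell_def)
qed

lemma half_cell_borel [measurable]: "half_cell \<in> sets borel"
proof -
  have "{x \<in> space borel. \<forall>e\<in>Basis - {b}. 0 \<le> cos (2 * pi / L * (x \<bullet> e))} \<in> sets (borel :: 'a measure)"
    by (intro sets.sets_Collect_finite_All) auto
  then show ?thesis by (simp add: half_cell_def)
qed

lemma quarter_period_iff:
  assumes "- (L / 2) \<le> s" "s < L / 2"
  shows "0 \<le> cos (2 * pi / L * s) \<longleftrightarrow> \<bar>s\<bar> \<le> L / 4"
proof
  assume "\<bar>s\<bar> \<le> L / 4"
  then have "\<bar>2 * pi / L * s\<bar> \<le> pi / 2" using L by (simp add: abs_mult field_simps)
  then have "- (pi / 2) \<le> 2 * pi / L * s" "2 * pi / L * s \<le> pi / 2" by linarith+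
  then show "0 \<le> cos (2 * pi / L * s)" by (rule cos_ge_zero)
next
  assume c: "0 \<le> cos (2 * pi / L * s)"
  show "\<bar>s\<bar> \<le> L / 4"
  proof (rule ccontr)
    assume "\<not> \<bar>s\<bar> \<le> L / 4"
    then have "pi / 2 < 2 * pi / L * \<bar>s\<bar>" using L by (simp add: field_simps)
    moreover have "2 * pi / L * \<bar>s\<bar> \<le> pi" using L assms by (simp add: field_simps abs_le_iff)
    ultimately have "cos (2 * pi / L * \<bar>s\<bar>) < cos (pi / 2)"
      by (intro cos_monotone_0_pi) auto
    then have "cos (2 * pi / L * s) < 0" by (auto simp: abs_if split: if_splits)
    then show False using c by simp
  qed
qed

text \<open>On the half cell the sine determines the coordinates orthogonal to \<open>b\<close>, and the equation of
  the hyperplane the remaining one.\<close>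

lemma approximable_half_cell:
  assumes A [measurable]: "A \<in> sets borel"
  shows "cell.approximable (indicator (A \<inter> half_cell))"
proof -
  \<comment> \<open>Inverts the sine on half a period; the clipping makes it continuous on the whole
    line.\<close>
  define \<phi> where "\<phi> s = L / (2 * pi) * arcsin (max (-1) (min 1 s))" for s
  have \<phi>: "continuous_on UNIV \<phi>"
    unfolding \<phi>_def
    by (rule continuous_on_mult_left, rule continuous_on_arcsin)
       (auto intro!: continuous_on_max continuous_on_min)
  define y where "y e x = \<phi> (sin (2 * pi / L * (x \<bullet> e)))" for e x :: 'a
  have [measurable]: "y e \<in> borel_measurable cell.approximable_algebra" if "e \<in> Basis - {b}" for e
    unfolding y_def[abs_def]
    by (rule cell.approximable_measurable_algebra[OF cell.approximable_continuous[OF cell_approximable_cos_sin(2)[OF that] \<phi>]])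
  \<comment> \<open>Recovers a point from its sines: \<open>y\<close> gives the coordinates other
    than \<open>b\<close>, the equation of the hyperplane the last one. It fixes the points of the
    hyperplane that lie in both the cell and the half cell; the rest of the half cell is null for
    \<open>cell_measure\<close>.\<close>
  define r where "r x = (\<Sum>e\<in>Basis - {b}. y e x *\<^sub>R e) + ((c - (\<Sum>e\<in>Basis - {b}. (a \<bullet> e) * y e x)) / (a \<bullet> b)) *\<^sub>R b" for x
  have r [measurable]: "r \<in> borel_measurable cell.approximable_algebra"
    unfolding r_def[abs_def] by measurable
  have rx: "r x = x" if x: "x \<in> cell" "x \<in> half_cell" "a \<bullet> x = c" for x
  proof -
    have y: "y e x = x \<bullet> e" if e: "e \<in> Basis - {b}" for e
    proof -
      have "\<bar>x \<bullet> e\<bar> \<le> L / 4" 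
        using x e quarter_period_iff[of "x \<bullet> e"] by (auto simp: cell_def half_cell_def)
      then have "\<bar>2 * pi / L * (x \<bullet> e)\<bar> \<le> pi / 2" using L by (simp add: abs_mult field_simps)
      then have "- (pi / 2) \<le> 2 * pi / L * (x \<bullet> e)" "2 * pi / L * (x \<bullet> e) \<le> pi / 2" by linarith+
      then have "arcsin (sin (2 * pi / L * (x \<bullet> e))) = 2 * pi / L * (x \<bullet> e)"
        by (rule arcsin_sin)
      then show ?thesis using L by (simp add: y_def \<phi>_def)
    qed
    have "c = (\<Sum>e\<in>Basis. (a \<bullet> e) * (x \<bullet> e))" using x(3) euclidean_inner[of a x] by simp
    also have "\<dots> = (a \<bullet> b) * (x \<bullet> b) + (\<Sum>e\<in>Basis - {b}. (a \<bullet> e) * (x \<bullet> e))"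
      using b by (simp add: sum.remove)
    finally have xb: "(c - (\<Sum>e\<in>Basis - {b}. (a \<bullet> e) * (x \<bullet> e))) / (a \<bullet> b) = x \<bullet> b"
      using b by (simp add: field_simps)
    have "r x = (\<Sum>e\<in>Basis - {b}. (x \<bullet> e) *\<^sub>R e) + (x \<bullet> b) *\<^sub>R b"
      unfolding r_def using y xb by simp
    also have "\<dots> = (\<Sum>e\<in>Basis. (x \<bullet> e) *\<^sub>R e)" using b by (simp add: sum.remove)
    finally show ?thesis by (simp add: euclidean_representation)
  qed
  let ?B = "r -` A \<inter> half_cell"
  have "r -` A \<in> sets cell.approximable_algebra"
    using measurable_sets[OF r A] by simp
  then have B: "cell.approximable (indicator ?B)"
    using sets.Int[OF _ half_cell_approximable_set] by (fastforce simp: cell.approximable_sets_def)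
  have "AE x in \<nu>. x \<in> cell \<longrightarrow> (indicator (A \<inter> half_cell) x :: complex) = indicator ?B x"
    using AE_hyperplane by eventually_elim (auto simp: indicator_def rx)
  then have "AE x in cell_measure. (indicator (A \<inter> half_cell) x :: complex) = indicator ?B x"
    unfolding cell_measure_def by (subst AE_density) (auto simp: indicator_def)
  then have "AE x in cell_measure. (cmod (indicator (A \<inter> half_cell) x - indicator ?B x))\<^sup>2 = 0"
    by eventually_elim simp
  then have "(\<integral>x. (cmod (indicator (A \<inter> half_cell) x - indicator ?B x))\<^sup>2 \<partial>cell_measure) = 0"
    by (rule integral_eq_zero_AE)
  then show ?thesis
    using B by (intro cell.approximable_limit[where B=1]) (auto simp: indicator_def)
qed

text \<open>The support condition places \<open>f\<close> in the half cell, where the polynomials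
  are dense; any good approximation then bounds what the lattice coefficients miss. A finite set
  with an error \<epsilon> is the form in which blocks can be attached to the frequencies.\<close>

lemma parseval_lower:
  fixes f :: "'a \<Rightarrow> complex"
  assumes f: "square_integrable \<nu> f" and supp: "\<And>x e. f x \<noteq> 0 \<Longrightarrow> e \<in> Basis - {b} \<Longrightarrow> \<bar>x \<bullet> e\<bar> \<le> L / 4"
    and \<epsilon>: "\<epsilon> > 0"
  shows "\<exists>S. finite S \<and> S \<subseteq> lattice \<and>
    cell_volume * (\<integral>x. (cmod (f x))\<^sup>2 \<partial>\<nu>) \<le> (\<Sum>\<xi>\<in>S. (cmod (fourier_coeff \<nu> f \<xi>))\<^sup>2) + \<epsilon>"
proof (cases "cell_volume > 0")
  case False
  \<comment> \<open>Zero volume makes the left side 0, so the empty set of frequencies will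
    do.\<close>
  then have "cell_volume = 0" by (simp add: cell_volume_def zero_less_measure_iff)
  then show ?thesis using \<epsilon> by (intro exI[of _ "{}"]) simp
next
  case True
  have supp_cell: "f x = 0" if "x \<notin> cell" for x
    using supp[of x] that L by (force simp: cell_def abs_le_iff)
  have supp_half: "f x = 0" if xh: "x \<notin> half_cell" for x
  proof (rule ccontr)
    assume fx: "f x \<noteq> 0"
    obtain e where e: "e \<in> Basis - {b}" "\<not> 0 \<le> cos (2 * pi / L * (x \<bullet> e))"
      using xh unfolding half_cell_def by blast
    have "\<bar>x \<bullet> e\<bar> \<le> L / 4" using supp[OF fx e(1)] .
    moreover from this have "- (L / 2) \<le> x \<bullet> e" "x \<bullet> e < L / 2" using L by linarith+
    ultimately show False using e(2) quarter_period_iff by blast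
  qed
  note restr = restrict_support[OF cell_borel f supp_cell, folded cell_measure_def]
  have "\<exists>P. trig_poly lattice P \<and> (\<integral>x. (cmod (f x - P x))\<^sup>2 \<partial>cell_measure) < \<epsilon> / cell_volume"
    by (rule cell.square_integrable_approximation[OF approximable_half_cell restr(1)])
       (use supp_half True \<epsilon> in auto)
  then obtain P where P: "trig_poly lattice P" "(\<integral>x. (cmod (f x - P x))\<^sup>2 \<partial>cell_measure) < \<epsilon> / cell_volume"
    by blast
  obtain S p where S: "finite S" "S \<subseteq> lattice" "\<And>x. P x = (\<Sum>\<xi>\<in>S. p \<xi> * cnj (character \<xi> x))"
    using trig_poly_sum_form[OF P(1)] by blast
  have "cell_volume * (\<integral>x. (cmod (f x))\<^sup>2 \<partial>cell_measure)
     \<le> (\<Sum>\<xi>\<in>S. (cmod (fourier_coeff cell_measure f \<xi>))\<^sup>2)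
       + cell_volume * (\<integral>x. (cmod (f x - (\<Sum>\<xi>\<in>S. p \<xi> * cnj (character \<xi> x))))\<^sup>2 \<partial>cell_measure)"
    by (rule best_approximation_orthogonal[OF finite_measure_cell sets_cell_measure restr(1) S(1) True
          character_lattice_orthogonal]) (use S(2) in blast)+
  also have "cell_volume * (\<integral>x. (cmod (f x - (\<Sum>\<xi>\<in>S. p \<xi> * cnj (character \<xi> x))))\<^sup>2 \<partial>cell_measure) \<le> \<epsilon>"
    using P(2) True by (simp add: S(3) field_simps)
  finally show ?thesis using S by (auto simp: restr(2,3))
qed

lemma parseval_upper:
  fixes f :: "'a \<Rightarrow> complex"
  assumes f: "square_integrable \<nu> f" and supp: "\<And>x e. f x \<noteq> 0 \<Longrightarrow> e \<in> Basis - {b} \<Longrightarrow> \<bar>x \<bullet> e\<bar> \<le> L / 4"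
    and S: "finite S" "S \<subseteq> lattice"
  shows "(\<Sum>\<xi>\<in>S. (cmod (fourier_coeff \<nu> f \<xi>))\<^sup>2) \<le> (cell_volume + 1) * (\<integral>x. (cmod (f x))\<^sup>2 \<partial>\<nu>)"
proof (rule bessel_restricted[OF cell_borel emeasure_cell f _ S(1)])
  show "f x = 0" if "x \<notin> cell" for x
    using supp[of x] that L by (force simp: cell_def abs_le_iff)
  have V: "cell_volume \<ge> 0" by (simp add: cell_volume_def)
  \<comment> \<open>The added 1 keeps the constant positive when the volume is 0.\<close>
  then show "cell_volume + 1 > 0" by simp
  fix \<xi> assume \<xi>: "\<xi> \<in> S"
  have "(\<Sum>\<eta>\<in>S. cmod (\<integral>x. character (\<eta> - \<xi>) x \<partial>cell_measure)) = (\<Sum>\<eta>\<in>S. if \<xi> = \<eta> then cell_volume else 0)"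
    using \<xi> S(2) V by (intro sum.cong refl) (subst character_lattice_orthogonal; auto)
  then show "(\<Sum>\<eta>\<in>S. cmod (\<integral>x. character (\<eta> - \<xi>) x \<partial>density \<nu> (indicator cell))) \<le> cell_volume + 1"
    using \<xi> S(1) by (simp add: cell_measure_def)
qed

end

section \<open>Blocks of frequencies\<close>

lemma norm_sum_square_le:
  fixes z :: "'i \<Rightarrow> 'a::real_normed_vector"
  shows "(norm (\<Sum>j\<in>J. z j))\<^sup>2 \<le> real (card J) * (\<Sum>j\<in>J. (norm (z j))\<^sup>2)"
proof -
  have "(norm (\<Sum>j\<in>J. z j))\<^sup>2 \<le> (\<Sum>j\<in>J. norm (z j))\<^sup>2"
    by (intro power_mono norm_sum norm_ge_zero)
  also have "\<dots> \<le> (\<Sum>j\<in>J. (norm (z j))\<^sup>2) * card J"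
    by (rule sum_squared_le_sum_of_squares)
  finally show ?thesis by (simp add: mult.commute)
qed

lemma sum_half_power_le_2:
  assumes "finite S"
  shows "(\<Sum>n\<in>S. (1/2::real) ^ n) \<le> 2"
proof -
  have "(\<Sum>n\<in>S. (1/2::real) ^ n) \<le> (\<Sum>n. (1/2) ^ n)"
    by (intro sum_le_suminf assms) (auto intro: summable_geometric)
  also have "\<dots> = 2" by (simp add: suminf_geometric)
  finally show ?thesis .
qed

text \<open>
  The offsets are chosen greedily along an enumeration of the set; the bound \<open>2\<^sup>-\<^sup>m\<^sup>-\<^sup>n\<close> for the pair with
  indices \<open>m\<close> and \<open>n\<close> makes all row sums small.
\<close>

lemma separating_offsets:
  fixes G :: "'j \<Rightarrow> 'a::real_vector \<Rightarrow> real"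
  assumes J: "finite J" and D: "finite D" "\<And>\<delta>. \<delta> \<in> D \<Longrightarrow> - \<delta> \<in> D"
    and \<Lambda>: "countable \<Lambda>" and \<kappa>: "\<kappa> > 0"
    and sym: "\<And>j \<xi>. G j (- \<xi>) = G j \<xi>"
    and lim: "\<And>j \<xi>. j \<in> J \<Longrightarrow> ((\<lambda>t. G j (\<xi> + t *\<^sub>R \<eta>)) \<longlongrightarrow> 0) at_top"
  shows "\<exists>t. \<forall>j\<in>J. \<forall>\<xi>\<in>\<Lambda>. \<forall>S. finite S \<longrightarrow> S \<subseteq> \<Lambda> - {\<xi>} \<longrightarrow>
       (\<exists>g. (\<forall>\<xi>'\<in>S. \<forall>\<delta>\<in>D. G j (\<xi>' - \<xi> + (t \<xi>' - t \<xi> + \<delta>) *\<^sub>R \<eta>) \<le> g \<xi>') \<and> (\<Sum>\<xi>'\<in>S. g \<xi>') \<le> \<kappa>)"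
proof -
  define l where "l = from_nat_into \<Lambda>"
  define h :: "nat \<Rightarrow> real" where "h n = (1/2) ^ n" for n
  \<comment> \<open>Compatibility of a new offset \<open>r\<close> with the earlier ones only, so
    that well-founded choice applies. The bound is uniform over \<open>D\<close>, so one number will
    serve all pairs of members of two blocks.\<close>
  define P where "P \<tau> n r \<longleftrightarrow> (\<forall>m<n. \<forall>j\<in>J. \<forall>\<delta>\<in>D.
      G j (l n - l m + (r - \<tau> m + \<delta>) *\<^sub>R \<eta>) \<le> \<kappa> / 2 * h n * h m)" for \<tau> :: "nat \<Rightarrow> real" and n r
  have ex: "\<exists>r. P \<tau> n r" for \<tau> n
  proof -
    have "\<forall>\<^sub>F r in at_top. G j (l n - l m + (r - \<tau> m + \<delta>) *\<^sub>R \<eta>) \<le> \<kappa> / 2 * h n * h m"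
      if "j \<in> J" for m j \<delta>
    proof -
      have "((\<lambda>r. G j ((l n - l m + (\<delta> - \<tau> m) *\<^sub>R \<eta>) + r *\<^sub>R \<eta>)) \<longlongrightarrow> 0) at_top"
        by (rule lim[OF that])
      moreover have "(l n - l m + (\<delta> - \<tau> m) *\<^sub>R \<eta>) + r *\<^sub>R \<eta> = l n - l m + (r - \<tau> m + \<delta>) *\<^sub>R \<eta>" for r
        by (simp add: algebra_simps)
      ultimately have "((\<lambda>r. G j (l n - l m + (r - \<tau> m + \<delta>) *\<^sub>R \<eta>)) \<longlongrightarrow> 0) at_top" by simp
      moreover have "0 < \<kappa> / 2 * h n * h m" using \<kappa> by (simp add: h_def)
      ultimately have "\<forall>\<^sub>F r in at_top. G j (l n - l m + (r - \<tau> m + \<delta>) *\<^sub>R \<eta>) < \<kappa> / 2 * h n * h m"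
        by (rule order_tendstoD(2))
      then show ?thesis by (rule eventually_mono) simp
    qed
    then have "\<forall>\<^sub>F r in at_top. \<forall>m\<in>{..<n}. \<forall>j\<in>J. \<forall>\<delta>\<in>D.
        G j (l n - l m + (r - \<tau> m + \<delta>) *\<^sub>R \<eta>) \<le> \<kappa> / 2 * h n * h m"
      using J D by (intro eventually_ball_finite ballI) auto
    then obtain r where "\<forall>m\<in>{..<n}. \<forall>j\<in>J. \<forall>\<delta>\<in>D.
        G j (l n - l m + (r - \<tau> m + \<delta>) *\<^sub>R \<eta>) \<le> \<kappa> / 2 * h n * h m"
      by (auto dest: eventually_happens)
    then show ?thesis unfolding P_def by blast
  qed
  have "\<exists>\<tau>. \<forall>n. P \<tau> n (\<tau> n)"
  proof (rule dependent_wf_choice[OF wf_less_than])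
    show "P f x r = P g x r" if "\<And>z. (z, x) \<in> less_than \<Longrightarrow> f z = g z" for f g x r
      using that by (auto simp: P_def)
  qed (use ex in blast)
  then obtain \<tau> where \<tau>: "\<And>n. P \<tau> n (\<tau> n)" by blast
  define idx where "idx = to_nat_on \<Lambda>"
  have l_idx: "l (idx \<xi>) = \<xi>" if "\<xi> \<in> \<Lambda>" for \<xi>
    using that \<Lambda> by (simp add: l_def idx_def)
  have inj: "inj_on idx \<Lambda>" using \<Lambda> by (simp add: idx_def inj_on_to_nat_on)
  define t where "t \<xi> = \<tau> (idx \<xi>)" for \<xi>
  have main: "G j (\<xi>' - \<xi> + (t \<xi>' - t \<xi> + \<delta>) *\<^sub>R \<eta>) \<le> \<kappa> / 2 * h (idx \<xi>')"
    if "j \<in> J" "\<xi> \<in> \<Lambda>" "\<xi>' \<in> \<Lambda>" "\<xi> \<noteq> \<xi>'" "\<delta> \<in> D" for j \<xi> \<xi>' \<delta>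
  proof -
    have "G j (\<xi>' - \<xi> + (t \<xi>' - t \<xi> + \<delta>) *\<^sub>R \<eta>) \<le> \<kappa> / 2 * h (idx \<xi>') * h (idx \<xi>)"
    proof (cases "idx \<xi> < idx \<xi>'")
      case True
      then show ?thesis using \<tau>[of "idx \<xi>'"] that by (auto simp: P_def t_def l_idx)
    next
      \<comment> \<open>In the reverse order the difference changes sign; evenness of
        \<open>G\<close> and the symmetry of \<open>D\<close> absorb this.\<close>
      case False
      then have lt: "idx \<xi>' < idx \<xi>" using inj that by (metis inj_onD linorder_cases)
      have "G j (\<xi> - \<xi>' + (t \<xi> - t \<xi>' + (- \<delta>)) *\<^sub>R \<eta>) \<le> \<kappa> / 2 * h (idx \<xi>) * h (idx \<xi>')"
        using \<tau>[of "idx \<xi>"] that lt D(2) unfolding P_def t_def by (metis l_idx)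
      moreover have "\<xi> - \<xi>' + (t \<xi> - t \<xi>' + (- \<delta>)) *\<^sub>R \<eta> = - (\<xi>' - \<xi> + (t \<xi>' - t \<xi> + \<delta>) *\<^sub>R \<eta>)"
        by (simp add: algebra_simps)
      ultimately show ?thesis by (simp only: sym mult_ac)
    qed
    \<comment> \<open>One factor \<open>h\<close> is enough to sum over \<xi>'; its values at
      distinct indices sum to at most 2, whence the \<open>\<kappa> / 2\<close>.\<close>
    also have "\<dots> \<le> \<kappa> / 2 * h (idx \<xi>') * 1"
      using \<kappa> by (intro mult_left_mono) (auto simp: h_def power_le_one)
    finally show ?thesis by simp
  qed
  show ?thesis
  proof (rule exI[of _ t], intro ballI allI impI)
    fix j \<xi> S assume j: "j \<in> J" "\<xi> \<in> \<Lambda>" "finite S" "S \<subseteq> \<Lambda> - {\<xi>}"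
    have "inj_on idx S" using inj j(4) by (meson Diff_subset inj_on_subset subset_trans)
    then have "(\<Sum>\<xi>'\<in>S. h (idx \<xi>')) = (\<Sum>n\<in>idx ` S. h n)" by (simp add: sum.reindex)
    also have "\<dots> \<le> 2" unfolding h_def using j(3) by (intro sum_half_power_le_2) auto
    finally have "\<kappa> / 2 * (\<Sum>\<xi>'\<in>S. h (idx \<xi>')) \<le> \<kappa> / 2 * 2"
      using \<kappa> by (intro mult_left_mono) auto
    then have "(\<Sum>\<xi>'\<in>S. \<kappa> / 2 * h (idx \<xi>')) \<le> \<kappa>"
      unfolding sum_distrib_left by simp
    moreover have "\<forall>\<xi>'\<in>S. \<forall>\<delta>\<in>D. G j (\<xi>' - \<xi> + (t \<xi>' - t \<xi> + \<delta>) *\<^sub>R \<eta>) \<le> \<kappa> / 2 * h (idx \<xi>')"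
      using main j by blast
    ultimately show "\<exists>g. (\<forall>\<xi>'\<in>S. \<forall>\<delta>\<in>D. G j (\<xi>' - \<xi> + (t \<xi>' - t \<xi> + \<delta>) *\<^sub>R \<eta>) \<le> g \<xi>') \<and> (\<Sum>\<xi>'\<in>S. g \<xi>') \<le> \<kappa>"
      by (intro exI[of _ "\<lambda>\<xi>'. \<kappa> / 2 * h (idx \<xi>')"] conjI)
  qed
qed

text \<open>Reduces a row of a Toeplitz matrix to the one-sided sum handled by the Cesaro mean,
  uniformly in the row: the entries on either side of the diagonal are among those of the first
  row.\<close>

lemma sum_even_differences_le:
  fixes g :: "int \<Rightarrow> real"
  assumes g: "\<And>k. 0 \<le> g k" "\<And>k. g (- k) = g k" and m: "m < N"
  shows "(\<Sum>m'<N. g (int m' - int m)) \<le> 2 * (\<Sum>k<N. g (int k))"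
proof -
  have "(\<Sum>m'<N. g (int m' - int m)) = (\<Sum>m'\<in>{..<m} \<union> {m..<N}. g (int m' - int m))"
    using m by (intro sum.cong) auto
  also have "\<dots> = (\<Sum>m'\<in>{..<m}. g (int m' - int m)) + (\<Sum>m'\<in>{m..<N}. g (int m' - int m))"
    by (intro sum.union_disjoint) auto
  also have "(\<Sum>m'\<in>{..<m}. g (int m' - int m)) = (\<Sum>k\<in>(\<lambda>m'. m - m') ` {..<m}. g (int k))"
  proof (subst sum.reindex)
    show "inj_on (\<lambda>m'. m - m') {..<m}" by (auto simp: inj_on_def)
    have "g (int m' - int m) = g (int (m - m'))" if "m' < m" for m'
      using g(2)[of "int m - int m'"] that by (simp add: of_nat_diff)
    then show "(\<Sum>m'<m. g (int m' - int m)) = sum ((\<lambda>k. g (int k)) \<circ> (\<lambda>m'. m - m')) {..<m}"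
      by (intro sum.cong) auto
  qed
  also have "\<dots> \<le> (\<Sum>k<N. g (int k))"
    using m g(1) by (intro sum_mono2) auto
  also have "(\<Sum>m'\<in>{m..<N}. g (int m' - int m)) = (\<Sum>k\<in>(\<lambda>m'. m' - m) ` {m..<N}. g (int k))"
    by (subst sum.reindex) (auto simp: inj_on_def of_nat_diff intro!: sum.cong)
  also have "\<dots> \<le> (\<Sum>k<N. g (int k))"
    using m g(1) by (intro sum_mono2) auto
  finally show ?thesis by simp
qed

section \<open>Phases along the normal direction\<close>

lemma (in hyperplane_measure) fourier_coeff_add_normal:
  assumes f: "f \<in> borel_measurable borel" and \<eta>: "\<eta> = r *\<^sub>R a"
  shows "fourier_coeff \<nu> f (\<xi> + t *\<^sub>R \<eta>) = cis (- 2 * pi * t * (r * c)) * fourier_coeff \<nu> f \<xi>"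
proof -
  have [measurable]: "f \<in> borel_measurable borel" by fact
  have "fourier_coeff \<nu> f (\<xi> + t *\<^sub>R \<eta>) = (\<integral>x. cis (- 2 * pi * t * (r * c)) * (f x * character \<xi> x) \<partial>\<nu>)"
    unfolding fourier_coeff_character
  proof (rule integral_cong_AE)
    show "AE x in \<nu>. f x * character (\<xi> + t *\<^sub>R \<eta>) x = cis (- 2 * pi * t * (r * c)) * (f x * character \<xi> x)"
      using AE_hyperplane
    proof eventually_elim
      fix x assume "a \<bullet> x = c"
      then have "character (t *\<^sub>R \<eta>) x = cis (- 2 * pi * t * (r * c))"
        by (simp add: character_cis \<eta> mult_ac)
      then show "f x * character (\<xi> + t *\<^sub>R \<eta>) x = cis (- 2 * pi * t * (r * c)) * (f x * character \<xi> x)"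
        by (simp add: character_add_left mult_ac)
    qed
  qed auto
  then show ?thesis by (simp add: fourier_coeff_character)
qed

text \<open>Equal phases would make \<open>s * (\<gamma> k - \<gamma> j)\<close> an integer, and
  \<open>s\<close> is small enough for its modulus to stay below 1. The 1 in the denominator makes
  this strict and the denominator positive.\<close>

lemma distinct_phases:
  fixes \<gamma> :: "'j \<Rightarrow> real"
  assumes J: "finite J" and inj: "inj_on \<gamma> J"
  obtains s where "s > 0" "inj_on (\<lambda>j. cis (- 2 * pi * s * \<gamma> j)) J"
proof
  define \<Gamma> where "\<Gamma> = (\<Sum>j\<in>J. \<bar>\<gamma> j\<bar>)"
  define s where "s = 1 / (2 * \<Gamma> + 1)"
  have \<Gamma>: "\<Gamma> \<ge> 0" by (simp add: \<Gamma>_def sum_nonneg)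
  then show s: "s > 0" by (simp add: s_def)
  show "inj_on (\<lambda>j. cis (- 2 * pi * s * \<gamma> j)) J"
  proof (rule inj_onI)
    fix j k assume jk: "j \<in> J" "k \<in> J" and eq: "cis (- 2 * pi * s * \<gamma> j) = cis (- 2 * pi * s * \<gamma> k)"
    then have "sin (- 2 * pi * s * \<gamma> j) = sin (- 2 * pi * s * \<gamma> k) \<and> cos (- 2 * pi * s * \<gamma> j) = cos (- 2 * pi * s * \<gamma> k)"
      by (auto simp: complex_eq_iff)
    then obtain n :: int where "- 2 * pi * s * \<gamma> j = - 2 * pi * s * \<gamma> k + 2 * pi * n"
      unfolding sin_cos_eq_iff by blast
    then have "2 * pi * (s * (\<gamma> k - \<gamma> j)) = 2 * pi * n" by (simp add: algebra_simps)
    then have n: "s * (\<gamma> k - \<gamma> j) = n" by simp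
    have "\<bar>\<gamma> i\<bar> \<le> \<Gamma>" if "i \<in> J" for i
      unfolding \<Gamma>_def using J that by (intro member_le_sum) auto
    then have "\<bar>\<gamma> k - \<gamma> j\<bar> < 2 * \<Gamma> + 1" using jk by (smt (verit))
    then have "s * \<bar>\<gamma> k - \<gamma> j\<bar> < 1" using \<Gamma> by (simp add: s_def)
    then have "\<bar>real_of_int n\<bar> < 1" using s by (simp add: abs_mult flip: n)
    then have "n = 0" by linarith
    then have "\<gamma> j = \<gamma> k" using n s by simp
    then show "j = k" using inj jk by (auto dest: inj_onD)
  qed
qed

text \<open>The witness is the component of \<open>a'\<close> orthogonal to \<open>a\<close>; its
  inner product with \<open>a'\<close> is its own squared norm.\<close>

lemma parallel_or_transversal:
  fixes a a' :: "'a::real_inner"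
  assumes "a \<noteq> 0" "\<nexists>r. a' = r *\<^sub>R a"
  obtains u where "a \<bullet> u = 0" "a' \<bullet> u \<noteq> 0"
proof
  define r where "r = (a' \<bullet> a) / (a \<bullet> a)"
  define u where "u = a' - r *\<^sub>R a"
  show au: "a \<bullet> u = 0" using assms(1) by (simp add: u_def r_def inner_diff_right inner_commute)
  have "u \<noteq> 0" using assms(2) by (auto simp: u_def)
  moreover have "a' \<bullet> u = u \<bullet> u" using au by (simp add: u_def inner_diff_left)
  ultimately show "a' \<bullet> u \<noteq> 0" by simp
qed

text \<open>Distinctness concerns the hyperplanes as sets, since different pairs \<open>a j\<close>,
  \<open>c j\<close> may describe the same one. On a repeated hyperplane with the same measure,
  \<open>f\<close> and \<open>- f\<close> would cancel at every frequency.\<close>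

locale hyperplane_family =
  fixes I :: "'j set" and \<nu> :: "'j \<Rightarrow> 'a::euclidean_space measure" and a :: "'j \<Rightarrow> 'a"
    and c :: "'j \<Rightarrow> real" and R :: real
  assumes finite_I: "finite I"
    and hyperplane: "\<And>j. j \<in> I \<Longrightarrow> hyperplane_measure (\<nu> j) (a j) (c j)"
    and distinct: "inj_on (\<lambda>j. {x. a j \<bullet> x = c j}) I"
    and R_pos: "R > 0"
begin

definition admissible :: "('j \<Rightarrow> 'a \<Rightarrow> complex) \<Rightarrow> bool" where
  "admissible f \<longleftrightarrow> (\<forall>j\<in>I. square_integrable (\<nu> j) (f j) \<and> (\<forall>x. f j x \<noteq> 0 \<longrightarrow> x \<in> ball 0 R))"

definition norm_sq :: "('j \<Rightarrow> 'a \<Rightarrow> complex) \<Rightarrow> 'j \<Rightarrow> real" where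
  "norm_sq f j = (\<integral>x. (cmod (f j x))\<^sup>2 \<partial>\<nu> j)"

definition total_coeff :: "('j \<Rightarrow> 'a \<Rightarrow> complex) \<Rightarrow> 'a \<Rightarrow> complex" where
  "total_coeff f \<xi> = (\<Sum>j\<in>I. fourier_coeff (\<nu> j) (f j) \<xi>)"

lemma norm_sq_nonneg: "norm_sq f j \<ge> 0"
  by (simp add: norm_sq_def)

text \<open>The order of quantifiers is the point: \<open>V\<close> is fixed before \<epsilon>, so
  that the errors can later be made small against all the \<open>V\<close> at once, while the
  frequencies and \<open>B\<close> may depend on \<epsilon>. Finite sums with a slack \<delta>
  postpone infinite sums to the end.\<close>

lemma partial_frame:
  assumes i: "i \<in> I"
  obtains V where "V \<ge> 0" "emeasure (\<nu> i) (ball 0 R) > 0 \<Longrightarrow> V > 0"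
    and "\<And>\<epsilon>. \<epsilon> > 0 \<Longrightarrow> \<exists>\<Lambda> B. countable \<Lambda> \<and> (\<forall>f. admissible f \<longrightarrow>
      (\<forall>S. finite S \<longrightarrow> S \<subseteq> \<Lambda> \<longrightarrow> (\<Sum>\<xi>\<in>S. (cmod (total_coeff f \<xi>))\<^sup>2) \<le> B * (\<Sum>j\<in>I. norm_sq f j)) \<and>
      (\<forall>\<delta>>0. \<exists>S. finite S \<and> S \<subseteq> \<Lambda> \<and>
         V * norm_sq f i \<le> (\<Sum>\<xi>\<in>S. (cmod (total_coeff f \<xi>))\<^sup>2) + \<epsilon> * (\<Sum>j\<in>I. norm_sq f j) + \<delta>))"
proof -
  interpret i: hyperplane_measure "\<nu> i" "a i" "c i" using hyperplane[OF i] .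
  define \<eta> where "\<eta> = a i"
  \<comment> \<open>Makes every coordinate on the ball of radius \<open>R\<close> at most
    \<open>L / 4\<close>, as the Parseval bounds demand.\<close>
  define L where "L = 4 * R"
  define U where "U = ball (0::'a) R"
  have L: "L > 0" using R_pos by (simp add: L_def)
  obtain b where b: "b \<in> Basis" "\<eta> \<bullet> b \<noteq> 0"
    using i.normal_nonzero unfolding \<eta>_def by (metis euclidean_all_zero_iff)
  define \<Lambda>\<^sub>0 where "\<Lambda>\<^sub>0 = coordinate_lattice b L"
  have card_pos: "card I > 0" using i finite_I by (auto simp: card_gt_0_iff)
  have U: "open U" "bounded U" "U \<in> sets borel" by (simp_all add: U_def)
  have U_fin: "emeasure (\<nu> j) U < \<infinity>" if "j \<in> I" for j
    using hyperplane_measure.emeasure_bounded[OF hyperplane[OF that]] U by blast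
  have coord: "\<bar>x \<bullet> e\<bar> \<le> L / 4" if "x \<in> ball 0 R" "e \<in> Basis" for x e :: 'a
    using Basis_le_norm[OF that(2), of x] that(1) by (simp add: L_def)

  define par where "par = {j \<in> I. \<exists>r. \<eta> = r *\<^sub>R a j}"
  have par: "finite par" "par \<subseteq> I" using finite_I by (auto simp: par_def)
  have i_par: "i \<in> par" using i by (auto simp: par_def \<eta>_def intro: exI[of _ 1])
  have "\<forall>j\<in>par. \<exists>r. \<eta> = r *\<^sub>R a j" by (simp add: par_def)
  then obtain r where r: "\<And>j. j \<in> par \<Longrightarrow> \<eta> = r j *\<^sub>R a j" by metis
  have r0: "r j \<noteq> 0" if "j \<in> par" for j using r[OF that] b by auto
  \<comment> \<open>In terms of the common normal \<eta>, the hyperplane \<open>j\<close> is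
    \<open>\<eta> \<bullet> x = \<gamma> j\<close>, so distinct parallel hyperplanes have distinct
    \<gamma>.\<close>
  define \<gamma> where "\<gamma> j = r j * c j" for j
  have inj_\<gamma>: "inj_on \<gamma> par"
  proof (rule inj_onI)
    fix j k assume jk: "j \<in> par" "k \<in> par" "\<gamma> j = \<gamma> k"
    have "{x. a l \<bullet> x = c l} = {x. \<eta> \<bullet> x = \<gamma> l}" if "l \<in> par" for l
      using r0[OF that] by (subst r[OF that]) (auto simp: \<gamma>_def)
    then have "{x. a j \<bullet> x = c j} = {x. a k \<bullet> x = c k}" using jk by simp
    then show "j = k" using distinct jk par by (meson inj_onD subsetD)
  qed
  obtain s where s: "s > 0" "inj_on (\<lambda>j. cis (- 2 * pi * s * \<gamma> j)) par"
    using distinct_phases[OF par(1) inj_\<gamma>] .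
  define w where "w j = cis (- 2 * pi * s * \<gamma> j)" for j
  obtain D where D: "D \<ge> 0" "\<And>N z. (real N - D) * (\<Sum>j\<in>par. (cmod (z j))\<^sup>2)
      \<le> (\<Sum>m<N. (cmod (\<Sum>j\<in>par. w j ^ m * z j))\<^sup>2)"
    using vandermonde_lower_bound[OF par(1), of w] s(2) unfolding w_def by auto
  have cell: "hyperplane_cell (\<nu> j) (a j) (c j) b L" if "j \<in> par" for j
  proof -
    have "a j \<bullet> b \<noteq> 0" using b(2) r[OF that] by auto
    then show ?thesis
      using hyperplane[of j] that par b(1) L
      by (auto simp: hyperplane_cell_def hyperplane_cell_axioms_def)
  qed
  interpret ci: hyperplane_cell "\<nu> i" "a i" "c i" b L using cell[OF i_par] .
  \<comment> \<open>One factor 1/2 is lost because only \<open>N - D \<ge> N / 2\<close> is known,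
    the other when the transversal part is split off by \<open>norm_add_square_le\<close>.\<close>
  define V where "V = ci.cell_volume / 4"

  show ?thesis
  proof (rule that[of V])
    show "V \<ge> 0" by (simp add: V_def ci.cell_volume_def)
    assume pos: "emeasure (\<nu> i) (ball 0 R) > 0"
    have "ball 0 R \<subseteq> ci.cell"
      using coord L by (force simp: ci.cell_def abs_le_iff)
    then have "emeasure (\<nu> i) (ball 0 R) \<le> emeasure (\<nu> i) ci.cell"
      by (intro emeasure_mono) auto
    then have "emeasure (\<nu> i) ci.cell > 0" using pos by simp
    moreover have "emeasure (\<nu> i) ci.cell \<noteq> \<infinity>" using ci.emeasure_cell by simp
    ultimately show "V > 0"
      by (simp add: V_def ci.cell_volume_def measure_def enn2real_positive_iff less_top)
  next
    fix \<epsilon> :: real assume \<epsilon>: "\<epsilon> > 0"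
    \<comment> \<open>Compensates the factor \<open>card I\<close> that Cauchy-Schwarz over the
      transversal hyperplanes produces.\<close>
    define \<epsilon>1 where "\<epsilon>1 = \<epsilon> / card I"
    have \<epsilon>1: "\<epsilon>1 > 0" using \<epsilon> card_pos by (simp add: \<epsilon>1_def)
    define G where "G j \<xi> = cmod (\<integral>x. character \<xi> x \<partial>density (\<nu> j) (indicator U))" for j \<xi>
    have G_sym: "G j (- \<xi>) = G j \<xi>" for j \<xi>
      by (simp add: G_def flip: cnj_character)
    have G_lim: "((\<lambda>t. G j (\<xi> + t *\<^sub>R \<eta>)) \<longlongrightarrow> 0) at_top" if j: "j \<in> I - par" for j \<xi>
    proof -
      interpret j: hyperplane_measure "\<nu> j" "a j" "c j" using hyperplane j by blast
      have "\<nexists>r. \<eta> = r *\<^sub>R a j" using j by (auto simp: par_def)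
      then obtain u where u: "a j \<bullet> u = 0" "\<eta> \<bullet> u \<noteq> 0"
        using parallel_or_transversal[OF j.normal_nonzero] by blast
      show ?thesis
        unfolding G_def using tendsto_norm[OF j.riemann_lebesgue[OF U(1,2) u]] by simp
    qed
    have "\<forall>\<^sub>F N in sequentially. (\<Sum>k<N. G j ((real k * s) *\<^sub>R \<eta>)) \<le> \<epsilon>1 / 4 * real N" if j: "j \<in> I - par" for j
    proof (rule cesaro_mean_tendsto_zero)
      have "filterlim (\<lambda>k. real k * s) at_top sequentially"
        by (rule filterlim_at_top_mult_tendsto_pos[OF tendsto_const s(1) filterlim_real_sequentially])
      then show "(\<lambda>k. G j ((real k * s) *\<^sub>R \<eta>)) \<longlonglongrightarrow> 0"
        using filterlim_compose[OF G_lim[OF j, of 0]] by simp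
    qed (use \<epsilon>1 in simp)
    then have "\<forall>\<^sub>F N in sequentially. \<forall>j\<in>I - par. (\<Sum>k<N. G j ((real k * s) *\<^sub>R \<eta>)) \<le> \<epsilon>1 / 4 * real N"
      using finite_I by (intro eventually_ball_finite ballI) auto
    \<comment> \<open>\<open>2 * D\<close> is for separating parallel hyperplanes.
      \<open>2 / \<epsilon>1\<close> makes the total 1 of the other blocks at most half of
      \<open>\<epsilon>1 * N\<close>; the remaining half is twice the Cesaro bound
      \<open>\<epsilon>1 / 4 * N\<close>.\<close>
    moreover have "\<forall>\<^sub>F N in sequentially. real N \<ge> max (max 1 (2 * D)) (2 / \<epsilon>1)"
      using filterlim_real_sequentially[unfolded filterlim_at_top] by blast
    ultimately obtain N where N: "\<And>j. j \<in> I - par \<Longrightarrow> (\<Sum>k<N. G j ((real k * s) *\<^sub>R \<eta>)) \<le> \<epsilon>1 / 4 * real N"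
        "real N \<ge> 1" "real N \<ge> 2 * D" "real N \<ge> 2 / \<epsilon>1"
    proof -
      assume *: "\<forall>\<^sub>F N in sequentially. \<forall>j\<in>I - par. (\<Sum>k<N. G j ((real k * s) *\<^sub>R \<eta>)) \<le> \<epsilon>1 / 4 * real N"
        "\<forall>\<^sub>F N in sequentially. real N \<ge> max (max 1 (2 * D)) (2 / \<epsilon>1)"
      then obtain N where "\<forall>j\<in>I - par. (\<Sum>k<N. G j ((real k * s) *\<^sub>R \<eta>)) \<le> \<epsilon>1 / 4 * real N"
        "real N \<ge> max (max 1 (2 * D)) (2 / \<epsilon>1)"
        using eventually_happens[OF eventually_conj[OF *]] by auto
      then show ?thesis using that[of N] by auto
    qed
    have N4: "1 \<le> \<epsilon>1 / 2 * real N" using N(4) \<epsilon>1 by (simp add: field_simps)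

    \<comment> \<open>All differences of positions inside blocks; the separation of two blocks must
      hold for each of them.\<close>
    define \<Delta> where "\<Delta> = (\<lambda>(m, m'). (real m' - real m) * s) ` ({..<N} \<times> {..<N})"
    have \<Delta>: "finite \<Delta>" by (simp add: \<Delta>_def)
    have \<Delta>_minus: "- \<delta> \<in> \<Delta>" if \<delta>: "\<delta> \<in> \<Delta>" for \<delta>
    proof -
      obtain m m' where m: "m < N" "m' < N" "\<delta> = (real m' - real m) * s" using \<delta> by (auto simp: \<Delta>_def)
      then have "- \<delta> = (\<lambda>(m, m'). (real m' - real m) * s) (m', m)" by (simp add: algebra_simps)
      then show ?thesis unfolding \<Delta>_def using m by (intro image_eqI[where x="(m', m)"]) auto
    qed
    have "countable \<Lambda>\<^sub>0" unfolding \<Lambda>\<^sub>0_def using L by (rule countable_coordinate_lattice)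
    \<comment> \<open>Each other block has \<open>N\<close> members, so bounds with sum
      \<open>1 / N\<close> over the blocks give a row total of at most 1.\<close>
    have N_inv: "1 / real N > 0" using N(2) by simp
    have "\<exists>t. \<forall>j\<in>I - par. \<forall>\<xi>\<in>\<Lambda>\<^sub>0. \<forall>S. finite S \<longrightarrow> S \<subseteq> \<Lambda>\<^sub>0 - {\<xi>} \<longrightarrow>
       (\<exists>g. (\<forall>\<xi>'\<in>S. \<forall>\<delta>\<in>\<Delta>. G j (\<xi>' - \<xi> + (t \<xi>' - t \<xi> + \<delta>) *\<^sub>R \<eta>) \<le> g \<xi>') \<and> (\<Sum>\<xi>'\<in>S. g \<xi>') \<le> 1 / real N)"
      by (rule separating_offsets)
        (use finite_I \<Delta> \<Delta>_minus \<open>countable \<Lambda>\<^sub>0\<close> N_inv G_sym G_lim in \<open>auto simp only: finite_Diff\<close>)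
    then obtain t where t: "\<forall>j\<in>I - par. \<forall>\<xi>\<in>\<Lambda>\<^sub>0. \<forall>S. finite S \<longrightarrow> S \<subseteq> \<Lambda>\<^sub>0 - {\<xi>} \<longrightarrow>
       (\<exists>g. (\<forall>\<xi>'\<in>S. \<forall>\<delta>\<in>\<Delta>. G j (\<xi>' - \<xi> + (t \<xi>' - t \<xi> + \<delta>) *\<^sub>R \<eta>) \<le> g \<xi>') \<and> (\<Sum>\<xi>'\<in>S. g \<xi>') \<le> 1 / real N)"
      by (rule exE)

    define \<Xi> where "\<Xi> p = fst p + (t (fst p) + real (snd p) * s) *\<^sub>R \<eta>" for p :: "'a \<times> nat"
    \<comment> \<open>Lattice points have \<open>b\<close> component 0 but \<eta> does not, so the
      \<open>b\<close> component reveals the offset, hence the lattice point, hence the position in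
      the block.\<close>
    have inj_\<Xi>: "inj_on \<Xi> (\<Lambda>\<^sub>0 \<times> X)" for X
    proof (rule inj_onI)
      fix p q assume p: "p \<in> \<Lambda>\<^sub>0 \<times> X" "q \<in> \<Lambda>\<^sub>0 \<times> X" and eq: "\<Xi> p = \<Xi> q"
      have "fst p \<bullet> b = 0" "fst q \<bullet> b = 0" using p by (auto simp: \<Lambda>\<^sub>0_def coordinate_lattice_def)
      then have "(t (fst p) + real (snd p) * s) * (\<eta> \<bullet> b) = (t (fst q) + real (snd q) * s) * (\<eta> \<bullet> b)"
        using arg_cong[OF eq, of "\<lambda>x. x \<bullet> b"] by (simp add: \<Xi>_def inner_add_left)
      then have tt: "t (fst p) + real (snd p) * s = t (fst q) + real (snd q) * s" using b by simp
      then have "fst p = fst q" using eq by (simp add: \<Xi>_def)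
      moreover from this have "snd p = snd q" using tt s(1) by simp
      ultimately show "p = q" by (simp add: prod_eq_iff)
    qed

    have transversal: "(\<Sum>p\<in>S \<times> {..<N}. (cmod (fourier_coeff (\<nu> j) (f j) (\<Xi> p)))\<^sup>2) \<le> \<epsilon>1 * real N * norm_sq f j"
      if j: "j \<in> I - par" and f: "admissible f" and S: "finite S" "S \<subseteq> \<Lambda>\<^sub>0" for j f S
      unfolding norm_sq_def
    proof (rule hyperplane_measure.bessel_restricted[OF hyperplane U(3) U_fin])
      show "square_integrable (\<nu> j) (f j)"
        using f j by (auto simp: admissible_def)
      show "f j x = 0" if "x \<notin> U" for x
        using f j that by (auto simp: admissible_def U_def)
      show "\<epsilon>1 * real N > 0" using \<epsilon>1 N by simp
      fix p assume p: "p \<in> S \<times> {..<N}"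
      obtain \<xi> m where pm: "p = (\<xi>, m)" "\<xi> \<in> S" "m < N" using p by auto
      \<comment> \<open>The row sum splits into the own block, at most
        \<open>\<epsilon>1 / 2 * N\<close> by the Cesaro bound, and all other blocks, at most 1 by
        the choice of \<open>t\<close>.\<close>
      have "(\<Sum>q\<in>S \<times> {..<N}. G j (\<Xi> q - \<Xi> p)) = (\<Sum>\<xi>'\<in>S. \<Sum>m'<N. G j (\<Xi> (\<xi>', m') - \<Xi> p))"
        by (simp add: sum.cartesian_product)
      also have "\<dots> = (\<Sum>m'<N. G j (\<Xi> (\<xi>, m') - \<Xi> p)) + (\<Sum>\<xi>'\<in>S - {\<xi>}. \<Sum>m'<N. G j (\<Xi> (\<xi>', m') - \<Xi> p))"
        using S(1) pm(2) by (rule sum.remove)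
      also have "(\<Sum>m'<N. G j (\<Xi> (\<xi>, m') - \<Xi> p)) \<le> 2 * (\<Sum>k<N. G j ((real k * s) *\<^sub>R \<eta>))"
      proof -
        define g where "g k = G j ((real_of_int k * s) *\<^sub>R \<eta>)" for k
        have "\<Xi> (\<xi>, m') - \<Xi> p = (real_of_int (int m' - int m) * s) *\<^sub>R \<eta>" for m'
          by (simp add: \<Xi>_def pm algebra_simps)
        then have "(\<Sum>m'<N. G j (\<Xi> (\<xi>, m') - \<Xi> p)) = (\<Sum>m'<N. g (int m' - int m))"
          by (simp add: g_def)
        also have "\<dots> \<le> 2 * (\<Sum>k<N. g (int k))"
        proof (rule sum_even_differences_le)
          show "0 \<le> g k" "g (- k) = g k" for k
            using G_sym[of j "(real_of_int k * s) *\<^sub>R \<eta>"] by (simp_all add: g_def) (simp add: G_def)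
        qed fact
        finally show ?thesis by (simp add: g_def)
      qed
      also have "2 * (\<Sum>k<N. G j ((real k * s) *\<^sub>R \<eta>)) \<le> \<epsilon>1 / 2 * real N" using N(1)[OF j] by simp
      also have "(\<Sum>\<xi>'\<in>S - {\<xi>}. \<Sum>m'<N. G j (\<Xi> (\<xi>', m') - \<Xi> p)) \<le> 1"
      proof -
        obtain g where g: "\<And>\<xi>' \<delta>. \<xi>' \<in> S - {\<xi>} \<Longrightarrow> \<delta> \<in> \<Delta> \<Longrightarrow> G j (\<xi>' - \<xi> + (t \<xi>' - t \<xi> + \<delta>) *\<^sub>R \<eta>) \<le> g \<xi>'"
          "(\<Sum>\<xi>'\<in>S - {\<xi>}. g \<xi>') \<le> 1 / real N"
          using t[rule_format, OF j, of \<xi> "S - {\<xi>}"] pm S by blast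
        have "(\<Sum>\<xi>'\<in>S - {\<xi>}. \<Sum>m'<N. G j (\<Xi> (\<xi>', m') - \<Xi> p)) \<le> (\<Sum>\<xi>'\<in>S - {\<xi>}. \<Sum>m'<N. g \<xi>')"
        proof (intro sum_mono)
          fix \<xi>' m' assume *: "\<xi>' \<in> S - {\<xi>}" "m' \<in> {..<N}"
          have "\<Xi> (\<xi>', m') - \<Xi> p = \<xi>' - \<xi> + (t \<xi>' - t \<xi> + (real m' - real m) * s) *\<^sub>R \<eta>"
            by (simp add: \<Xi>_def pm algebra_simps)
          moreover have "(real m' - real m) * s \<in> \<Delta>" using * pm by (auto simp: \<Delta>_def)
          ultimately show "G j (\<Xi> (\<xi>', m') - \<Xi> p) \<le> g \<xi>'" using g(1)[OF *(1)] by simp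
        qed
        also have "\<dots> = real N * (\<Sum>\<xi>'\<in>S - {\<xi>}. g \<xi>')" by (simp add: sum_distrib_left)
        also have "\<dots> \<le> real N * (1 / real N)" using g(2) by (intro mult_left_mono) auto
        also have "\<dots> = 1" using N(2) by simp
        finally show ?thesis .
      qed
      finally have "(\<Sum>q\<in>S \<times> {..<N}. G j (\<Xi> q - \<Xi> p)) \<le> \<epsilon>1 / 2 * real N + 1" by simp
      then show "(\<Sum>q\<in>S \<times> {..<N}. cmod (\<integral>x. character (\<Xi> q - \<Xi> p) x \<partial>density (\<nu> j) (indicator U))) \<le> \<epsilon>1 * real N"
        using N4 by (simp add: G_def)
    qed (use j S in auto)

    have coeff_par: "fourier_coeff (\<nu> j) (f j) (\<Xi> (\<xi>, m)) = w j ^ m * (cis (- 2 * pi * t \<xi> * \<gamma> j) * fourier_coeff (\<nu> j) (f j) \<xi>)"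
      if j: "j \<in> par" and f: "admissible f" for j f \<xi> m
    proof -
      interpret j: hyperplane_measure "\<nu> j" "a j" "c j" using hyperplane j par by blast
      have "j \<in> I" using j par by blast
      then have "square_integrable (\<nu> j) (f j)" using f unfolding admissible_def by blast
      then have "f j \<in> borel_measurable (\<nu> j)" unfolding square_integrable_def by blast
      then have "f j \<in> borel_measurable borel" by simp
      then have "fourier_coeff (\<nu> j) (f j) (\<Xi> (\<xi>, m))
         = cis (- 2 * pi * (t \<xi> + real m * s) * \<gamma> j) * fourier_coeff (\<nu> j) (f j) \<xi>"
        using j.fourier_coeff_add_normal[OF _ r[OF j]] by (simp add: \<Xi>_def \<gamma>_def)
      also have "cis (- 2 * pi * (t \<xi> + real m * s) * \<gamma> j) = w j ^ m * cis (- 2 * pi * t \<xi> * \<gamma> j)"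
      proof -
        have "- 2 * pi * (t \<xi> + real m * s) * \<gamma> j = real m * (- 2 * pi * s * \<gamma> j) + (- 2 * pi * t \<xi> * \<gamma> j)"
          by (simp add: algebra_simps)
        then show ?thesis by (simp only: w_def Complex.DeMoivre cis_mult)
      qed
      finally show ?thesis by simp
    qed

    have support: "f j x \<noteq> 0 \<Longrightarrow> e \<in> Basis - {b} \<Longrightarrow> \<bar>x \<bullet> e\<bar> \<le> L / 4" "square_integrable (\<nu> j) (f j)"
      if "j \<in> I" "admissible f" for f j x e
      using that coord[of x e] by (auto simp: admissible_def)

    have "\<exists>C\<ge>0. \<forall>f S. admissible f \<longrightarrow> finite S \<longrightarrow> S \<subseteq> \<Lambda>\<^sub>0 \<longrightarrow>
       (\<Sum>p\<in>S \<times> {..<N}. (cmod (fourier_coeff (\<nu> j) (f j) (\<Xi> p)))\<^sup>2) \<le> C * norm_sq f j" if j: "j \<in> I" for j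
    proof (cases "j \<in> par")
      case True
      interpret cj: hyperplane_cell "\<nu> j" "a j" "c j" b L using cell[OF True] .
      have "(\<Sum>p\<in>S \<times> {..<N}. (cmod (fourier_coeff (\<nu> j) (f j) (\<Xi> p)))\<^sup>2) \<le> (real N * (cj.cell_volume + 1)) * norm_sq f j"
        if f: "admissible f" and S: "finite S" "S \<subseteq> \<Lambda>\<^sub>0" for f S
      proof -
        have "(\<Sum>p\<in>S \<times> {..<N}. (cmod (fourier_coeff (\<nu> j) (f j) (\<Xi> p)))\<^sup>2)
          = (\<Sum>\<xi>\<in>S. \<Sum>m<N. (cmod (fourier_coeff (\<nu> j) (f j) (\<Xi> (\<xi>, m))))\<^sup>2)"
          by (simp add: sum.cartesian_product)
        also have "\<dots> = real N * (\<Sum>\<xi>\<in>S. (cmod (fourier_coeff (\<nu> j) (f j) \<xi>))\<^sup>2)"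
          by (simp add: coeff_par[OF True f] norm_mult norm_power w_def sum_distrib_left)
        also have "(\<Sum>\<xi>\<in>S. (cmod (fourier_coeff (\<nu> j) (f j) \<xi>))\<^sup>2) \<le> (cj.cell_volume + 1) * norm_sq f j"
          unfolding norm_sq_def
          by (rule cj.parseval_upper) (use support[OF j f] S in \<open>auto simp: \<Lambda>\<^sub>0_def\<close>)
        finally show ?thesis by (simp add: mult_left_mono)
      qed
      moreover have "0 \<le> real N * (cj.cell_volume + 1)" by (simp add: cj.cell_volume_def)
      ultimately show ?thesis by blast
    next
      case False
      then show ?thesis using transversal[of j] j \<epsilon>1 by (intro exI[of _ "\<epsilon>1 * real N"]) auto
    qed
    then obtain C where C: "\<And>j. j \<in> I \<Longrightarrow> C j \<ge> 0" "\<And>j f S. j \<in> I \<Longrightarrow> admissible f \<Longrightarrow> finite S \<Longrightarrow> S \<subseteq> \<Lambda>\<^sub>0 \<Longrightarrow>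
       (\<Sum>p\<in>S \<times> {..<N}. (cmod (fourier_coeff (\<nu> j) (f j) (\<Xi> p)))\<^sup>2) \<le> C j * norm_sq f j"
      by metis
    define B where "B = real (card I) * (\<Sum>j\<in>I. C j)"
    define \<Lambda> where "\<Lambda> = \<Xi> ` (\<Lambda>\<^sub>0 \<times> {..<N})"

    have upper: "(\<Sum>\<xi>\<in>S. (cmod (total_coeff f \<xi>))\<^sup>2) \<le> B * (\<Sum>j\<in>I. norm_sq f j)"
      if f: "admissible f" and S: "finite S" "S \<subseteq> \<Lambda>" for f S
    proof -
      \<comment> \<open>\<open>X\<close> indexes the frequencies in \<open>S\<close>; it is then
        enlarged to full blocks over \<open>T\<close>, which can only increase a sum of nonnegative
        terms.\<close>
      obtain X where X: "X \<subseteq> \<Lambda>\<^sub>0 \<times> {..<N}" "finite X" "S = \<Xi> ` X"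
        using finite_subset_image[OF S(1) S(2)[unfolded \<Lambda>_def]] by metis
      define T where "T = fst ` X"
      have T: "finite T" "T \<subseteq> \<Lambda>\<^sub>0" "X \<subseteq> T \<times> {..<N}" using X by (force simp: T_def)+
      have "inj_on \<Xi> X" using inj_\<Xi> X(1) by (rule inj_on_subset)
      then have "(\<Sum>\<xi>\<in>S. (cmod (total_coeff f \<xi>))\<^sup>2) = (\<Sum>p\<in>X. (cmod (total_coeff f (\<Xi> p)))\<^sup>2)"
        by (simp add: X(3) sum.reindex)
      also have "\<dots> \<le> (\<Sum>p\<in>T \<times> {..<N}. (cmod (total_coeff f (\<Xi> p)))\<^sup>2)"
        using T by (intro sum_mono2) auto
      also have "\<dots> \<le> (\<Sum>p\<in>T \<times> {..<N}. real (card I) * (\<Sum>j\<in>I. (cmod (fourier_coeff (\<nu> j) (f j) (\<Xi> p)))\<^sup>2))"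
        unfolding total_coeff_def by (intro sum_mono norm_sum_square_le)
      also have "\<dots> = real (card I) * (\<Sum>j\<in>I. \<Sum>p\<in>T \<times> {..<N}. (cmod (fourier_coeff (\<nu> j) (f j) (\<Xi> p)))\<^sup>2)"
        by (subst sum.swap) (simp add: sum_distrib_left)
      also have "\<dots> \<le> real (card I) * (\<Sum>j\<in>I. C j * norm_sq f j)"
        using C(2) f T by (intro mult_left_mono sum_mono) auto
      also have "\<dots> \<le> real (card I) * (\<Sum>j\<in>I. C j * (\<Sum>k\<in>I. norm_sq f k))"
        using C(1) finite_I by (intro mult_left_mono sum_mono member_le_sum) (auto simp: norm_sq_nonneg)
      also have "\<dots> = B * (\<Sum>j\<in>I. norm_sq f j)" by (simp add: B_def sum_distrib_right mult.assoc)
      finally show ?thesis .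
    qed

    have lower: "\<exists>S. finite S \<and> S \<subseteq> \<Lambda> \<and>
         V * norm_sq f i \<le> (\<Sum>\<xi>\<in>S. (cmod (total_coeff f \<xi>))\<^sup>2) + \<epsilon> * (\<Sum>j\<in>I. norm_sq f j) + \<delta>"
      if f: "admissible f" and \<delta>: "\<delta> > 0" for f and \<delta> :: real
    proof -
      define H where "H j p = (cmod (fourier_coeff (\<nu> j) (f j) (\<Xi> p)))\<^sup>2" for j p
      have pw: "real N / 2 * (cmod (fourier_coeff (\<nu> i) (f i) \<xi>))\<^sup>2
        \<le> 2 * (\<Sum>m<N. (cmod (total_coeff f (\<Xi> (\<xi>, m))))\<^sup>2) + 2 * real (card I) * (\<Sum>m<N. \<Sum>j\<in>I - par. H j (\<xi>, m))" for \<xi>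
      proof -
        define z where "z j = cis (- 2 * pi * t \<xi> * \<gamma> j) * fourier_coeff (\<nu> j) (f j) \<xi>" for j
        \<comment> \<open>\<open>N \<ge> 2 * D\<close> gives \<open>N - D \<ge> N / 2\<close>; the
          single component \<open>i\<close> is then bounded by the sum over all parallel
          ones.\<close>
        have "real N / 2 * (cmod (z i))\<^sup>2 \<le> (real N - D) * (cmod (z i))\<^sup>2"
          using N(3) by (intro mult_right_mono) auto
        also have "\<dots> \<le> (real N - D) * (\<Sum>j\<in>par. (cmod (z j))\<^sup>2)"
          using N(3) D(1) par i_par by (intro mult_left_mono member_le_sum) auto
        also have "\<dots> \<le> (\<Sum>m<N. (cmod (\<Sum>j\<in>par. w j ^ m * z j))\<^sup>2)" by (rule D(2))
        also have "\<dots> \<le> (\<Sum>m<N. 2 * (cmod (total_coeff f (\<Xi> (\<xi>, m))))\<^sup>2 + 2 * (real (card I) * (\<Sum>j\<in>I - par. H j (\<xi>, m))))"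
        proof (rule sum_mono)
          fix m
          let ?h = "\<Sum>j\<in>I - par. fourier_coeff (\<nu> j) (f j) (\<Xi> (\<xi>, m))"
          have "(\<Sum>j\<in>par. w j ^ m * z j) = (\<Sum>j\<in>par. fourier_coeff (\<nu> j) (f j) (\<Xi> (\<xi>, m)))"
            using coeff_par[OF _ f] by (intro sum.cong) (simp_all add: z_def)
          \<comment> \<open>The parallel components are the total minus the transversal ones, whose
            squares go into the error term.\<close>
          also have "\<dots> = total_coeff f (\<Xi> (\<xi>, m)) + (- ?h)"
            unfolding total_coeff_def using finite_I par(2) by (simp add: sum_diff)
          finally have "(cmod (\<Sum>j\<in>par. w j ^ m * z j))\<^sup>2
            \<le> 2 * (cmod (total_coeff f (\<Xi> (\<xi>, m))))\<^sup>2 + 2 * (cmod ?h)\<^sup>2"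
            using norm_add_square_le[of "total_coeff f (\<Xi> (\<xi>, m))" "- ?h"] by simp
          moreover have "(cmod ?h)\<^sup>2 \<le> real (card I) * (\<Sum>j\<in>I - par. H j (\<xi>, m))"
          proof -
            have "(cmod ?h)\<^sup>2 \<le> real (card (I - par)) * (\<Sum>j\<in>I - par. H j (\<xi>, m))"
              unfolding H_def by (rule norm_sum_square_le)
            also have "\<dots> \<le> real (card I) * (\<Sum>j\<in>I - par. H j (\<xi>, m))"
              using finite_I by (intro mult_right_mono sum_nonneg) (auto simp: card_mono H_def)
            finally show ?thesis .
          qed
          ultimately show "(cmod (\<Sum>j\<in>par. w j ^ m * z j))\<^sup>2
             \<le> 2 * (cmod (total_coeff f (\<Xi> (\<xi>, m))))\<^sup>2 + 2 * (real (card I) * (\<Sum>j\<in>I - par. H j (\<xi>, m)))"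
            by linarith
        qed
        finally show ?thesis
          by (simp add: z_def norm_mult sum.distrib sum_distrib_left mult.assoc)
      qed
      obtain S where S: "finite S" "S \<subseteq> \<Lambda>\<^sub>0"
        "ci.cell_volume * norm_sq f i \<le> (\<Sum>\<xi>\<in>S. (cmod (fourier_coeff (\<nu> i) (f i) \<xi>))\<^sup>2) + 4 * \<delta>"
        using ci.parseval_lower[of "f i" "4 * \<delta>"] support[OF i f] \<delta> unfolding norm_sq_def \<Lambda>\<^sub>0_def by auto
      let ?T = "\<Sum>\<xi>\<in>\<Xi> ` (S \<times> {..<N}). (cmod (total_coeff f \<xi>))\<^sup>2"
      let ?E = "\<Sum>j\<in>I. norm_sq f j"
      have T: "(\<Sum>\<xi>\<in>S. \<Sum>m<N. (cmod (total_coeff f (\<Xi> (\<xi>, m))))\<^sup>2) = ?T"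
      proof -
        have "inj_on \<Xi> (S \<times> {..<N})" using inj_\<Xi>[of "{..<N}"] by (rule inj_on_subset) (use S in auto)
        then show ?thesis by (simp add: sum.reindex sum.cartesian_product)
      qed
      have HE: "(\<Sum>\<xi>\<in>S. \<Sum>m<N. \<Sum>j\<in>I - par. H j (\<xi>, m)) \<le> \<epsilon>1 * real N * ?E"
      proof -
        have "(\<Sum>\<xi>\<in>S. \<Sum>m<N. \<Sum>j\<in>I - par. H j (\<xi>, m)) = (\<Sum>p\<in>S \<times> {..<N}. \<Sum>j\<in>I - par. H j p)"
          using sum.cartesian_product[of "\<lambda>\<xi> m. \<Sum>j\<in>I - par. H j (\<xi>, m)" "{..<N}" S]
          by (simp add: case_prod_unfold)
        also have "\<dots> = (\<Sum>j\<in>I - par. \<Sum>p\<in>S \<times> {..<N}. H j p)" by (rule sum.swap)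
        also have "\<dots> \<le> (\<Sum>j\<in>I - par. \<epsilon>1 * real N * norm_sq f j)"
          unfolding H_def using transversal[OF _ f S(1,2)] by (intro sum_mono)
        also have "\<dots> \<le> (\<Sum>j\<in>I. \<epsilon>1 * real N * norm_sq f j)"
          using finite_I \<epsilon>1 by (intro sum_mono2) (auto simp: norm_sq_nonneg)
        finally show ?thesis by (simp add: sum_distrib_left)
      qed
      have "real N / 2 * (\<Sum>\<xi>\<in>S. (cmod (fourier_coeff (\<nu> i) (f i) \<xi>))\<^sup>2)
         \<le> (\<Sum>\<xi>\<in>S. 2 * (\<Sum>m<N. (cmod (total_coeff f (\<Xi> (\<xi>, m))))\<^sup>2) + 2 * real (card I) * (\<Sum>m<N. \<Sum>j\<in>I - par. H j (\<xi>, m)))"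
        unfolding sum_distrib_left[of "real N / 2"] using pw by (intro sum_mono) simp
      also have "\<dots> = 2 * ?T + 2 * real (card I) * (\<Sum>\<xi>\<in>S. \<Sum>m<N. \<Sum>j\<in>I - par. H j (\<xi>, m))"
        by (simp add: sum.distrib flip: T sum_distrib_left)
      also have "\<dots> \<le> 2 * ?T + 2 * real (card I) * (\<epsilon>1 * real N * ?E)"
        using HE by (intro add_left_mono mult_left_mono) auto
      also have "\<dots> = 2 * ?T + 2 * (\<epsilon> * real N * ?E)"
        using card_pos by (simp add: \<epsilon>1_def)
      \<comment> \<open>Enlarging \<open>?T\<close> to \<open>N * ?T\<close> gives away a factor,
        but then \<open>N\<close> cancels and the resulting constant does not depend on it.\<close>
      also have "\<dots> \<le> 2 * (real N * ?T) + 2 * (\<epsilon> * real N * ?E)"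
        using N(2) mult_right_mono[OF N(2), of ?T] by (simp add: sum_nonneg)
      finally have "real N * ((\<Sum>\<xi>\<in>S. (cmod (fourier_coeff (\<nu> i) (f i) \<xi>))\<^sup>2) / 4) \<le> real N * (?T + \<epsilon> * ?E)"
        by (simp add: algebra_simps)
      then have "(\<Sum>\<xi>\<in>S. (cmod (fourier_coeff (\<nu> i) (f i) \<xi>))\<^sup>2) / 4 \<le> ?T + \<epsilon> * ?E"
        using N(2) by simp
      then have "V * norm_sq f i \<le> ?T + \<epsilon> * ?E + \<delta>"
        using S(3) by (simp add: V_def)
      then show ?thesis
        using S by (intro exI[of _ "\<Xi> ` (S \<times> {..<N})"]) (auto simp: \<Lambda>_def)
    qed
    have "countable \<Lambda>" unfolding \<Lambda>_def using \<open>countable \<Lambda>\<^sub>0\<close> by auto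
    then show "\<exists>\<Lambda> B. countable \<Lambda> \<and> (\<forall>f. admissible f \<longrightarrow>
      (\<forall>S. finite S \<longrightarrow> S \<subseteq> \<Lambda> \<longrightarrow> (\<Sum>\<xi>\<in>S. (cmod (total_coeff f \<xi>))\<^sup>2) \<le> B * (\<Sum>j\<in>I. norm_sq f j)) \<and>
      (\<forall>\<delta>>0. \<exists>S. finite S \<and> S \<subseteq> \<Lambda> \<and>
         V * norm_sq f i \<le> (\<Sum>\<xi>\<in>S. (cmod (total_coeff f \<xi>))\<^sup>2) + \<epsilon> * (\<Sum>j\<in>I. norm_sq f j) + \<delta>))"
      using upper lower by blast
  qed
qed

end

section \<open>Assembling the facets\<close>

text \<open>Frequency sets of different hyperplanes may overlap; counting a point several times only
  increases a sum of nonnegative terms.\<close>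

lemma sum_Union_le:
  fixes g :: "'b \<Rightarrow> real"
  assumes "finite I" "finite S" "S \<subseteq> (\<Union>j\<in>I. \<Lambda> j)" "\<And>x. g x \<ge> 0"
  shows "(\<Sum>x\<in>S. g x) \<le> (\<Sum>j\<in>I. \<Sum>x\<in>S \<inter> \<Lambda> j. g x)"
proof -
  have "(\<Sum>x\<in>S. g x) \<le> (\<Sum>x\<in>S. \<Sum>j\<in>I. if x \<in> \<Lambda> j then g x else 0)"
  proof (rule sum_mono)
    fix x assume "x \<in> S"
    then obtain k where k: "k \<in> I" "x \<in> \<Lambda> k" using assms(3) by blast
    then have "(if x \<in> \<Lambda> k then g x else 0) \<le> (\<Sum>j\<in>I. if x \<in> \<Lambda> j then g x else 0)"
      using assms(1,4) by (intro member_le_sum) auto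
    then show "g x \<le> (\<Sum>j\<in>I. if x \<in> \<Lambda> j then g x else 0)" using k by simp
  qed
  also have "\<dots> = (\<Sum>j\<in>I. \<Sum>x\<in>S. if x \<in> \<Lambda> j then g x else 0)" by (rule sum.swap)
  also have "\<dots> = (\<Sum>j\<in>I. \<Sum>x\<in>S \<inter> \<Lambda> j. g x)" using assms(2) by (simp add: sum.inter_restrict)
  finally show ?thesis .
qed

context hyperplane_family
begin

lemma frame:
  assumes pos: "\<And>j. j \<in> I \<Longrightarrow> emeasure (\<nu> j) (ball 0 R) > 0"
  obtains \<Lambda> A B where "countable \<Lambda>" "0 < A" "A \<le> B"
    and "\<And>f. admissible f \<Longrightarrow> (\<lambda>\<xi>. (cmod (total_coeff f \<xi>))\<^sup>2) summable_on \<Lambda> \<and>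
       A * (\<Sum>j\<in>I. norm_sq f j) \<le> (\<Sum>\<^sub>\<infinity>\<xi>\<in>\<Lambda>. (cmod (total_coeff f \<xi>))\<^sup>2) \<and>
       (\<Sum>\<^sub>\<infinity>\<xi>\<in>\<Lambda>. (cmod (total_coeff f \<xi>))\<^sup>2) \<le> B * (\<Sum>j\<in>I. norm_sq f j)"
proof -
  define good where "good i V \<epsilon> \<Lambda> B \<longleftrightarrow> countable \<Lambda> \<and> (\<forall>f. admissible f \<longrightarrow>
      (\<forall>S. finite S \<longrightarrow> S \<subseteq> \<Lambda> \<longrightarrow> (\<Sum>\<xi>\<in>S. (cmod (total_coeff f \<xi>))\<^sup>2) \<le> B * (\<Sum>j\<in>I. norm_sq f j)) \<and>
      (\<forall>\<delta>>0. \<exists>S. finite S \<and> S \<subseteq> \<Lambda> \<and>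
         V * norm_sq f i \<le> (\<Sum>\<xi>\<in>S. (cmod (total_coeff f \<xi>))\<^sup>2) + \<epsilon> * (\<Sum>j\<in>I. norm_sq f j) + \<delta>))"
    for i and V \<epsilon> :: real and \<Lambda> and B :: real
  have "\<exists>V>0. \<forall>\<epsilon>>0. \<exists>\<Lambda> B. good i V \<epsilon> \<Lambda> B" if i: "i \<in> I" for i
  proof (rule partial_frame[OF i])
    fix V assume "emeasure (\<nu> i) (ball 0 R) > 0 \<Longrightarrow> V > 0"
      and V: "\<And>\<epsilon>. \<epsilon> > 0 \<Longrightarrow> \<exists>\<Lambda> B. countable \<Lambda> \<and> (\<forall>f. admissible f \<longrightarrow>
      (\<forall>S. finite S \<longrightarrow> S \<subseteq> \<Lambda> \<longrightarrow> (\<Sum>\<xi>\<in>S. (cmod (total_coeff f \<xi>))\<^sup>2) \<le> B * (\<Sum>j\<in>I. norm_sq f j)) \<and>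
      (\<forall>\<delta>>0. \<exists>S. finite S \<and> S \<subseteq> \<Lambda> \<and>
         V * norm_sq f i \<le> (\<Sum>\<xi>\<in>S. (cmod (total_coeff f \<xi>))\<^sup>2) + \<epsilon> * (\<Sum>j\<in>I. norm_sq f j) + \<delta>))"
    then have "V > 0" using pos[OF i] by blast
    moreover have "\<forall>\<epsilon>>0. \<exists>\<Lambda> B. good i V \<epsilon> \<Lambda> B" using V unfolding good_def by blast
    ultimately show ?thesis by blast
  qed
  then obtain V where V: "\<And>i. i \<in> I \<Longrightarrow> V i > 0" "\<And>i \<epsilon>. i \<in> I \<Longrightarrow> \<epsilon> > 0 \<Longrightarrow> \<exists>\<Lambda> B. good i (V i) \<epsilon> \<Lambda> B"
    by metis
  \<comment> \<open>The inserted 1 keeps \<open>Min\<close> meaningful when \<open>I\<close> is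
    empty.\<close>
  define V0 where "V0 = Min (insert 1 (V ` I))"
  have V0: "V0 > 0" "\<And>i. i \<in> I \<Longrightarrow> V0 \<le> V i"
    using V(1) finite_I by (auto simp: V0_def)
  \<comment> \<open>\<open>A\<close> serves both as the lower frame bound and as the error in
    \<open>good\<close>. With \<open>E\<close> the total norm and \<open>T\<close> the full sum,
    adding over \<open>I\<close> gives \<open>V0 * E \<le> (card I + 1) * (T + A * E)\<close>; as
    \<open>V0 = 2 * A * (card I + 1)\<close>, half of the left side absorbs the error.\<close>
  define A where "A = V0 / (2 * (real (card I) + 1))"
  have A: "A > 0" using V0 by (simp add: A_def)
  obtain \<Lambda> B where \<Lambda>: "\<And>i. i \<in> I \<Longrightarrow> good i (V i) A (\<Lambda> i) (B i)"
    using V(2)[OF _ A] by metis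
  \<comment> \<open>The bounds \<open>B i\<close> come without a sign, hence the absolute values;
    adding \<open>A\<close> secures \<open>A \<le> B'\<close>.\<close>
  define B' where "B' = (\<Sum>i\<in>I. \<bar>B i\<bar>) + A"
  define \<Lambda>' where "\<Lambda>' = (\<Union>i\<in>I. \<Lambda> i)"
  show ?thesis
  proof (rule that[of \<Lambda>' A B'])
    show "countable \<Lambda>'" unfolding \<Lambda>'_def using \<Lambda> finite_I
      by (intro countable_UN) (auto simp: good_def countable_finite)
    show "0 < A" by (rule A)
    show "A \<le> B'" by (simp add: B'_def sum_nonneg)
    fix f assume f: "admissible f"
    define g where "g \<xi> = (cmod (total_coeff f \<xi>))\<^sup>2" for \<xi>
    define E where "E = (\<Sum>j\<in>I. norm_sq f j)"
    have g0: "g \<xi> \<ge> 0" for \<xi> by (simp add: g_def)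
    have E0: "E \<ge> 0" by (simp add: E_def norm_sq_nonneg sum_nonneg)
    have up: "(\<Sum>\<xi>\<in>S. g \<xi>) \<le> B' * E" if S: "finite S" "S \<subseteq> \<Lambda>'" for S
    proof -
      have "(\<Sum>\<xi>\<in>S. g \<xi>) \<le> (\<Sum>i\<in>I. \<Sum>\<xi>\<in>S \<inter> \<Lambda> i. g \<xi>)"
        using finite_I S g0 unfolding \<Lambda>'_def by (rule sum_Union_le)
      also have "\<dots> \<le> (\<Sum>i\<in>I. B i * E)"
      proof (rule sum_mono)
        fix i assume "i \<in> I"
        then show "(\<Sum>\<xi>\<in>S \<inter> \<Lambda> i. g \<xi>) \<le> B i * E"
          using \<Lambda> f S(1) unfolding good_def g_def E_def by simp
      qed
      also have "\<dots> \<le> (\<Sum>i\<in>I. \<bar>B i\<bar> * E)" using E0 by (intro sum_mono mult_right_mono) auto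
      also have "\<dots> \<le> B' * E" using E0 A by (simp add: B'_def distrib_right sum_distrib_right)
      finally show ?thesis .
    qed
    have summable: "g summable_on \<Lambda>'"
      by (rule nonneg_bdd_above_summable_on) (use g0 up in \<open>auto simp: bdd_above_def\<close>)
    have le: "(\<Sum>\<^sub>\<infinity>\<xi>\<in>\<Lambda>'. g \<xi>) \<le> B' * E"
      by (rule infsum_le_finite_sums[OF summable up])
    have lower: "V0 * norm_sq f i \<le> (\<Sum>\<^sub>\<infinity>\<xi>\<in>\<Lambda>'. g \<xi>) + A * E" if i: "i \<in> I" for i
    proof (rule field_le_epsilon)
      fix \<delta> :: real assume "\<delta> > 0"
      then obtain S where S: "finite S" "S \<subseteq> \<Lambda> i" "V i * norm_sq f i \<le> (\<Sum>\<xi>\<in>S. g \<xi>) + A * E + \<delta>"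
        using \<Lambda>[OF i] f unfolding good_def g_def E_def by blast
      have "(\<Sum>\<xi>\<in>S. g \<xi>) \<le> (\<Sum>\<^sub>\<infinity>\<xi>\<in>\<Lambda>'. g \<xi>)"
        using S i by (intro finite_sum_le_infsum summable g0) (auto simp: \<Lambda>'_def)
      moreover have "V0 * norm_sq f i \<le> V i * norm_sq f i"
        by (intro mult_right_mono V0 i norm_sq_nonneg)
      ultimately show "V0 * norm_sq f i \<le> (\<Sum>\<^sub>\<infinity>\<xi>\<in>\<Lambda>'. g \<xi>) + A * E + \<delta>" using S(3) by linarith
    qed
    have T0: "(\<Sum>\<^sub>\<infinity>\<xi>\<in>\<Lambda>'. g \<xi>) \<ge> 0" by (intro infsum_nonneg g0)
    have VA: "V0 = A * (2 * (real (card I) + 1))" by (simp add: A_def)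
    have "V0 * E = (\<Sum>i\<in>I. V0 * norm_sq f i)" by (simp add: E_def sum_distrib_left)
    also have "\<dots> \<le> (\<Sum>i\<in>I. (\<Sum>\<^sub>\<infinity>\<xi>\<in>\<Lambda>'. g \<xi>) + A * E)" by (intro sum_mono lower)
    also have "\<dots> = real (card I) * ((\<Sum>\<^sub>\<infinity>\<xi>\<in>\<Lambda>'. g \<xi>) + A * E)" by simp
    also have "\<dots> \<le> (real (card I) + 1) * ((\<Sum>\<^sub>\<infinity>\<xi>\<in>\<Lambda>'. g \<xi>) + A * E)"
      using T0 A E0 by (intro mult_right_mono) auto
    finally have "(real (card I) + 1) * (2 * (A * E)) \<le> (real (card I) + 1) * ((\<Sum>\<^sub>\<infinity>\<xi>\<in>\<Lambda>'. g \<xi>) + A * E)"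
      by (simp add: VA mult_ac)
    then have "2 * (A * E) \<le> (\<Sum>\<^sub>\<infinity>\<xi>\<in>\<Lambda>'. g \<xi>) + A * E"
      by (rule mult_left_le_imp_le) simp
    then have ge: "A * E \<le> (\<Sum>\<^sub>\<infinity>\<xi>\<in>\<Lambda>'. g \<xi>)" by simp
    show "(\<lambda>\<xi>. (cmod (total_coeff f \<xi>))\<^sup>2) summable_on \<Lambda>' \<and>
       A * (\<Sum>j\<in>I. norm_sq f j) \<le> (\<Sum>\<^sub>\<infinity>\<xi>\<in>\<Lambda>'. (cmod (total_coeff f \<xi>))\<^sup>2) \<and>
       (\<Sum>\<^sub>\<infinity>\<xi>\<in>\<Lambda>'. (cmod (total_coeff f \<xi>))\<^sup>2) \<le> B' * (\<Sum>j\<in>I. norm_sq f j)"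
      using summable ge le unfolding g_def E_def by blast
  qed
qed

end

text \<open>Invariance passes to the restriction because \<open>a \<bullet> v = 0\<close> makes the
  hyperplane itself invariant under translation by \<open>v\<close>.\<close>

lemma hyperplane_measure_hausdorff:
  fixes a :: "'a::euclidean_space"
  assumes a: "a \<noteq> 0"
  shows "hyperplane_measure (density (hausdorff_measure (DIM('a) - 1)) (indicator {x. a \<bullet> x = c})) a c"
    (is "hyperplane_measure (density ?\<mu> (indicator ?H)) a c")
proof
  have H [measurable]: "?H \<in> sets borel" by measurable
  have em: "emeasure (density ?\<mu> (indicator ?H)) A = emeasure ?\<mu> (?H \<inter> A)" if "A \<in> sets borel" for A
    using that by (simp add: emeasure_density flip: indicator_inter_arith)
  show "sets (density ?\<mu> (indicator ?H)) = sets borel" by simp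
  show "AE x in density ?\<mu> (indicator ?H). a \<bullet> x = c"
    by (subst AE_density) (auto simp: indicator_def)
  show "emeasure (density ?\<mu> (indicator ?H)) B < \<infinity>" if B: "bounded B" "B \<in> sets borel" for B
  proof -
    have "emeasure ?\<mu> (?H \<inter> B) \<le> hausdorff_outer (DIM('a) - 1) (?H \<inter> B)"
      by (rule emeasure_hausdorff_measure_le)
    also have "\<dots> < \<infinity>" using a B(1) by (intro hausdorff_outer_hyperplane_finite[of a _ c]) auto
    finally show ?thesis using em[OF B(2)] by simp
  qed
  show "emeasure (density ?\<mu> (indicator ?H)) ((\<lambda>x. x + v) -` A) = emeasure (density ?\<mu> (indicator ?H)) A"
    if v: "a \<bullet> v = 0" and A: "A \<in> sets borel" for v A
  proof -
    have shift: "?H \<inter> (\<lambda>x. x + v) -` A = (+) (- v) ` (?H \<inter> A)"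
    proof (intro subset_antisym subsetI)
      fix x assume "x \<in> ?H \<inter> (\<lambda>x. x + v) -` A"
      then have "x + v \<in> ?H \<inter> A" using v by (simp add: inner_add_right)
      then show "x \<in> (+) (- v) ` (?H \<inter> A)" by (rule rev_image_eqI) simp
    qed (use v in \<open>auto simp: inner_diff_right inner_add_right\<close>)
    have "emeasure (density ?\<mu> (indicator ?H)) ((\<lambda>x. x + v) -` A) = emeasure ?\<mu> (?H \<inter> (\<lambda>x. x + v) -` A)"
      using measurable_sets[of "\<lambda>x. x + v" borel borel A] A by (intro em) simp
    also have "\<dots> = emeasure ?\<mu> (?H \<inter> A)"
      unfolding shift using A by (intro emeasure_hausdorff_measure_translation) simp
    also have "\<dots> = emeasure (density ?\<mu> (indicator ?H)) A"
      by (rule em[OF A, symmetric])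
    finally show ?thesis .
  qed
qed fact

theorem theorem1p5:
  fixes K :: "'a::euclidean_space set"
  assumes "general_polytope K"
  shows "frame_spectral (surface_measure K)"
proof -
  let ?\<mu> = "hausdorff_measure (DIM('a) - 1) :: 'a measure"
  obtain \<F> where bK: "bounded K" and \<F>: "finite \<F>" "\<And>F. F \<in> \<F> \<Longrightarrow> polytope_facet F" "frontier K = \<Union>\<F>"
    using assms unfolding general_polytope_def
    by (elim exE conjE) (rule that; (assumption | erule (1) bspec))
  have "\<forall>F\<in>\<F>. \<exists>a b. a \<noteq> 0 \<and> F \<subseteq> {x. a \<bullet> x = b}"
    using \<F>(2) unfolding polytope_facet_def by blast
  then obtain \<alpha> \<beta> where \<alpha>: "\<And>F. F \<in> \<F> \<Longrightarrow> \<alpha> F \<noteq> 0" "\<And>F. F \<in> \<F> \<Longrightarrow> F \<subseteq> {x. \<alpha> F \<bullet> x = \<beta> F}"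
    by metis
  have F_borel: "F \<in> sets borel" and F_pos: "emeasure ?\<mu> F > 0" and F_bdd: "bounded F" if "F \<in> \<F>" for F
    using \<F>(2)[OF that] by (auto simp: polytope_facet_def)
  \<comment> \<open>Facets are grouped by their hyperplane as a set, since facets in a common
    hyperplane may come with different equations; one equation per hyperplane is then chosen
    anew.\<close>
  define h where "h F = {x. \<alpha> F \<bullet> x = \<beta> F}" for F
  define I where "I = h ` \<F>"
  have finite_I: "finite I" using \<F>(1) by (simp add: I_def)
  have "\<forall>H\<in>I. \<exists>a c. a \<noteq> 0 \<and> H = {x. a \<bullet> x = c}" using \<alpha>(1) by (auto simp: I_def h_def)
  then obtain a c where a: "\<And>H. H \<in> I \<Longrightarrow> a H \<noteq> 0" "\<And>H. H \<in> I \<Longrightarrow> H = {x. a H \<bullet> x = c H}"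
    by metis
  have H_borel: "H \<in> sets borel" if "H \<in> I" for H
    by (subst a(2)[OF that]) measurable
  define \<nu> where "\<nu> H = density ?\<mu> (indicator H)" for H
  obtain R where R: "R > 0" "frontier K \<subseteq> ball 0 R"
    using bounded_subset_ballD[of "frontier K" 0] bounded_diff[OF bounded_closure[OF bK]]
    unfolding frontier_def by blast
  interpret hyperplane_family I \<nu> a c R
  proof (rule hyperplane_family.intro)
    show "finite I" by fact
    show "hyperplane_measure (\<nu> j) (a j) (c j)" if "j \<in> I" for j
      unfolding \<nu>_def using hyperplane_measure_hausdorff[OF a(1)[OF that], of "c j"] a(2)[OF that] by simp
    show "inj_on (\<lambda>j. {x. a j \<bullet> x = c j}) I" using a(2) by (simp add: inj_on_def)
  qed (rule R)
  have em: "emeasure (\<nu> H) A = emeasure ?\<mu> (H \<inter> A)" if "H \<in> I" "A \<in> sets borel" for H A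
    using that H_borel[of H] by (simp add: \<nu>_def emeasure_density flip: indicator_inter_arith)
  have pos: "emeasure (\<nu> H) (ball 0 R) > 0" if H: "H \<in> I" for H
  proof -
    obtain F where F: "F \<in> \<F>" "H = h F" using H by (auto simp: I_def)
    have "F \<subseteq> H \<inter> ball 0 R" using \<alpha>(2)[OF F(1)] F R(2) \<F>(3) by (auto simp: h_def)
    then have "emeasure ?\<mu> F \<le> emeasure ?\<mu> (H \<inter> ball 0 R)"
      using H_borel[OF H] by (intro emeasure_mono) auto
    then show ?thesis using F_pos[OF F(1)] H by (simp add: em)
  qed

  define E0 where "E0 H = \<Union>{F \<in> \<F>. h F = H}" for H
  \<comment> \<open>Pieces in different hyperplanes can meet. Removing what belongs to an earlier
    hyperplane, in an enumeration of \<open>I\<close>, makes the indicators add up to that of the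
    boundary at every point.\<close>
  define E where "E H = E0 H - (\<Union>H'\<in>{H' \<in> I. to_nat_on I H' < to_nat_on I H}. E0 H')" for H
  have E0_borel: "E0 H \<in> sets borel" for H
    unfolding E0_def using \<F>(1) F_borel by (intro sets.finite_Union) auto
  have E_borel: "E H \<in> sets borel" for H
    unfolding E_def using finite_I E0_borel by (intro sets.Diff sets.finite_UN) auto
  have E_sub: "E H \<subseteq> H" for H
    using \<alpha>(2) by (auto simp: E_def E0_def h_def)
  have E_frontier: "E H \<subseteq> frontier K" for H by (auto simp: E_def E0_def \<F>(3))
  have E_indicator: "(\<Sum>H\<in>I. indicator (E H) x) = (indicator (frontier K) x :: real)" for x
  proof (cases "x \<in> frontier K")
    case False
    then have "x \<notin> E H" for H using E_frontier by blast
    then show ?thesis using False by simp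
  next
    case True
    then have ex: "\<exists>n. \<exists>H\<in>I. x \<in> E0 H \<and> to_nat_on I H = n" by (auto simp: \<F>(3) I_def E0_def)
    then obtain H where H: "H \<in> I" "x \<in> E0 H"
        "to_nat_on I H = (LEAST n. \<exists>H\<in>I. x \<in> E0 H \<and> to_nat_on I H = n)"
      using LeastI_ex[OF ex] by blast
    have least: "to_nat_on I H \<le> to_nat_on I H'" if "H' \<in> I" "x \<in> E0 H'" for H'
      unfolding H(3) using that by (intro Least_le) blast
    have "x \<in> E H' \<longleftrightarrow> H' = H" if H': "H' \<in> I" for H'
    proof
      assume "H' = H"
      then show "x \<in> E H'" using H least by (force simp: E_def)
    next
      assume x: "x \<in> E H'"
      then have "to_nat_on I H \<le> to_nat_on I H'" using least[OF H'] by (auto simp: E_def)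
      moreover have "\<not> to_nat_on I H < to_nat_on I H'" using x H by (auto simp: E_def)
      ultimately have "to_nat_on I H = to_nat_on I H'" by simp
      then show "H' = H" using H(1) H' finite_I by (simp add: countable_finite)
    qed
    then have "(\<Sum>H'\<in>I. indicator (E H') x) = (\<Sum>H'\<in>I. if H' = H then 1 else (0::real))"
      by (intro sum.cong) (auto simp: indicator_def)
    then show ?thesis using H(1) finite_I True by simp
  qed

  let ?\<sigma> = "surface_measure K"
  have fr_borel: "frontier K \<in> sets borel" by simp
  have sets_\<sigma>: "sets ?\<sigma> = sets borel" by (simp add: surface_measure_def)
  have \<sigma>_int: "(\<integral>x. g x \<partial>?\<sigma>) = (\<integral>x. indicator (frontier K) x *\<^sub>R g x \<partial>?\<mu>)"
    if "g \<in> borel_measurable borel" for g :: "'a \<Rightarrow> 'b::{banach, second_countable_topology}"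
    unfolding surface_measure_def by (rule integral_density_indicator) (use that in \<open>simp_all cong: measurable_cong_sets\<close>)
  have \<nu>_int: "(\<integral>x. indicator (E H) x *\<^sub>R g x \<partial>\<nu> H) = (\<integral>x. indicator (E H) x *\<^sub>R g x \<partial>?\<mu>)"
    if "H \<in> I" "g \<in> borel_measurable borel" for H and g :: "'a \<Rightarrow> 'b::{banach, second_countable_topology}"
  proof -
    have "(\<integral>x. indicator (E H) x *\<^sub>R g x \<partial>\<nu> H) = (\<integral>x. indicator H x *\<^sub>R indicator (E H) x *\<^sub>R g x \<partial>?\<mu>)"
      unfolding \<nu>_def using that E_borel H_borel by (intro integral_density_indicator) (simp_all cong: measurable_cong_sets)
    also have "\<dots> = (\<integral>x. indicator (E H) x *\<^sub>R g x \<partial>?\<mu>)"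
      using E_sub[of H] by (intro Bochner_Integration.integral_cong) (auto simp: indicator_def)
    finally show ?thesis .
  qed
  have \<sigma>_integrable: "integrable ?\<sigma> g \<longleftrightarrow> integrable ?\<mu> (\<lambda>x. indicator (frontier K) x *\<^sub>R g x)"
    if "g \<in> borel_measurable borel" for g :: "'a \<Rightarrow> 'b::{banach, second_countable_topology}"
    unfolding surface_measure_def
    using integrable_density[of g ?\<mu> "indicator (frontier K) :: 'a \<Rightarrow> real"] that
    by (simp add: ennreal_indicator cong: measurable_cong_sets)
  have E_integrable: "integrable ?\<mu> (\<lambda>x. indicator (E H) x *\<^sub>R g x)"
    if "integrable ?\<sigma> g" "g \<in> borel_measurable borel" for H and g :: "'a \<Rightarrow> 'b::{banach, second_countable_topology}"
  proof -
    have "integrable ?\<mu> (\<lambda>x. indicator (E H) x *\<^sub>R (indicator (frontier K) x *\<^sub>R g x))"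
      using that E_borel \<sigma>_integrable[of g] by (intro integrable_mult_indicator[of "E H"]) auto
    moreover have "indicator (E H) x *\<^sub>R (indicator (frontier K) x *\<^sub>R g x) = indicator (E H) x *\<^sub>R g x" for x
      using E_frontier[of H] by (auto simp: indicator_def)
    ultimately show ?thesis by (simp only:)
  qed
  have split: "(\<integral>x. g x \<partial>?\<sigma>) = (\<Sum>H\<in>I. \<integral>x. indicator (E H) x *\<^sub>R g x \<partial>\<nu> H)"
    if g: "integrable ?\<sigma> g" "g \<in> borel_measurable borel" for g :: "'a \<Rightarrow> 'b::{banach, second_countable_topology}"
  proof -
    have "(\<integral>x. g x \<partial>?\<sigma>) = (\<integral>x. (\<Sum>H\<in>I. indicator (E H) x *\<^sub>R g x) \<partial>?\<mu>)"
      unfolding \<sigma>_int[OF g(2)] by (simp add: E_indicator flip: scaleR_left.sum)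
    also have "\<dots> = (\<Sum>H\<in>I. \<integral>x. indicator (E H) x *\<^sub>R g x \<partial>?\<mu>)"
      by (rule Bochner_Integration.integral_sum) (rule E_integrable[OF g])
    also have "\<dots> = (\<Sum>H\<in>I. \<integral>x. indicator (E H) x *\<^sub>R g x \<partial>\<nu> H)"
      by (rule sum.cong[OF refl], rule sym, rule \<nu>_int[OF _ g(2)])
    finally show ?thesis .
  qed
  \<comment> \<open>Finiteness makes square-integrable functions integrable, so that the integral
    defining a Fourier coefficient splits over the hyperplanes.\<close>
  have fin: "finite_measure ?\<sigma>"
  proof (rule finite_measureI)
    have "emeasure ?\<sigma> (space ?\<sigma>) = emeasure ?\<mu> (\<Union>F\<in>\<F>. F)"
      unfolding surface_measure_def using fr_borel
      by (subst emeasure_density) (auto intro!: borel_measurable_indicator simp: \<F>(3)[symmetric])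
    also have "\<dots> \<le> (\<Sum>F\<in>\<F>. emeasure ?\<mu> F)"
      using \<F>(1) F_borel by (intro emeasure_subadditive_finite) auto
    also have "\<dots> < \<infinity>"
    proof -
      have "emeasure ?\<mu> F < \<infinity>" if "F \<in> \<F>" for F
        using emeasure_hausdorff_measure_le[of "DIM('a) - 1" F]
          hausdorff_outer_hyperplane_finite[OF \<alpha>(1)[OF that] F_bdd[OF that] \<alpha>(2)[OF that]]
        by (rule le_less_trans)
      then show ?thesis using \<F>(1) by simp
    qed
    finally show "emeasure ?\<sigma> (space ?\<sigma>) \<noteq> \<infinity>" by simp
  qed

  \<comment> \<open>The component of \<open>f\<close> on each hyperplane. Fourier coefficients add
    up to those of \<open>f\<close>, and so do the squared norms because the pieces are disjoint;
    thus the frame inequality of the family is that of the surface measure.\<close>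
  define part where "part f H x = indicator (E H) x *\<^sub>R f x" for f :: "'a \<Rightarrow> complex" and H x
  have part: "admissible (part f) \<and> (\<forall>\<xi>. total_coeff (part f) \<xi> = fourier_coeff ?\<sigma> f \<xi>) \<and>
      (\<Sum>H\<in>I. norm_sq (part f) H) = (\<integral>x. (cmod (f x))\<^sup>2 \<partial>?\<sigma>)" if f: "square_integrable ?\<sigma> f" for f
  proof (intro conjI allI)
    have fm [measurable]: "f \<in> borel_measurable borel"
      using f sets_\<sigma> by (simp add: square_integrable_def cong: measurable_cong_sets)
    have f2: "integrable ?\<sigma> (\<lambda>x. (cmod (f x))\<^sup>2)" using f by (simp add: square_integrable_def)
    have sq: "(cmod (part f H x))\<^sup>2 = indicator (E H) x *\<^sub>R (cmod (f x))\<^sup>2" for H x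
      by (simp add: part_def indicator_def)
    show "(\<Sum>H\<in>I. norm_sq (part f) H) = (\<integral>x. (cmod (f x))\<^sup>2 \<partial>?\<sigma>)"
      unfolding norm_sq_def sq by (rule split[symmetric]) (use f2 in auto)
    show "total_coeff (part f) \<xi> = fourier_coeff ?\<sigma> f \<xi>" for \<xi>
    proof -
      have "integrable ?\<sigma> (\<lambda>x. f x * character \<xi> x)"
        by (intro integrable_mult_character square_integrable_integrable[OF fin f] sets_\<sigma>)
      then have "fourier_coeff ?\<sigma> f \<xi> = (\<Sum>H\<in>I. \<integral>x. indicator (E H) x *\<^sub>R (f x * character \<xi> x) \<partial>\<nu> H)"
        unfolding fourier_coeff_character by (rule split) measurable
      then show ?thesis by (simp add: total_coeff_def fourier_coeff_character part_def)
    qed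
    show "admissible (part f)"
      unfolding admissible_def
    proof (intro ballI conjI allI impI)
      fix H assume H: "H \<in> I"
      have "integrable (\<nu> H) (\<lambda>x. (cmod (part f H x))\<^sup>2)"
      proof -
        have "integrable ?\<mu> (\<lambda>x. indicator H x *\<^sub>R indicator (E H) x *\<^sub>R (cmod (f x))\<^sup>2)"
          using E_integrable[OF f2, of H] H_borel[OF H] by (intro integrable_mult_indicator[of H]) simp_all
        then show ?thesis
          using integrable_density[of "\<lambda>x. (cmod (part f H x))\<^sup>2" ?\<mu> "indicator H :: 'a \<Rightarrow> real"] E_borel H_borel[OF H]
          by (simp add: sq \<nu>_def ennreal_indicator cong: measurable_cong_sets)
      qed
      moreover have "part f H \<in> borel_measurable (\<nu> H)"
        unfolding part_def[abs_def] \<nu>_def using E_borel by (simp cong: measurable_cong_sets)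
      ultimately show "square_integrable (\<nu> H) (part f H)" by (simp add: square_integrable_def)
      fix x assume "part f H x \<noteq> 0"
      then have "x \<in> E H" by (auto simp: part_def indicator_def split: if_splits)
      then show "x \<in> ball 0 R" using E_frontier R(2) by blast
    qed
  qed
  show ?thesis
  proof (rule frame[OF pos])
    fix \<Lambda> A B assume *: "countable \<Lambda>" "0 < A" "A \<le> B"
      "\<And>f. admissible f \<Longrightarrow> (\<lambda>\<xi>. (cmod (total_coeff f \<xi>))\<^sup>2) summable_on \<Lambda> \<and>
       A * (\<Sum>j\<in>I. norm_sq f j) \<le> (\<Sum>\<^sub>\<infinity>\<xi>\<in>\<Lambda>. (cmod (total_coeff f \<xi>))\<^sup>2) \<and>
       (\<Sum>\<^sub>\<infinity>\<xi>\<in>\<Lambda>. (cmod (total_coeff f \<xi>))\<^sup>2) \<le> B * (\<Sum>j\<in>I. norm_sq f j)"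
    have "(\<lambda>\<xi>. (cmod (fourier_coeff ?\<sigma> f \<xi>))\<^sup>2) summable_on \<Lambda> \<and>
       A * (\<integral>x. (cmod (f x))\<^sup>2 \<partial>?\<sigma>) \<le> (\<Sum>\<^sub>\<infinity>\<xi>\<in>\<Lambda>. (cmod (fourier_coeff ?\<sigma> f \<xi>))\<^sup>2) \<and>
       (\<Sum>\<^sub>\<infinity>\<xi>\<in>\<Lambda>. (cmod (fourier_coeff ?\<sigma> f \<xi>))\<^sup>2) \<le> B * (\<integral>x. (cmod (f x))\<^sup>2 \<partial>?\<sigma>)"
      if "square_integrable ?\<sigma> f" for f
      using part[OF that] *(4)[of "part f"] by simp
    then show ?thesis unfolding frame_spectral_def using *(1-3) by blast
  qed
qed

end
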